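(* Let $n\in\mathbb{N}$, $n>2$, and let $\mu_1,\dots,\mu_n$ be Borel probability measures on $\mathbb{R}$ that increase in convex order. Let $c:\mathbb{R}^n\to(-\infty,\infty]$ be lower semi-continuous and such that, for some $K\in\mathbb{R}$, $c(x_1,\dots,x_n)\ge -K(1+|x_1|+\dots+|x_n|)$ for all $x_1,\dots,x_n\in\mathbb{R}$. Assume additionally that there exists some $\mathbb{Q}'\in\mathcal{M}(\mu_1,\dots,\mu_n)$ such that $\mathbb{E}_{\mathbb{Q}'}[c(S_1,\dots,S_n)]<\infty$. For $u_i\in L^1(\mu_i)$, $i=2,\dots,n$, and $x_1,\dots,x_n\in\mathbb{R}$ set $$c_n(u_2,\dots,u_n,x_1,\dots,x_n):=c(x_1,\dots,x_n)-\sum_{i=2}^n u_i(x_i),$$ and define inductively for $i=n-1,\dots,1$ $$c_i(u_2,\dots,u_n,x_1,\dots,x_i):=\Big(c_{i+1}(u_2,\dots,u_n,x_1,\dots,x_i,\,\cdot\,)\Big)^{**}(x_i),$$ i.e. the convex biconjugate of the one-variable function $y\mapsto c_{i+1}(u_2,\dots,u_n,x_1,\dots,x_i,y)$, evaluated at $y=x_i$. Then $$\inf_{\mathbb{Q}\in\mathcal{M}(\mu_1,\dots,\mu_n)}\mathbb{E}_{\mathbb{Q}}[c(S_1,S_2,\dots,S_n)]=\sup_{u_i\in L^1(\mu_i),\ i=2,\dots,n}\left(\mathbb{E}_{\mu_1}\big[c_1(u_2,\dots,u_n,S_1)\big]+\sum_{i=2}^n\mathbb{E}_{\mu_i}[u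_i(S_i)]\right).$$
   Context: $S_i:\mathbb{R}^n\to\mathbb{R}$, $S_i(x_1,\dots,x_n):=x_i$, denotes the canonical process on $\mathbb{R}^n$. For a measure $\mathbb{Q}$ on $\mathbb{R}^n$, $\mathbb{E}_{\mathbb{Q}}$ is the expectation under $\mathbb{Q}$; $\mathbb{E}_{\mu_i}[g(S_i)]:=\int_{\mathbb{R}} g(x)\,\mathrm{d}\mu_i(x)$. $\Pi(\mu_1,\dots,\mu_n)$ is the set of all Borel probability measures on $\mathbb{R}^n$ with marginals $\mu_1,\dots,\mu_n$, and $\mathcal{M}(\mu_1,\dots,\mu_n)$ is the set of martingale measures with these marginals: $$\mathcal{M}(\mu_1,\dots,\mu_n):=\Big\{\mathbb{Q}\in\Pi(\mu_1,\dots,\mu_n)\ \Big|\ \int_{\mathbb{R}^n}H(x_1,\dots,x_i)(x_{i+1}-x_i)\,\mathrm{d}\mathbb{Q}(x_1,\dots,x_n)=0\ \text{ for all continuous bounded } H:\mathbb{R}^i\to\mathbb{R},\ i=1,\dots,n-1\Big\}.$$ "Increase in convex order" means that the $\mu_i$ have finite first moments and $\int \varphi\,\mathrm{d}\mu_i\le\int\varphi\,\mathrm{d}\mu_{i+1}$ for every convex $\varphi:\mathbb{R}\to\mathbb{R}$ and $i=1,\dots,n-1$; this guarantees that $\mathcal{M}(\mu_1,\dots,\mu_n)$ is non-empty. $L^1(\mu_i)$ is understood as the set of $\mu_i$-integrable functions $u_i:\mathbb{R}\to\mathbb{R}$ (actual functions, evaluated pointwise). Convex biconjugate: for a function $f$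 on $\mathbb{R}$, $f^{**}$ is the largest lower semi-continuous and convex function smaller than or equal to $f$, i.e. for $x\in\mathbb{R}$ $$f^{**}(x):=\sup\{h(x)\ |\ h:\mathbb{R}\to\mathbb{R}\text{ lower semi-continuous and convex},\ h(y)\le f(y)\text{ for all }y\in\mathbb{R}\}.$$ The functions $c_i$ are regarded as extended-real-valued, with the convention $\sup\emptyset=-\infty$. *)

theory Defs
  imports "HOL-Probability.Probability"
begin

text \<open>
  \<open>\<real>\<^sup>i\<close> is rendered as the set of functions \<^typ>\<open>nat \<Rightarrow> real\<close> that are extensional on \<open>{1..i}\<close>.
  It is both the topological space \<^term>\<open>powertop_real {1..i}\<close> and the measurable space
  \<open>PiM {1..i} (\<lambda>_. borel)\<close>; the point \<open>(x\<^sub>1, \<dots>, x\<^sub>i, y)\<close> is \<open>x(Suc i := y)\<close>. Functions on \<open>\<real>\<^sup>i\<close>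
  are total on \<^typ>\<open>nat \<Rightarrow> real\<close> but only their values at such points matter.
\<close>

abbreviation R_space :: "nat \<Rightarrow> (nat \<Rightarrow> real) set" where
  "R_space i \<equiv> (\<Pi>\<^sub>E k\<in>{1..i}. UNIV)"

definition lower_semicontinuous_map :: "'a topology \<Rightarrow> ('a \<Rightarrow> 'b::linorder) \<Rightarrow> bool" where
  "lower_semicontinuous_map X f \<longleftrightarrow> (\<forall>a. openin X {x \<in> topspace X. a < f x})"

text \<open>
  Expectation of an extended-real function: integral of the positive part minus integral of the
  negative part. Whenever one of these two is finite this is the usual extended integral; note
  that \<open>\<infinity> - \<infinity> = \<infinity>\<close> in \<^typ>\<open>ereal\<close>. Since \<^const>\<open>nn_integral\<close> is unchanged when the measure is
  completed (\<open>nn_integral_completion\<close>), functions that are measurable for the completion of \<open>M\<close>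
  only, such as the convex biconjugates below, get their integral with respect to the completion.
\<close>

definition ereal_expectation :: "'a measure \<Rightarrow> ('a \<Rightarrow> ereal) \<Rightarrow> ereal" where
  "ereal_expectation M f =
     enn2ereal (\<integral>\<^sup>+ x. e2ennreal (f x) \<partial>M) - enn2ereal (\<integral>\<^sup>+ x. e2ennreal (- f x) \<partial>M)"

text \<open>
  \<open>\<integral> \<phi> d\<mu>\<^sub>i\<close> may be \<open>\<infinity>\<close>; it is never \<open>-\<infinity>\<close>, because \<open>\<phi>\<close> has an affine minorant and \<open>\<mu>\<^sub>i\<close> a finite
  first moment.
\<close>

definition increasing_convex_order :: "nat \<Rightarrow> (nat \<Rightarrow> real measure) \<Rightarrow> bool" where
  "increasing_convex_order n \<mu> \<longleftrightarrow>
     (\<forall>i\<in>{1..n}. integrable (\<mu> i) (\<lambda>x. x)) \<and>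
     (\<forall>i\<in>{1..n - 1}. \<forall>\<phi>::real \<Rightarrow> real. convex_on UNIV \<phi> \<longrightarrow>
        ereal_expectation (\<mu> i) (\<lambda>x. ereal (\<phi> x)) \<le>
        ereal_expectation (\<mu> (Suc i)) (\<lambda>x. ereal (\<phi> x)))"

definition couplings :: "nat \<Rightarrow> (nat \<Rightarrow> real measure) \<Rightarrow> (nat \<Rightarrow> real) measure set" where
  "couplings n \<mu> = {Q. prob_space Q \<and> sets Q = sets (PiM {1..n} (\<lambda>_. borel :: real measure)) \<and>
     (\<forall>i\<in>{1..n}. distr Q borel (\<lambda>x. x i) = \<mu> i)}"

text \<open>
  \<^const>\<open>has_bochner_integral\<close> rather than an equation about \<^const>\<open>lebesgue_integral\<close>, which is
  \<open>0\<close> for non-integrable functions as well.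
\<close>

definition martingale_measures :: "nat \<Rightarrow> (nat \<Rightarrow> real measure) \<Rightarrow> (nat \<Rightarrow> real) measure set" where
  "martingale_measures n \<mu> = {Q \<in> couplings n \<mu>.
     \<forall>i\<in>{1..n - 1}. \<forall>H::(nat \<Rightarrow> real) \<Rightarrow> real.
       continuous_map (powertop_real {1..i}) euclideanreal H \<and> bounded (H ` R_space i) \<longrightarrow>
       has_bochner_integral Q (\<lambda>x. H (restrict x {1..i}) * (x (Suc i) - x i)) 0}"

text \<open>The supremum of the empty set in \<^typ>\<open>ereal\<close> is \<open>-\<infinity>\<close>.\<close>

definition convex_biconjugate :: "(real \<Rightarrow> ereal) \<Rightarrow> real \<Rightarrow> ereal" where
  "convex_biconjugate f x = Sup {ereal (h x) | h :: real \<Rightarrow> real.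
     lower_semicontinuous_map euclideanreal h \<and> convex_on UNIV h \<and> (\<forall>y. ereal (h y) \<le> f y)}"

text \<open>
  \<open>c_iter c n u i x\<close> is \<open>c\<^sub>i(u\<^sub>2, \<dots>, u\<^sub>n, x\<^sub>1, \<dots>, x\<^sub>i)\<close>, for \<open>1 \<le> i \<le> n\<close> and \<open>x \<in> R_space i\<close>; the value
  for \<open>i > n\<close> is a dummy.
\<close>

function c_iter ::
  "((nat \<Rightarrow> real) \<Rightarrow> ereal) \<Rightarrow> nat \<Rightarrow> (nat \<Rightarrow> real \<Rightarrow> real) \<Rightarrow> nat \<Rightarrow> (nat \<Rightarrow> real) \<Rightarrow> ereal" where
  "c_iter c n u i x =
     (if n \<le> i then c x - ereal (\<Sum>j = 2..n. u j (x j))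
      else convex_biconjugate (\<lambda>y. c_iter c n u (Suc i) (x(Suc i := y))) (x i))"
  by pat_completeness auto
termination
  by (relation "Wellfounded.measure (\<lambda>(c, n, u, i, x). n - i)") auto

declare c_iter.simps [simp del]

end

theory Submission
  imports Defs
begin

text \<open>
  Both inequalities compare the value \<open>c\<^sub>1\<close> of the iterated biconjugates with conditional expectations
  under martingale measures.

  \<^bold>\<open>The dual value is at most the primal value.\<close> Let \<open>Q\<close> be a martingale measure with marginals
  \<open>\<mu>\<^sub>1, \<dots>, \<mu>\<^sub>n\<close>. If \<open>c\<^sub>i\<^sub>+\<^sub>1\<close> is almost surely at most a measurable function \<open>g\<close>, then for almost every
  \<open>x\<close> the law of \<open>S\<^sub>i\<^sub>+\<^sub>1\<close> given \<open>(S\<^sub>1, \<dots>, S\<^sub>i) = x\<close> has mean \<open>x\<^sub>i\<close>, and Jensen's inequality for each convex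
  minorant \<open>h\<close> of \<open>c\<^sub>i\<^sub>+\<^sub>1(x, \<cdot>)\<close> gives \<open>h(x\<^sub>i) \<le> E[g | S\<^sub>1, \<dots>, S\<^sub>i](x)\<close>. Hence \<open>c\<^sub>i\<close> is dominated by the
  conditional expectation of \<open>g\<close>, and going down to \<open>i = 1\<close> yields \<open>E c\<^sub>1 \<le> E c - \<Sum> E u\<^sub>i\<close>. The minorants
  range over an uncountable family, so the argument must be made pointwise in \<open>x\<close>, with genuine
  conditional laws; \<open>quantile_transform\<close> provides them. The biconjugates may fail to be Borel
  measurable, so they are squeezed between measurable functions throughout.

  \<^bold>\<open>The primal value is at most the dual value.\<close> An affine minorant of \<open>c\<^sub>i\<^sub>+\<^sub>1(x, \<cdot>)\<close>, evaluated at \<open>x\<^sub>i\<close>,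
  is a lower bound of \<open>c\<^sub>i(x)\<close>. So if
  \<open>\<Sum> u\<^sub>i(x\<^sub>i) + \<Sum> \<Delta>\<^sub>i(x\<^sub>1, \<dots>, x\<^sub>i) (x\<^sub>i\<^sub>+\<^sub>1 - x\<^sub>i) \<le> c(x)\<close> for all \<open>x\<close>, then \<open>u\<^sub>1 \<le> c\<^sub>1(u\<^sub>2, \<dots>, u\<^sub>n, \<cdot>)\<close>
  (\<open>subhedge_le_c_iter\<close>), and it is enough to find such semistatic subhedges of price close to the
  primal value. They come from a penalisation argument, for which
  \<open>c\<close> may be taken nonnegative after adding a multiple of \<open>1 + \<Sum> \<bar>x\<^sub>i\<bar>\<close>. Countably many test inequalities
  \<open>E f\<^sub>k \<le> 0\<close> characterise the martingale measures with the given marginals. Among finitely supported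
  probabilities \<open>q\<close> consider the smooth convex functional
  \<open>E\<^sub>q c + (N + 1) \<Sum>\<^sub>k\<^sub><\<^sub>N max(0, E\<^sub>q f\<^sub>k)\<^sup>2\<close>. If it took values \<open>\<le> p\<close> for every \<open>N\<close>, then a
  subsequential limit would be a martingale measure of cost at most \<open>p\<close>
  (\<open>martingale_measure_of_penalized_sequence\<close>). So for \<open>p\<close> below the primal value some \<open>N\<close> has
  all values above \<open>p\<close>, and the first-order condition at a near-minimiser, tested against Dirac masses,
  says that \<open>c + \<Sum> \<lambda>\<^sub>k f\<^sub>k \<ge> p\<close> up to a small error, with \<open>\<lambda>\<^sub>k\<close> proportional to
  \<open>max(0, E\<^sub>q f\<^sub>k)\<close> (\<open>approximate_multipliers\<close>). Each \<open>f\<^sub>k\<close> is semistatic of price \<open>0\<close>, so this is the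
  wanted subhedge.

  Weak limits in several dimensions are reduced to the real line: all coordinates of a vector are encoded
  in the digits of one real number, Helly's and Skorohod's theorems are applied there, and decoding is
  continuous along encoded sequences (\<open>almost_sure_representation\<close>).
\<close>

section \<open>Approximate Lagrange multipliers from a quadratic penalty\<close>

lemma pmf_expectation_mix:
  fixes g :: "'a \<Rightarrow> real"
  assumes "finite (set_pmf q)" "0 \<le> s" "s \<le> 1"
  shows "measure_pmf.expectation (bernoulli_pmf s \<bind> (\<lambda>b. if b then return_pmf x else q)) g
    = s * g x + (1 - s) * measure_pmf.expectation q g"
  using assms by (subst pmf_expectation_bind[where A = UNIV]) (auto simp: UNIV_bool)

text \<open>
  The first-order condition for the functional \<open>J q = E\<^sub>q c + N \<Sum>\<^sub>k max(0, E\<^sub>q f\<^sub>k)\<^sup>2\<close> at a near-minimiser \<open>q\<close>,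
  in the direction of the Dirac mass at \<open>x\<close>. Moving a weight \<open>s\<close> from \<open>q\<close> to \<open>x\<close> changes \<open>J\<close> to first order
  by \<open>s\<close> times \<open>c x + \<Sum> l\<^sub>k f\<^sub>k x - const\<close> with \<open>l\<^sub>k = 2 N max(0, E\<^sub>q f\<^sub>k)\<close>, and the second-order term is
  \<open>O(s\<^sup>2 W(x)\<^sup>2)\<close>. A step \<open>s\<close> of size \<open>\<eta> / W(x)\<close> from an \<open>\<eta>\<^sup>2\<close>-minimiser makes both errors \<open>O(\<eta> W(x))\<close>,
  which is why a near-minimiser is enough.
\<close>

lemma approximate_multipliers:
  fixes c W :: "'a \<Rightarrow> real" and f :: "'i \<Rightarrow> 'a \<Rightarrow> real"
  assumes fin: "finite I"
    and W: "\<And>x. x \<in> D \<Longrightarrow> 1 \<le> W x"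
    and c0: "\<And>x. x \<in> D \<Longrightarrow> 0 \<le> c x"
    and fb: "\<And>k x. k \<in> I \<Longrightarrow> x \<in> D \<Longrightarrow> \<bar>f k x\<bar> \<le> B * W x"
    and N: "0 < N" and eps: "0 < \<epsilon>"
    and pen: "\<And>q. finite (set_pmf q) \<Longrightarrow> set_pmf q \<subseteq> D \<Longrightarrow>
      p \<le> measure_pmf.expectation q c + N * (\<Sum>k\<in>I. (max 0 (measure_pmf.expectation q (f k)))\<^sup>2)"
  obtains l where "\<And>k. k \<in> I \<Longrightarrow> 0 \<le> l k"
    and "\<And>x. x \<in> D \<Longrightarrow> p \<le> c x + (\<Sum>k\<in>I. l k * f k x) + \<epsilon> * W x"
proof (cases "D = {}")
  case True
  then show ?thesis using that[of "\<lambda>_. 0"] by auto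
next
  case False
  then obtain x0 where x0: "x0 \<in> D" by auto
  define S where "S = {q. finite (set_pmf q) \<and> set_pmf q \<subseteq> D}"
  define J where "J q = measure_pmf.expectation q c
    + N * (\<Sum>k\<in>I. (max 0 (measure_pmf.expectation q (f k)))\<^sup>2)" for q
  have Ec0: "0 \<le> measure_pmf.expectation q c" if "q \<in> S" for q
    using that c0 by (intro integral_nonneg_AE) (auto simp: S_def AE_measure_pmf_iff)
  have J0: "0 \<le> J q" if "q \<in> S" for q
    unfolding J_def using Ec0[OF that] N by (intro add_nonneg_nonneg mult_nonneg_nonneg sum_nonneg) auto
  define v where "v = Inf (J ` S)"
  have ne: "S \<noteq> {}" using x0 by (auto simp: S_def intro!: exI[of _ "return_pmf x0"])
  have bdd: "bdd_below (J ` S)" using J0 by (auto intro!: bdd_belowI[of _ 0])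
  have v_le: "v \<le> J q" if "q \<in> S" for q
    unfolding v_def using that bdd by (intro cInf_lower) auto
  have pv: "p \<le> v" unfolding v_def using ne pen by (intro cInf_greatest) (auto simp: S_def J_def)
  have v0: "0 \<le> v" unfolding v_def using ne J0 by (intro cInf_greatest) auto
  \<comment> \<open>\<open>C * (W x)\<^sup>2\<close> will bound the second-order term, uniformly in the choice of the near-minimiser.\<close>
  define C where "C = N * (real (card I) * (2 * B\<^sup>2 + 2 * ((v + 1) / N)))"
  have C0: "0 \<le> C" unfolding C_def using N v0 by auto
  define \<eta> where "\<eta> = min 1 (\<epsilon> / (1 + C))"
  have eta: "0 < \<eta>" "\<eta> \<le> 1" "\<eta> * (1 + C) \<le> \<epsilon>"
  proof -
    show "0 < \<eta>" "\<eta> \<le> 1" using eps C0 by (auto simp: \<eta>_def)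
    have "\<eta> * (1 + C) \<le> \<epsilon> / (1 + C) * (1 + C)"
      using C0 by (intro mult_right_mono) (auto simp: \<eta>_def)
    then show "\<eta> * (1 + C) \<le> \<epsilon>" using C0 by auto
  qed
  have "\<exists>q\<in>S. J q < v + \<eta>\<^sup>2"
    using cInf_lessD[of "J ` S" "v + \<eta>\<^sup>2"] ne eta unfolding v_def by auto
  then obtain q where q: "q \<in> S" "J q < v + \<eta>\<^sup>2" by auto
  have eta2: "\<eta>\<^sup>2 \<le> 1" using eta by (simp add: power_le_one)
  define a where "a = measure_pmf.expectation q c"
  define m where "m k = max 0 (measure_pmf.expectation q (f k))" for k
  have m0: "0 \<le> m k" for k by (simp add: m_def)
  have Jq: "J q = a + N * (\<Sum>k\<in>I. (m k)\<^sup>2)" by (simp add: J_def a_def m_def)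
  have a0: "0 \<le> a" using Ec0[OF q(1)] by (simp add: a_def)
  have m2: "(m k)\<^sup>2 \<le> (v + 1) / N" if "k \<in> I" for k
  proof -
    have "(m k)\<^sup>2 \<le> (\<Sum>k\<in>I. (m k)\<^sup>2)" using that fin by (intro member_le_sum) auto
    then have "N * (m k)\<^sup>2 \<le> N * (\<Sum>k\<in>I. (m k)\<^sup>2)" using N by auto
    also have "\<dots> \<le> v + 1" using Jq q(2) a0 eta2 by linarith
    finally show ?thesis using N by (simp add: field_simps)
  qed
  show ?thesis
  proof (rule that[of "\<lambda>k. 2 * N * m k"])
    show "0 \<le> 2 * N * m k" for k using N m0 by simp
    fix x assume x: "x \<in> D"
    have Wx: "1 \<le> W x" "0 < W x" using W[OF x] by auto
    define s where "s = \<eta> / W x"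
    have s: "0 < s" "s \<le> 1" unfolding s_def using eta Wx by auto
    define r where "r = bernoulli_pmf s \<bind> (\<lambda>b. if b then return_pmf x else q)"
    have rE: "measure_pmf.expectation r g = s * g x + (1 - s) * measure_pmf.expectation q g"
      for g :: "'a \<Rightarrow> real"
      unfolding r_def using q s by (intro pmf_expectation_mix) (auto simp: S_def)
    have "r \<in> S" using q(1) x by (auto simp: S_def r_def split: if_splits)
    \<comment> \<open>The positive part is sublinear, so only the positive part \<open>m k\<close> of \<open>E\<^sub>q f\<^sub>k\<close> enters, even where \<open>E\<^sub>q f\<^sub>k\<close> is very negative.\<close>
    have sq: "(max 0 (measure_pmf.expectation r (f k)))\<^sup>2 \<le> (m k + s * (f k x - m k))\<^sup>2" for k
    proof -
      have "(1 - s) * measure_pmf.expectation q (f k) \<le> (1 - s) * m k"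
        using s by (intro mult_left_mono) (auto simp: m_def)
      then have "measure_pmf.expectation r (f k) \<le> m k + s * (f k x - m k)"
        unfolding rE by (simp add: algebra_simps)
      then show ?thesis by (cases "measure_pmf.expectation r (f k) \<le> 0") (auto intro: power_mono)
    qed
    have fm: "(f k x - m k)\<^sup>2 \<le> (2 * B\<^sup>2 + 2 * ((v + 1) / N)) * (W x)\<^sup>2" if "k \<in> I" for k
    proof -
      have "(f k x - m k)\<^sup>2 \<le> 2 * (f k x)\<^sup>2 + 2 * (m k)\<^sup>2"
        using sum_squares_ge_zero[of "f k x + m k" 0]
        by (simp add: power2_eq_square algebra_simps)
      moreover have "(f k x)\<^sup>2 \<le> (B * W x)\<^sup>2"
        using fb[OF that x] by (metis abs_ge_zero order_trans power2_abs power_mono)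
      moreover have "(m k)\<^sup>2 \<le> (v + 1) / N * (W x)\<^sup>2"
      proof -
        have "1 \<le> (W x)\<^sup>2" using Wx by (simp add: one_le_power)
        then have "(v + 1) / N * 1 \<le> (v + 1) / N * (W x)\<^sup>2" using v0 N by (intro mult_left_mono) auto
        then show ?thesis using m2[OF that] by linarith
      qed
      moreover have "(2 * B\<^sup>2 + 2 * ((v + 1) / N)) * (W x)\<^sup>2
          = 2 * (B * W x)\<^sup>2 + 2 * ((v + 1) / N * (W x)\<^sup>2)"
        by (simp only: power_mult_distrib distrib_right mult.assoc)
      ultimately show ?thesis by linarith
    qed
    have NW: "N * (\<Sum>k\<in>I. (f k x - m k)\<^sup>2) \<le> C * (W x)\<^sup>2"
    proof -
      have "(\<Sum>k\<in>I. (f k x - m k)\<^sup>2) \<le> (\<Sum>k\<in>I. (2 * B\<^sup>2 + 2 * ((v + 1) / N)) * (W x)\<^sup>2)"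
        using fm by (intro sum_mono)
      then have "N * (\<Sum>k\<in>I. (f k x - m k)\<^sup>2)
          \<le> N * (\<Sum>k\<in>I. (2 * B\<^sup>2 + 2 * ((v + 1) / N)) * (W x)\<^sup>2)"
        using N by (intro mult_left_mono) auto
      then show ?thesis by (simp add: C_def mult_ac)
    qed
    define T where "T = (\<Sum>k\<in>I. m k * (f k x - m k))"
    define R where "R = (\<Sum>k\<in>I. (f k x - m k)\<^sup>2)"
    have "J q - \<eta>\<^sup>2 \<le> J r" using v_le[OF \<open>r \<in> S\<close>] q(2) by linarith
    also have "J r \<le> s * c x + (1 - s) * a + N * (\<Sum>k\<in>I. (m k + s * (f k x - m k))\<^sup>2)"
      unfolding J_def rE[of c] a_def[symmetric] using N sq s by (intro add_mono mult_left_mono sum_mono) auto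
    also have "(\<Sum>k\<in>I. (m k + s * (f k x - m k))\<^sup>2) = (\<Sum>k\<in>I. (m k)\<^sup>2) + 2 * s * T + s\<^sup>2 * R"
      unfolding T_def R_def sum_distrib_left sum.distrib[symmetric]
      by (intro sum.cong) (auto simp: power2_eq_square algebra_simps)
    finally have "0 \<le> \<eta>\<^sup>2 + s * (c x - a + 2 * N * T) + s\<^sup>2 * (N * R)"
      unfolding Jq by (simp add: algebra_simps)
    also have "\<dots> \<le> \<eta>\<^sup>2 + s * (c x - a + 2 * N * T) + s\<^sup>2 * (C * (W x)\<^sup>2)"
      using NW by (intro add_left_mono mult_left_mono) (auto simp: R_def)
    also have "\<dots> = s * (\<eta> * W x + (c x - a + 2 * N * T) + C * (\<eta> * W x))"
      using Wx by (simp add: s_def field_simps power2_eq_square)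
    finally have *: "0 \<le> \<eta> * W x + (c x - a + 2 * N * T) + C * (\<eta> * W x)"
      using s by (simp add: zero_le_mult_iff)
    have "\<eta> * (1 + C) * W x \<le> \<epsilon> * W x" using eta Wx by (intro mult_right_mono) auto
    with * have "a - 2 * N * T \<le> c x + \<epsilon> * W x" by (simp add: algebra_simps)
    moreover have "2 * N * T = (\<Sum>k\<in>I. 2 * N * m k * f k x) - 2 * (N * (\<Sum>k\<in>I. (m k)\<^sup>2))"
      unfolding T_def by (simp add: sum_distrib_left sum_subtractf[symmetric] power2_eq_square algebra_simps)
    moreover have "0 \<le> N * (\<Sum>k\<in>I. (m k)\<^sup>2)" using N by (intro mult_nonneg_nonneg sum_nonneg) auto
    ultimately show "p \<le> c x + (\<Sum>k\<in>I. 2 * N * m k * f k x) + \<epsilon> * W x"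
      using v_le[OF q(1)] pv Jq by linarith
  qed
qed

section \<open>Encoding a sequence of reals in one real\<close>

text \<open>
  A sequence of numbers in \<open>[0, 1)\<close> is encoded by interleaving the binary expansions of its entries. The
  interleaved digits \<open>0\<close> and \<open>1\<close> are written as the digits \<open>1\<close> and \<open>3\<close> in base five. This
  keeps every shifted fractional part of an encoding at a distance from \<open>0\<close> and \<open>1 / 2\<close>, so each digit, and
  therefore the decoding, depends continuously on the encoding (\<open>decode_tendsto\<close>); with plain
  binary digits it would jump at dyadic numbers.
\<close>

definition quinary_digit :: "nat \<Rightarrow> real \<Rightarrow> real" where
  "quinary_digit k s = (if 1 / 2 < frac (5 ^ k * s) then 1 else 0)"

definition decode :: "real \<Rightarrow> nat \<Rightarrow> real" where
  "decode s i = (\<Sum>k. quinary_digit (prod_encode (i, k)) s / 2 ^ Suc k)"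

definition binary_digit :: "nat \<Rightarrow> real \<Rightarrow> nat" where
  "binary_digit k p = nat \<lfloor>2 ^ Suc k * p\<rfloor> mod 2"

lemma binary_digit_le_1: "binary_digit k p \<le> 1"
  by (simp add: binary_digit_def flip: less_Suc_eq_le)

definition interleaved_digit :: "(nat \<Rightarrow> real) \<Rightarrow> nat \<Rightarrow> nat" where
  "interleaved_digit x m = (case prod_decode m of (i, k) \<Rightarrow> binary_digit k (x i))"

definition encode :: "(nat \<Rightarrow> real) \<Rightarrow> real" where
  "encode x = (\<Sum>m. (1 + 2 * real (interleaved_digit x m)) / 5 ^ Suc m)"

lemma binary_expansion:
  assumes "0 \<le> p" "p < 1"
  shows "(\<lambda>k. real (binary_digit k p) / 2 ^ Suc k) sums p"
proof -
  have partial: "(\<Sum>k<m. real (binary_digit k p) / 2 ^ Suc k) = real (nat \<lfloor>2 ^ m * p\<rfloor>) / 2 ^ m" for m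
  proof (induction m)
    case 0
    then show ?case using assms by (simp add: floor_unique)
  next
    case (Suc m)
    define z where "z = 2 ^ m * p"
    have z: "0 \<le> z" using assms by (simp add: z_def)
    have "\<lfloor>z\<rfloor> = \<lfloor>2 * z\<rfloor> div 2"
    proof -
      have "\<lfloor>2 * z / of_int 2\<rfloor> = \<lfloor>2 * z\<rfloor> div 2" by (rule floor_divide_real_eq_div) simp
      then show ?thesis by simp
    qed
    then have "nat \<lfloor>z\<rfloor> = nat \<lfloor>2 * z\<rfloor> div 2" using z by (simp add: nat_div_distrib)
    then have "nat \<lfloor>2 * z\<rfloor> = 2 * nat \<lfloor>z\<rfloor> + nat \<lfloor>2 * z\<rfloor> mod 2" by simp
    then have "real (nat \<lfloor>2 * z\<rfloor>) = 2 * real (nat \<lfloor>z\<rfloor>) + real (nat \<lfloor>2 * z\<rfloor> mod 2)"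
      by (metis of_nat_add of_nat_mult of_nat_numeral)
    then show ?case using Suc by (simp add: binary_digit_def z_def field_simps)
  qed
  have "(\<lambda>m. real (nat \<lfloor>2 ^ m * p\<rfloor>) / 2 ^ m) \<longlonglongrightarrow> p"
  proof (rule real_tendsto_sandwich[where f = "\<lambda>m. p - 1 / 2 ^ m" and h = "\<lambda>_. p"])
    have "p - 1 / 2 ^ m \<le> real (nat \<lfloor>2 ^ m * p\<rfloor>) / 2 ^ m \<and> real (nat \<lfloor>2 ^ m * p\<rfloor>) / 2 ^ m \<le> p" for m
    proof -
      have "2 ^ m * p - 1 \<le> real (nat \<lfloor>2 ^ m * p\<rfloor>)" "real (nat \<lfloor>2 ^ m * p\<rfloor>) \<le> 2 ^ m * p"
        using assms by (simp_all add: of_nat_nat)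
      then have "(2 ^ m * p - 1) / 2 ^ m \<le> real (nat \<lfloor>2 ^ m * p\<rfloor>) / 2 ^ m"
        "real (nat \<lfloor>2 ^ m * p\<rfloor>) / 2 ^ m \<le> (2 ^ m * p) / 2 ^ m"
        by (intro divide_right_mono; simp)+
      then show ?thesis by (simp add: diff_divide_distrib)
    qed
    then show "\<forall>\<^sub>F m in sequentially. p - 1 / 2 ^ m \<le> real (nat \<lfloor>2 ^ m * p\<rfloor>) / 2 ^ m"
      "\<forall>\<^sub>F m in sequentially. real (nat \<lfloor>2 ^ m * p\<rfloor>) / 2 ^ m \<le> p" by auto
    have "(\<lambda>m. p - (1 / 2) ^ m) \<longlonglongrightarrow> p - 0"
      by (intro tendsto_diff tendsto_const LIMSEQ_power_zero) auto
    then show "(\<lambda>m. p - 1 / 2 ^ m) \<longlonglongrightarrow> p" by (simp add: power_one_over)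
  qed auto
  then show ?thesis unfolding sums_def partial .
qed

lemma quinary_series:
  fixes b :: "nat \<Rightarrow> nat"
  assumes b: "\<And>k. b k \<le> 1"
  shows "summable (\<lambda>k. (1 + 2 * real (b k)) / 5 ^ Suc k)"
    and "1 / 4 \<le> (\<Sum>k. (1 + 2 * real (b k)) / 5 ^ Suc k)"
    and "(\<Sum>k. (1 + 2 * real (b k)) / 5 ^ Suc k) \<le> 3 / 4"
proof -
  have geo: "(\<lambda>k. d / 5 ^ Suc k) sums (d / 4)" for d :: real
  proof -
    have "(\<lambda>k. d / 5 * (1 / 5) ^ k) sums (d / 5 * (1 / (1 - 1 / 5)))"
      by (intro sums_mult geometric_sums) auto
    then show ?thesis by (simp add: power_one_over field_simps)
  qed
  have bb: "1 \<le> 1 + 2 * real (b k)" "1 + 2 * real (b k) \<le> 3" for k using b[of k] by auto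
  show summ: "summable (\<lambda>k. (1 + 2 * real (b k)) / 5 ^ Suc k)"
  proof (rule summable_comparison_test'[where N = 0])
    show "summable (\<lambda>k. 3 / 5 ^ Suc k :: real)" using geo sums_summable by blast
    show "norm ((1 + 2 * real (b k)) / 5 ^ Suc k) \<le> 3 / 5 ^ Suc k" for k
      using bb[of k] by (simp add: divide_right_mono)
  qed
  have "(\<Sum>k. 1 / 5 ^ Suc k) \<le> (\<Sum>k. (1 + 2 * real (b k)) / 5 ^ Suc k)"
    using bb summ sums_summable[OF geo] by (intro suminf_le divide_right_mono) auto
  then show "1 / 4 \<le> (\<Sum>k. (1 + 2 * real (b k)) / 5 ^ Suc k)"
    using sums_unique[OF geo[of 1], symmetric] by simp
  have "(\<Sum>k. (1 + 2 * real (b k)) / 5 ^ Suc k) \<le> (\<Sum>k. 3 / 5 ^ Suc k)"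
    using bb summ sums_summable[OF geo] by (intro suminf_le divide_right_mono) auto
  then show "(\<Sum>k. (1 + 2 * real (b k)) / 5 ^ Suc k) \<le> 3 / 4"
    using sums_unique[OF geo[of 3], symmetric] by simp
qed

text \<open>
  Multiplication by \<open>5 ^ m\<close> shifts the expansion: up to an integer, the result is the series of the remaining
  digits, which starts with \<open>1 + 2 b\<^sub>m\<close> and has a tail in \<open>[1 / 4, 3 / 4]\<close>.
\<close>

lemma frac_quinary_expansion:
  fixes b :: "nat \<Rightarrow> nat"
  assumes b: "\<And>k. b k \<le> 1"
  defines "s \<equiv> (\<Sum>k. (1 + 2 * real (b k)) / 5 ^ Suc k)"
  shows "\<bar>frac (5 ^ m * s) - (3 / 10 + 2 / 5 * real (b m))\<bar> \<le> 1 / 20"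
proof -
  define t where "t m = (\<Sum>k. (1 + 2 * real (b (k + m))) / 5 ^ Suc k)" for m
  have summ: "summable (\<lambda>k. (1 + 2 * real (b (k + m))) / 5 ^ Suc k)" for m
    by (intro quinary_series b)
  have t_bounds: "1 / 4 \<le> t m" "t m \<le> 3 / 4" for m
    unfolding t_def using quinary_series[of "\<lambda>k. b (k + m)"] b by auto
  have t_step: "5 * t m = (1 + 2 * real (b m)) + t (Suc m)" for m
  proof -
    have "t m = (\<Sum>k. (1 + 2 * real (b (Suc k + m))) / 5 ^ Suc (Suc k)) + (1 + 2 * real (b (0 + m))) / 5 ^ Suc 0"
      unfolding t_def by (subst suminf_split_head[OF summ]) simp
    also have "(\<Sum>k. (1 + 2 * real (b (Suc k + m))) / 5 ^ Suc (Suc k)) = (\<Sum>k. 1 / 5 * ((1 + 2 * real (b (k + Suc m))) / 5 ^ Suc k))"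
      by (intro suminf_cong) simp
    also have "\<dots> = 1 / 5 * t (Suc m)"
      unfolding t_def by (rule suminf_mult[OF summ])
    finally show ?thesis by (simp add: field_simps)
  qed
  have "\<exists>N::int. 5 ^ m * s = of_int N + t m" for m
  proof (induction m)
    case 0
    then show ?case by (intro exI[of _ 0]) (simp add: t_def s_def)
  next
    case (Suc m)
    then obtain N where "5 ^ m * s = of_int N + t m" by auto
    then have "5 ^ Suc m * s = of_int (5 * N + 1 + 2 * int (b m)) + t (Suc m)"
      using t_step[of m] by simp
    then show ?case by blast
  qed
  then obtain N where N: "5 ^ m * s = of_int N + t m" by auto
  have "frac (5 ^ m * s) = t m"
    unfolding N using t_bounds[of m] by (simp add: frac_unique_iff)
  moreover have "t m = 1 / 5 * (1 + 2 * real (b m)) + 1 / 5 * t (Suc m)"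
    using t_step[of m] by (simp add: field_simps)
  moreover have "\<bar>A - (3 / 10 + 2 / 5 * B)\<bar> \<le> 1 / 20"
    if "A = 1 / 5 * (1 + 2 * B) + 1 / 5 * U" "1 / 4 \<le> U" "U \<le> 3 / 4" for A B U :: real
    using that by (intro abs_leI) (simp_all add: algebra_simps)
  ultimately show ?thesis using t_bounds[of "Suc m"] by metis
qed

lemma interleaved_digit_le_1: "interleaved_digit x m \<le> 1"
  by (simp only: interleaved_digit_def binary_digit_le_1 split: prod.split) simp

lemma frac_encode:
  "\<bar>frac (5 ^ m * encode x) - (3 / 10 + 2 / 5 * real (interleaved_digit x m))\<bar> \<le> 1 / 20"
  unfolding encode_def by (intro frac_quinary_expansion interleaved_digit_le_1)

lemma encode_bounds: "1 / 4 \<le> encode x" "encode x \<le> 3 / 4"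
  unfolding encode_def by (intro quinary_series interleaved_digit_le_1)+

lemma quinary_digit_encode: "quinary_digit m (encode x) = real (interleaved_digit x m)"
proof -
  have "interleaved_digit x m = 0 \<or> interleaved_digit x m = 1"
    using interleaved_digit_le_1[of x m] by linarith
  then have "1 / 2 < frac (5 ^ m * encode x) \<longleftrightarrow> interleaved_digit x m = 1"
    using frac_encode[of m x] by (elim disjE; simp only: of_nat_0 of_nat_1; linarith)
  with \<open>interleaved_digit x m = 0 \<or> _\<close> show ?thesis by (auto simp: quinary_digit_def)
qed

lemma decode_encode:
  assumes "0 \<le> x i" "x i < 1"
  shows "decode (encode x) i = x i"
  using sums_unique[OF binary_expansion[OF assms]]
  by (simp only: decode_def quinary_digit_encode interleaved_digit_def prod_encode_inverse prod.case)

lemma measurable_decode [measurable]: "(\<lambda>s. decode s i) \<in> borel_measurable borel"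
  unfolding decode_def quinary_digit_def frac_def by measurable

text \<open>
  A digit of an encoding is stable under perturbations of size \<open>1 / 100\<close>; the Tannery theorem then
  exchanges the limit with the decoding series.
\<close>

lemma decode_tendsto:
  assumes conv: "(\<lambda>j. encode (x j)) \<longlonglongrightarrow> s"
  shows "(\<lambda>j. decode (encode (x j)) i) \<longlonglongrightarrow> decode s i"
proof -
  have digit: "(\<lambda>j. quinary_digit m (encode (x j))) \<longlonglongrightarrow> quinary_digit m s" for m
  proof (rule tendsto_eventually)
    have "(\<lambda>j. 5 ^ m * encode (x j)) \<longlonglongrightarrow> 5 ^ m * s" by (intro tendsto_intros conv)
    then have "\<forall>\<^sub>F j in sequentially. dist (5 ^ m * encode (x j)) (5 ^ m * s) < 1 / 100"
      by (rule tendstoD) simp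
    then show "\<forall>\<^sub>F j in sequentially. quinary_digit m (encode (x j)) = quinary_digit m s"
    proof eventually_elim
      case (elim j)
      define z where "z = 5 ^ m * encode (x j)"
      define w where "w = 5 ^ m * s"
      have zw: "\<bar>z - w\<bar> < 1 / 100" using elim by (simp add: dist_real_def z_def w_def)
      define d where "d = interleaved_digit (x j) m"
      have d: "d \<le> 1" "\<bar>frac z - (3 / 10 + 2 / 5 * real d)\<bar> \<le> 1 / 20"
        using interleaved_digit_le_1 frac_encode by (auto simp only: d_def z_def)
      from d(1) have d01: "d = 0 \<or> d = 1" by auto
      have "frac w = frac z + (w - z)"
      proof -
        have "0 \<le> frac z + (w - z)" "frac z + (w - z) < 1"
          using d(2) d01 zw by (elim disjE; simp only: of_nat_0 of_nat_1; linarith)+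
        moreover have "w - (frac z + (w - z)) \<in> \<int>" by (simp add: frac_def)
        ultimately show ?thesis by (simp add: frac_unique_iff)
      qed
      then have "1 / 2 < frac z \<longleftrightarrow> 1 / 2 < frac w"
        using d(2) d01 zw by (elim disjE; simp only: of_nat_0 of_nat_1; linarith)
      then show ?case by (simp add: quinary_digit_def z_def w_def)
    qed
  qed
  show ?thesis unfolding decode_def
  proof (rule tannerys_theorem[THEN conjunct2, THEN conjunct2])
    show "((\<lambda>j. quinary_digit (prod_encode (i, k)) (encode (x j)) / 2 ^ Suc k) \<longlonglongrightarrow>
        quinary_digit (prod_encode (i, k)) s / 2 ^ Suc k)" for k
      by (intro tendsto_divide digit tendsto_const) simp
    show "\<forall>\<^sub>F (k, j) in sequentially \<times>\<^sub>F sequentially.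
        norm (quinary_digit (prod_encode (i, k)) (encode (x j)) / 2 ^ Suc k) \<le> 1 / 2 ^ Suc k"
      by (intro always_eventually) (auto simp: quinary_digit_def)
    have "(\<lambda>k. 1 / 2 ^ Suc k :: real) sums 1" using power_half_series by (simp add: power_one_over)
    then show "summable (\<lambda>k. 1 / 2 ^ Suc k :: real)" by (rule sums_summable)
  qed simp
qed

section \<open>Sequential compactness with almost sure convergence\<close>

definition squash :: "real \<Rightarrow> real" where
  "squash x = (1 + x / (1 + \<bar>x\<bar>)) / 2"

definition unsquash :: "real \<Rightarrow> real" where
  "unsquash p = (2 * p - 1) / (1 - \<bar>2 * p - 1\<bar>)"

lemma squash_rescaled: "2 * squash x - 1 = x / (1 + \<bar>x\<bar>)"
proof -
  have "2 * ((1 + a) / 2) - 1 = a" for a :: real by (simp add: field_simps)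
  then show ?thesis unfolding squash_def .
qed

lemma abs_squash: "\<bar>2 * squash x - 1\<bar> = \<bar>x\<bar> / (1 + \<bar>x\<bar>)"
  by (simp add: squash_rescaled)

lemma squash_bounds: "0 \<le> squash x" "squash x < 1"
proof -
  have "\<bar>x\<bar> / (1 + \<bar>x\<bar>) < 1" by simp
  then have "\<bar>2 * squash x - 1\<bar> < 1" by (simp only: abs_squash)
  then show "0 \<le> squash x" "squash x < 1" by linarith+
qed

lemma unsquash_squash: "unsquash (squash x) = x"
proof -
  have "1 - \<bar>x / (1 + \<bar>x\<bar>)\<bar> = 1 / (1 + \<bar>x\<bar>)"
    by (simp add: abs_divide field_simps)
  then show ?thesis unfolding unsquash_def squash_rescaled by simp
qed

lemma measurable_unsquash [measurable]: "unsquash \<in> borel_measurable borel"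
  unfolding unsquash_def by measurable

text \<open>
  A substitute for the theorems of Prohorov and Skorohod in countable dimension. The laws of the encodings live on
  \<open>[1 / 4, 3 / 4]\<close> and are tight, so Helly's theorem gives a weakly convergent subsequence, and
  Skorohod's theorem on the real line turns it into an almost surely convergent sequence of encodings. Decoding preserves the
  convergence, up to the possibility that a squashed coordinate tends to \<open>0\<close> or \<open>1\<close>, i.e. that the coordinate itself
  escapes to infinity; the moment bound and Fatou's lemma exclude this almost surely.
\<close>

lemma almost_sure_representation:
  fixes q :: "nat \<Rightarrow> (nat \<Rightarrow> real) pmf" and I :: "nat set"
  assumes moment: "\<And>i j. i \<in> I \<Longrightarrow> (\<integral>\<^sup>+x. ennreal \<bar>x i\<bar> \<partial>measure_pmf (q j)) \<le> ennreal (b i)"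
  obtains \<Omega> :: "real measure" and r :: "nat \<Rightarrow> nat" and X :: "nat \<Rightarrow> real \<Rightarrow> nat \<Rightarrow> real"
    and X' :: "real \<Rightarrow> nat \<Rightarrow> real"
  where "prob_space \<Omega>" "strict_mono r"
    "\<And>j. X j \<in> measurable \<Omega> (PiM I (\<lambda>_. borel))" "X' \<in> measurable \<Omega> (PiM I (\<lambda>_. borel))"
    "\<And>j. distr \<Omega> (PiM I (\<lambda>_. borel)) (X j)
      = distr (measure_pmf (q (r j))) (PiM I (\<lambda>_. borel)) (\<lambda>x. restrict x I)"
    "AE \<omega> in \<Omega>. \<forall>i\<in>I. (\<lambda>j. X j \<omega> i) \<longlonglongrightarrow> X' \<omega> i"
proof -
  define e where "e x = encode (\<lambda>i. squash (x i))" for x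
  define d where "d s = (\<lambda>i\<in>I. unsquash (decode s i))" for s
  have d_e: "d (e x) = restrict x I" for x
    by (auto simp: d_def e_def decode_encode squash_bounds unsquash_squash)
  have [measurable]: "d \<in> measurable borel (PiM I (\<lambda>_. borel))"
    unfolding d_def by measurable
  define \<nu> where "\<nu> j = distr (measure_pmf (q j)) borel e" for j
  have \<nu>: "real_distribution (\<nu> j)" for j
  proof -
    interpret prob_space "\<nu> j" unfolding \<nu>_def
      by (rule measure_pmf.prob_space_distr) simp
    show ?thesis by standard (auto simp: \<nu>_def)
  qed
  have "measure (\<nu> j) {0<..1} = 1" for j
  proof -
    have "e x \<in> {0<..1}" for x using encode_bounds[of "\<lambda>i. squash (x i)"] by (simp add: e_def)
    then have "e -` {0<..1} = UNIV" by auto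
    then show ?thesis by (simp add: \<nu>_def measure_distr)
  qed
  then have "0 < (1 :: real) \<and> (\<forall>j. 1 - \<epsilon> < measure (\<nu> j) {0<..1})" if "0 < \<epsilon>" for \<epsilon> :: real
    using that by simp
  then have "tight \<nu>" unfolding tight_def using \<nu> by blast
  from tight_imp_convergent_subsubsequence[OF this strict_mono_id]
  obtain r M where r: "strict_mono r" and M: "real_distribution M" "weak_conv_m (\<nu> \<circ> id \<circ> r) M"
    by auto
  have "\<And>j. real_distribution (\<nu> (r j))" "weak_conv_m (\<lambda>j. \<nu> (r j)) M"
    using \<nu> M by (auto simp: comp_def)
  from Skorohod[OF this(1) M(1) this(2)] obtain \<Omega> :: "real measure" and Y Y'
    where \<Omega>: "prob_space \<Omega>" and Y[measurable]: "\<And>j. Y j \<in> measurable \<Omega> borel"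
      and lawY: "\<And>j. distr \<Omega> borel (Y j) = \<nu> (r j)"
      and Y': "Y' \<in> measurable \<Omega> lborel" and conv: "\<And>\<omega>. \<omega> \<in> space \<Omega> \<Longrightarrow> (\<lambda>j. Y j \<omega>) \<longlonglongrightarrow> Y' \<omega>"
    by blast
  interpret \<Omega>: prob_space \<Omega> by fact
  have [measurable]: "Y' \<in> measurable \<Omega> borel" using Y' by simp
  have "AE \<omega> in \<Omega>. \<forall>j. Y j \<omega> \<in> range e"
  proof (subst AE_all_countable, intro allI)
    fix j
    have "countable (e ` set_pmf (q (r j)))" by simp
    then have S: "e ` set_pmf (q (r j)) \<in> sets borel" by (rule sets.countable[rotated]) simp
    then have "AE s in \<nu> (r j). s \<in> e ` set_pmf (q (r j))"
      unfolding \<nu>_def by (subst AE_distr_iff) (auto simp: AE_measure_pmf_iff)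
    then have "AE \<omega> in \<Omega>. Y j \<omega> \<in> e ` set_pmf (q (r j))"
      unfolding lawY[symmetric] by (rule AE_distrD[rotated]) simp
    then show "AE \<omega> in \<Omega>. Y j \<omega> \<in> range e" by eventually_elim auto
  qed
  moreover
  have law: "distr \<Omega> (PiM I (\<lambda>_. borel)) (\<lambda>\<omega>. d (Y j \<omega>))
      = distr (measure_pmf (q (r j))) (PiM I (\<lambda>_. borel)) (\<lambda>x. restrict x I)" for j
  proof -
    have "distr \<Omega> (PiM I (\<lambda>_. borel)) (\<lambda>\<omega>. d (Y j \<omega>)) = distr (distr \<Omega> borel (Y j)) (PiM I (\<lambda>_. borel)) d"
      by (subst distr_distr) (auto simp: comp_def)
    also have "\<dots> = distr (measure_pmf (q (r j))) (PiM I (\<lambda>_. borel)) (\<lambda>x. restrict x I)"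
      unfolding lawY \<nu>_def by (subst distr_distr) (auto simp: comp_def d_e)
    finally show ?thesis .
  qed
  have "AE \<omega> in \<Omega>. \<forall>i\<in>I. liminf (\<lambda>j. ennreal \<bar>d (Y j \<omega>) i\<bar>) < \<infinity>"
  proof (subst AE_ball_countable, simp, intro ballI)
    fix i assume i: "i \<in> I"
    have [measurable]: "(\<lambda>x. x i) \<in> borel_measurable (PiM I (\<lambda>_. borel :: real measure))"
      using i by measurable
    have [measurable]: "(\<lambda>\<omega>. d (Y j \<omega>) i) \<in> borel_measurable \<Omega>" for j
      using i by (simp add: d_def)
    have "(\<integral>\<^sup>+\<omega>. ennreal \<bar>d (Y j \<omega>) i\<bar> \<partial>\<Omega>) \<le> ennreal (b i)" for j
    proof -
      have "(\<integral>\<^sup>+\<omega>. ennreal \<bar>d (Y j \<omega>) i\<bar> \<partial>\<Omega>)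
          = (\<integral>\<^sup>+x. ennreal \<bar>x i\<bar> \<partial>distr \<Omega> (PiM I (\<lambda>_. borel)) (\<lambda>\<omega>. d (Y j \<omega>)))"
        by (subst nn_integral_distr) auto
      also have "\<dots> = (\<integral>\<^sup>+x. ennreal \<bar>x i\<bar> \<partial>measure_pmf (q (r j)))"
        unfolding law using i by (subst nn_integral_distr) (auto simp: space_PiM)
      finally show ?thesis using moment[OF i] by simp
    qed
    then have "liminf (\<lambda>j. \<integral>\<^sup>+\<omega>. ennreal \<bar>d (Y j \<omega>) i\<bar> \<partial>\<Omega>) \<le> liminf (\<lambda>j. ennreal (b i))"
      by (intro Liminf_mono always_eventually) auto
    then have "(\<integral>\<^sup>+\<omega>. liminf (\<lambda>j. ennreal \<bar>d (Y j \<omega>) i\<bar>) \<partial>\<Omega>) \<le> ennreal (b i)"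
      using nn_integral_liminf[of "\<lambda>j \<omega>. ennreal \<bar>d (Y j \<omega>) i\<bar>" \<Omega>] by (simp add: Liminf_const)
    then have "(\<integral>\<^sup>+\<omega>. liminf (\<lambda>j. ennreal \<bar>d (Y j \<omega>) i\<bar>) \<partial>\<Omega>) \<noteq> \<infinity>"
      by (auto simp: top_unique)
    then have "AE \<omega> in \<Omega>. liminf (\<lambda>j. ennreal \<bar>d (Y j \<omega>) i\<bar>) \<noteq> \<infinity>"
      by (intro nn_integral_PInf_AE) auto
    then show "AE \<omega> in \<Omega>. liminf (\<lambda>j. ennreal \<bar>d (Y j \<omega>) i\<bar>) < \<infinity>"
      by eventually_elim (auto simp: less_top)
  qed
  ultimately have lim: "AE \<omega> in \<Omega>. \<forall>i\<in>I. (\<lambda>j. d (Y j \<omega>) i) \<longlonglongrightarrow> d (Y' \<omega>) i"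
    using AE_space
  proof (eventually_elim, intro ballI)
    fix \<omega> i assume range: "\<forall>j. Y j \<omega> \<in> range e" and \<omega>: "\<omega> \<in> space \<Omega>" and i: "i \<in> I"
      and fin: "\<forall>i\<in>I. liminf (\<lambda>j. ennreal \<bar>d (Y j \<omega>) i\<bar>) < \<infinity>"
    from range have "\<forall>j. \<exists>x. Y j \<omega> = e x" by auto
    from choice[OF this] obtain x where x: "\<And>j. Y j \<omega> = e (x j)" by blast
    define P where "P = decode (Y' \<omega>) i"
    have "(\<lambda>j. encode (\<lambda>i. squash (x j i))) \<longlonglongrightarrow> Y' \<omega>"
      using conv[OF \<omega>] by (simp add: x e_def)
    from decode_tendsto[OF this, of i] have P: "(\<lambda>j. squash (x j i)) \<longlonglongrightarrow> P"
      by (simp add: P_def decode_encode squash_bounds)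
    have dY: "d (Y j \<omega>) i = x j i" for j using i by (simp add: x d_e)
    obtain C where C: "0 \<le> C" "liminf (\<lambda>j. ennreal \<bar>x j i\<bar>) < ennreal C"
    proof -
      have "liminf (\<lambda>j. ennreal \<bar>x j i\<bar>) < \<infinity>" using bspec[OF fin i] unfolding dY .
      then obtain a where "0 \<le> a" "liminf (\<lambda>j. ennreal \<bar>x j i\<bar>) = ennreal a"
        by (cases "liminf (\<lambda>j. ennreal \<bar>x j i\<bar>)") auto
      then show ?thesis by (intro that[of "a + 1"]) (auto intro!: ennreal_lessI)
    qed
    \<comment> \<open>A finite lower limit keeps a subsequence of \<open>x j i\<close> in \<open>[-C, C]\<close>, so its squashed limit stays off \<open>0\<close> and \<open>1\<close>.\<close>
    have freq: "\<exists>\<^sub>F j in sequentially. \<bar>x j i\<bar> \<le> C"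
    proof (rule ccontr)
      assume "\<not> (\<exists>\<^sub>F j in sequentially. \<bar>x j i\<bar> \<le> C)"
      then have "\<forall>\<^sub>F j in sequentially. ennreal C \<le> ennreal \<bar>x j i\<bar>"
        unfolding not_frequently by (auto elim!: eventually_mono simp: ennreal_leI)
      then have "ennreal C \<le> liminf (\<lambda>j. ennreal \<bar>x j i\<bar>)" by (rule Liminf_bounded)
      with C show False by simp
    qed
    have "\<bar>2 * P - 1\<bar> \<le> C / (1 + C)"
    proof (rule ccontr)
      assume "\<not> \<bar>2 * P - 1\<bar> \<le> C / (1 + C)"
      moreover have "(\<lambda>j. \<bar>2 * squash (x j i) - 1\<bar>) \<longlonglongrightarrow> \<bar>2 * P - 1\<bar>"
        by (intro tendsto_intros P)
      ultimately have "\<forall>\<^sub>F j in sequentially. C / (1 + C) < \<bar>2 * squash (x j i) - 1\<bar>"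
        by (intro order_tendstoD(1)) auto
      with freq have "\<exists>\<^sub>F j in sequentially. \<bar>x j i\<bar> \<le> C \<and> C / (1 + C) < \<bar>2 * squash (x j i) - 1\<bar>"
        by (rule frequently_eventually_frequently)
      then obtain j where "\<bar>x j i\<bar> \<le> C" "C / (1 + C) < \<bar>x j i\<bar> / (1 + \<bar>x j i\<bar>)"
        by (auto simp: abs_squash dest: frequently_ex)
      then show False using C(1) by (simp add: field_simps)
    qed
    also have "C / (1 + C) < 1" using C(1) by simp
    finally have "1 - \<bar>2 * P - 1\<bar> \<noteq> 0" by simp
    with P have "(\<lambda>j. unsquash (squash (x j i))) \<longlonglongrightarrow> unsquash P"
      unfolding unsquash_def by (intro tendsto_intros)
    then show "(\<lambda>j. d (Y j \<omega>) i) \<longlonglongrightarrow> d (Y' \<omega>) i"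
      using i by (simp add: dY unsquash_squash) (simp add: d_def P_def)
  qed
  show ?thesis
    by (rule that[of \<Omega> r "\<lambda>j \<omega>. d (Y j \<omega>)" "\<lambda>\<omega>. d (Y' \<omega>)"]) (use \<Omega> r law lim in auto)
qed

section \<open>Testing with ramp functions\<close>

text \<open>
  Continuous approximations of \<open>indicator {a<..}\<close>. With rational \<open>b\<close> they form a countable family, which is all
  that a sequence of penalty terms can control.
\<close>

definition ramp :: "real \<Rightarrow> nat \<Rightarrow> real \<Rightarrow> real" where
  "ramp b m x = max 0 (min 1 (real m * (x - b)))"

lemma ramp_bounds: "0 \<le> ramp b m x" "ramp b m x \<le> 1" "\<bar>ramp b m x\<bar> \<le> 1"
  by (auto simp: ramp_def)

lemma continuous_on_ramp: "continuous_on S (ramp b m)"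
  unfolding ramp_def by (intro continuous_intros)

lemma measurable_ramp [measurable]: "ramp b m \<in> borel_measurable borel"
  unfolding ramp_def by measurable

text \<open>
  Both the position \<open>b m \<in> (a, a + 1 / (m + 1))\<close> and the slope \<open>m + 1\<close> vary: the ramp starts to the right of \<open>a\<close>, so it
  vanishes on \<open>{..a}\<close>, and at \<open>x > a\<close> it has reached \<open>1\<close> as soon as \<open>(m + 1) (x - a) \<ge> 2\<close>.
\<close>

lemma ramp_tendsto_indicator:
  obtains b :: "nat \<Rightarrow> real" where "\<And>m. b m \<in> \<rat>"
    "\<And>x. (\<lambda>m. ramp (b m) (Suc m) x) \<longlonglongrightarrow> indicator {a<..} x"
proof -
  have "\<forall>m. \<exists>b\<in>\<rat>. a < b \<and> b < a + 1 / real (Suc m)"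
    by (intro allI Rats_dense_in_real) simp
  then obtain b where b: "\<And>m. b m \<in> \<rat>" "\<And>m. a < b m" "\<And>m. b m < a + 1 / real (Suc m)" by metis
  have "(\<lambda>m. ramp (b m) (Suc m) x) \<longlonglongrightarrow> indicator {a<..} x" for x
  proof (cases "a < x")
    case True
    obtain k :: nat where k: "2 / (x - a) < real k" using reals_Archimedean2 by auto
    have "ramp (b m) (Suc m) x = 1" if "k \<le> m" for m
    proof -
      have "2 < real k * (x - a)" using k True by (simp add: field_simps)
      also have "\<dots> \<le> real (Suc m) * (x - a)" using that True by (intro mult_right_mono) auto
      finally have "2 < real (Suc m) * (x - a)" .
      moreover have "real (Suc m) * (b m - a) < 1" using b(3)[of m] by (simp add: field_simps)
      ultimately have "1 < real (Suc m) * (x - b m)" by (simp add: algebra_simps)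
      then show ?thesis by (simp add: ramp_def)
    qed
    then have "\<forall>\<^sub>F m in sequentially. ramp (b m) (Suc m) x = indicator {a<..} x"
      using True by (auto simp: eventually_sequentially)
    then show ?thesis by (rule tendsto_eventually)
  next
    case False
    have "ramp (b m) (Suc m) x = 0" for m
    proof -
      have "real (Suc m) * (x - b m) \<le> 0"
        using False b(2)[of m] by (intro mult_nonneg_nonpos) auto
      then show ?thesis by (simp add: ramp_def)
    qed
    then show ?thesis using False by simp
  qed
  with b(1) show ?thesis by (rule that)
qed

lemma finite_measure_eqI_upper_boxes:
  fixes M N :: "('i \<Rightarrow> real) measure"
  assumes J: "finite J"
    and sets: "sets M = sets (PiM J (\<lambda>_. borel))" "sets N = sets (PiM J (\<lambda>_. borel))"
    and fin: "finite_measure M"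
    and eq: "\<And>a. emeasure M (\<Pi>\<^sub>E j\<in>J. {a j<..}) = emeasure N (\<Pi>\<^sub>E j\<in>J. {a j<..})"
  shows "M = N"
proof -
  define E where "E = range (\<lambda>a. \<Pi>\<^sub>E j\<in>J. {a j :: real<..})"
  have "sets (PiM J (\<lambda>_. borel)) = sets (PiM J (\<lambda>_. sigma UNIV (range (greaterThan :: real \<Rightarrow> real set))))"
    by (intro sets_PiM_cong refl) (simp only: borel_Ioi)
  also have "\<dots> = sets (sigma (\<Pi>\<^sub>E j\<in>J. UNIV) {{f \<in> (\<Pi>\<^sub>E j\<in>J. UNIV). \<forall>i\<in>j. f i \<in> A i} |A j.
      j \<in> {J} \<and> A \<in> Pi j (\<lambda>_. range (greaterThan :: real \<Rightarrow> real set))})"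
  proof (rule sets_PiM_sigma)
    show "\<exists>S\<subseteq>range greaterThan. countable S \<and> (UNIV :: real set) = \<Union>S" for i :: 'i
      by (intro exI[of _ "range (\<lambda>n::nat. {- real n<..})"])
        (use reals_Archimedean2 in \<open>auto simp: minus_less_iff\<close>)
  qed (use J in auto)
  also have "{{f \<in> (\<Pi>\<^sub>E j\<in>J. UNIV). \<forall>i\<in>j. f i \<in> A i} |A j.
      j \<in> {J} \<and> A \<in> Pi j (\<lambda>_. range (greaterThan :: real \<Rightarrow> real set))} = E"
  proof (intro equalityI subsetI)
    fix S assume "S \<in> {{f \<in> (\<Pi>\<^sub>E j\<in>J. UNIV). \<forall>i\<in>j. f i \<in> A i} |A j.
      j \<in> {J} \<and> A \<in> Pi j (\<lambda>_. range (greaterThan :: real \<Rightarrow> real set))}"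
    then obtain A where S: "S = {f \<in> (\<Pi>\<^sub>E j\<in>J. UNIV). \<forall>i\<in>J. f i \<in> A i}"
      and "A \<in> Pi J (\<lambda>_. range greaterThan)" by blast
    then have A: "\<forall>j\<in>J. \<exists>a. A j = {a<..}" by (auto simp: Pi_iff image_iff)
    from bchoice[OF A] obtain a where "\<forall>j\<in>J. A j = {a j<..}" by auto
    with S have "S = (\<Pi>\<^sub>E j\<in>J. {a j<..})" by (auto simp: PiE_iff extensional_def)
    then show "S \<in> E" by (auto simp: E_def)
  next
    fix S assume "S \<in> E"
    then obtain a where "S = (\<Pi>\<^sub>E j\<in>J. {a j<..})" by (auto simp: E_def)
    then have "S = {f \<in> (\<Pi>\<^sub>E j\<in>J. UNIV). \<forall>i\<in>J. f i \<in> {a i<..}}" by (auto simp: PiE_iff extensional_def)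
    then show "S \<in> {{f \<in> (\<Pi>\<^sub>E j\<in>J. UNIV). \<forall>i\<in>j. f i \<in> A i} |A j.
      j \<in> {J} \<and> A \<in> Pi j (\<lambda>_. range (greaterThan :: real \<Rightarrow> real set))}"
      by (intro CollectI exI[of _ "\<lambda>i. {a i<..}"] exI[of _ J]) auto
  qed
  also have "sets (sigma (\<Pi>\<^sub>E j\<in>J. UNIV) E) = sigma_sets (\<Pi>\<^sub>E j\<in>J. UNIV) E"
    by (rule sets_measure_of) (auto simp: E_def PiE_iff)
  finally have S: "sets (PiM J (\<lambda>_. borel)) = sigma_sets (\<Pi>\<^sub>E j\<in>J. UNIV) E" .
  show ?thesis
  proof (rule measure_eqI_generator_eq)
    show "Int_stable E"
    proof (rule Int_stableI)
      fix S T assume "S \<in> E" "T \<in> E"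
      then obtain a b where "S = (\<Pi>\<^sub>E j\<in>J. {a j<..})" "T = (\<Pi>\<^sub>E j\<in>J. {b j<..})"
        by (auto simp: E_def)
      then have "S \<inter> T = (\<Pi>\<^sub>E j\<in>J. {max (a j) (b j)<..})" by (auto simp: PiE_iff extensional_def)
      then show "S \<inter> T \<in> E" by (auto simp: E_def)
    qed
    show "E \<subseteq> Pow (\<Pi>\<^sub>E j\<in>J. UNIV)" by (auto simp: E_def PiE_iff)
    show "emeasure M X = emeasure N X" if "X \<in> E" for X using that eq by (auto simp: E_def)
    show "sets M = sigma_sets (\<Pi>\<^sub>E j\<in>J. UNIV) E" "sets N = sigma_sets (\<Pi>\<^sub>E j\<in>J. UNIV) E"
      using sets S by simp_all
    show "range (\<lambda>n::nat. \<Pi>\<^sub>E j\<in>J. {- real n<..}) \<subseteq> E" by (auto simp: E_def)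
    show "(\<Union>n::nat. \<Pi>\<^sub>E j\<in>J. {- real n<..}) = (\<Pi>\<^sub>E j\<in>J. UNIV)"
    proof (intro equalityI subsetI)
      fix f :: "'i \<Rightarrow> real" assume f: "f \<in> (\<Pi>\<^sub>E j\<in>J. UNIV)"
      obtain n :: nat where n: "Max (insert 0 ((\<lambda>j. - f j) ` J)) < real n"
        using reals_Archimedean2 by auto
      then have "- f j < real n" if "j \<in> J" for j
        using that J by (auto simp: Max_less_iff)
      then have "f \<in> (\<Pi>\<^sub>E j\<in>J. {- real n<..})" using f by (auto simp: PiE_iff minus_less_iff)
      then show "f \<in> (\<Union>n::nat. \<Pi>\<^sub>E j\<in>J. {- real n<..})" by auto
    qed (auto simp: PiE_iff extensional_def)
    show "emeasure M (\<Pi>\<^sub>E j\<in>J. {- real n<..}) \<noteq> \<infinity>" for n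
      using fin by (simp add: finite_measure.emeasure_finite)
  qed
qed

text \<open>
  Orthogonality to products of ramps passes to indicators of boxes by dominated convergence. It then says
  that the images under \<open>X\<close> of the finite measures with densities \<open>D\<^sup>+\<close> and \<open>D\<^sup>-\<close> agree on an intersection-stable
  generator, hence everywhere.
\<close>

lemma orthogonal_if_orthogonal_to_ramps:
  fixes D :: "'a \<Rightarrow> real" and H :: "('i \<Rightarrow> real) \<Rightarrow> real"
  assumes J: "finite J" and X[measurable]: "X \<in> measurable M (PiM J (\<lambda>_. borel))"
    and D: "integrable M D"
    and ramps: "\<And>b m. (\<And>j. j \<in> J \<Longrightarrow> b j \<in> \<rat>) \<Longrightarrow>
      (\<integral>\<omega>. (\<Prod>j\<in>J. ramp (b j) m (X \<omega> j)) * D \<omega> \<partial>M) = 0"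
    and H[measurable]: "H \<in> borel_measurable (PiM J (\<lambda>_. borel))"
    and B: "\<And>x. x \<in> space (PiM J (\<lambda>_. borel)) \<Longrightarrow> \<bar>H x\<bar> \<le> B"
  shows "has_bochner_integral M (\<lambda>\<omega>. H (X \<omega>) * D \<omega>) 0"
proof -
  note [measurable] = borel_measurable_integrable[OF D]
  define Bx where "Bx a = (\<Pi>\<^sub>E j\<in>J. {a j :: real<..})" for a
  have Bx[measurable]: "Bx a \<in> sets (PiM J (\<lambda>_. borel))" for a
    unfolding Bx_def using J by (intro sets_PiM_I_finite) auto
  have box0: "(\<integral>\<omega>. indicator (Bx a) (X \<omega>) * D \<omega> \<partial>M) = 0" for a
  proof -
    have "\<forall>j. \<exists>b. (\<forall>m. b m \<in> \<rat>) \<and> (\<forall>x. (\<lambda>m. ramp (b m) (Suc m) x) \<longlonglongrightarrow> indicator {a j<..} x)"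
      by (metis ramp_tendsto_indicator)
    from choice[OF this] obtain b where b: "\<And>j m. b j m \<in> \<rat>"
      "\<And>j x. (\<lambda>m. ramp (b j m) (Suc m) x) \<longlonglongrightarrow> indicator {a j<..} x" by blast
    have ind: "indicator (Bx a) (X \<omega>) = (\<Prod>j\<in>J. indicator {a j<..} (X \<omega> j) :: real)"
      if "\<omega> \<in> space M" for \<omega>
    proof -
      have "X \<omega> \<in> extensional J" using measurable_space[OF X that] by (auto simp: space_PiM PiE_iff)
      then show ?thesis using J
        by (auto simp: Bx_def PiE_iff indicator_def prod_zero_iff)
    qed
    have "(\<lambda>m. \<integral>\<omega>. (\<Prod>j\<in>J. ramp (b j m) (Suc m) (X \<omega> j)) * D \<omega> \<partial>M)
        \<longlonglongrightarrow> (\<integral>\<omega>. indicator (Bx a) (X \<omega>) * D \<omega> \<partial>M)"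
    proof (rule integral_dominated_convergence[where w = "\<lambda>\<omega>. \<bar>D \<omega>\<bar>"])
      show "integrable M (\<lambda>\<omega>. \<bar>D \<omega>\<bar>)" using D by simp
      show "AE \<omega> in M. (\<lambda>m. (\<Prod>j\<in>J. ramp (b j m) (Suc m) (X \<omega> j)) * D \<omega>)
          \<longlonglongrightarrow> indicator (Bx a) (X \<omega>) * D \<omega>"
        by (intro AE_I2) (auto simp: ind intro!: tendsto_intros b)
      fix m
      have "\<bar>\<Prod>j\<in>J. ramp (b j m) (Suc m) (X \<omega> j)\<bar> \<le> 1" for \<omega>
        by (auto simp: abs_prod intro!: prod_le_1 ramp_bounds)
      from mult_right_mono[OF this]
      show "AE \<omega> in M. norm ((\<Prod>j\<in>J. ramp (b j m) (Suc m) (X \<omega> j)) * D \<omega>) \<le> \<bar>D \<omega>\<bar>"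
        by (intro AE_I2) (force simp: abs_mult)
    qed measurable
    moreover have "(\<integral>\<omega>. (\<Prod>j\<in>J. ramp (b j m) (Suc m) (X \<omega> j)) * D \<omega> \<partial>M) = 0" for m
      using b(1) by (intro ramps)
    ultimately show ?thesis by (simp add: LIMSEQ_const_iff)
  qed
  define Dp where "Dp = (\<lambda>\<omega>. max 0 (D \<omega>))"
  define Dn where "Dn = (\<lambda>\<omega>. max 0 (- D \<omega>))"
  have [measurable]: "Dp \<in> borel_measurable M" "Dn \<in> borel_measurable M" by (simp_all add: Dp_def Dn_def)
  have int: "integrable M Dp" "integrable M Dn" using D by (simp_all add: Dp_def Dn_def)
  have DD: "D \<omega> = Dp \<omega> - Dn \<omega>" "0 \<le> Dp \<omega>" "0 \<le> Dn \<omega>" for \<omega> by (auto simp: Dp_def Dn_def)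
  define \<nu> where "\<nu> g = distr (density M (\<lambda>\<omega>. ennreal (g \<omega>))) (PiM J (\<lambda>_. borel)) X" for g
  have [measurable]: "X \<in> measurable (density M (\<lambda>\<omega>. ennreal (g \<omega>))) (PiM J (\<lambda>_. borel))" for g by simp
  have sets_\<nu>: "sets (\<nu> g) = sets (PiM J (\<lambda>_. borel))" for g by (simp add: \<nu>_def)
  have int_ind: "integrable M (\<lambda>\<omega>. indicator A (X \<omega>) * g \<omega>)"
    if [measurable]: "A \<in> sets (PiM J (\<lambda>_. borel))" and g: "integrable M g" for A and g :: "'a \<Rightarrow> real"
  proof (rule Bochner_Integration.integrable_bound[OF g])
    note [measurable] = borel_measurable_integrable[OF g]
    show "(\<lambda>\<omega>. indicator A (X \<omega>) * g \<omega>) \<in> borel_measurable M" by measurable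
  qed (auto simp: indicator_def)
  have em: "emeasure (\<nu> g) A = ennreal (\<integral>\<omega>. indicator A (X \<omega>) * g \<omega> \<partial>M)"
    if A[measurable]: "A \<in> sets (PiM J (\<lambda>_. borel))" and g: "integrable M g" and g0: "\<And>\<omega>. 0 \<le> g \<omega>" for A g
  proof -
    note [measurable] = borel_measurable_integrable[OF g]
    have "emeasure (\<nu> g) A = (\<integral>\<^sup>+\<omega>. ennreal (g \<omega>) * indicator (X -` A \<inter> space M) \<omega> \<partial>M)"
      unfolding \<nu>_def by (subst emeasure_distr) (auto simp: emeasure_density)
    also have "\<dots> = (\<integral>\<^sup>+\<omega>. ennreal (indicator A (X \<omega>) * g \<omega>) \<partial>M)"
      by (intro nn_integral_cong) (auto simp: indicator_def)
    also have "\<dots> = ennreal (\<integral>\<omega>. indicator A (X \<omega>) * g \<omega> \<partial>M)"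
      by (intro nn_integral_eq_integral int_ind A g) (auto simp: g0)
    finally show ?thesis .
  qed
  have fin: "finite_measure (\<nu> g)" if "integrable M g" "\<And>\<omega>. 0 \<le> g \<omega>" for g
    using em[OF _ that, of "space (\<nu> g)"] sets.top[of "\<nu> g"]
    by (intro finite_measureI) (simp add: sets_\<nu>)
  have "\<nu> Dp = \<nu> Dn"
  proof (rule finite_measure_eqI_upper_boxes[OF J sets_\<nu> sets_\<nu> fin[OF int(1) DD(2)]])
    fix a
    have "(\<integral>\<omega>. indicator (Bx a) (X \<omega>) * Dp \<omega> \<partial>M) - (\<integral>\<omega>. indicator (Bx a) (X \<omega>) * Dn \<omega> \<partial>M)
        = (\<integral>\<omega>. indicator (Bx a) (X \<omega>) * D \<omega> \<partial>M)"
      by (subst Bochner_Integration.integral_diff[symmetric, OF int_ind[OF Bx int(1)] int_ind[OF Bx int(2)]])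
        (simp add: DD right_diff_distrib)
    then show "emeasure (\<nu> Dp) (\<Pi>\<^sub>E j\<in>J. {a j<..}) = emeasure (\<nu> Dn) (\<Pi>\<^sub>E j\<in>J. {a j<..})"
      using box0[of a] em[OF Bx int(1), of a] em[OF Bx int(2), of a] DD unfolding Bx_def by simp
  qed
  moreover have "(\<integral>\<omega>. H (X \<omega>) * g \<omega> \<partial>M) = (\<integral>x. H x \<partial>\<nu> g)"
    if "integrable M g" "\<And>\<omega>. 0 \<le> g \<omega>" for g
  proof -
    note [measurable] = borel_measurable_integrable[OF that(1)]
    have "(\<integral>x. H x \<partial>\<nu> g) = (\<integral>\<omega>. H (X \<omega>) \<partial>density M (\<lambda>\<omega>. ennreal (g \<omega>)))"
      unfolding \<nu>_def by (rule integral_distr) auto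
    also have "\<dots> = (\<integral>\<omega>. g \<omega> * H (X \<omega>) \<partial>M)"
      using that by (subst integral_real_density) auto
    finally show ?thesis by (simp add: mult.commute)
  qed
  moreover have intH: "integrable M (\<lambda>\<omega>. H (X \<omega>) * g \<omega>)" if g: "integrable M g" for g :: "'a \<Rightarrow> real"
  proof (rule Bochner_Integration.integrable_bound[where f = "\<lambda>\<omega>. B * g \<omega>"])
    note [measurable] = borel_measurable_integrable[OF g]
    show "(\<lambda>\<omega>. H (X \<omega>) * g \<omega>) \<in> borel_measurable M" by measurable
    have "\<bar>H (X \<omega>)\<bar> \<le> \<bar>B\<bar>" if "\<omega> \<in> space M" for \<omega>
      using B[OF measurable_space[OF X that]] by simp
    then show "AE \<omega> in M. norm (H (X \<omega>) * g \<omega>) \<le> norm (B * g \<omega>)"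
      by (intro AE_I2) (auto simp: abs_mult intro!: mult_right_mono)
  qed (use g in simp)
  moreover have "(\<integral>\<omega>. H (X \<omega>) * D \<omega> \<partial>M) = (\<integral>\<omega>. H (X \<omega>) * Dp \<omega> \<partial>M) - (\<integral>\<omega>. H (X \<omega>) * Dn \<omega> \<partial>M)"
    by (subst Bochner_Integration.integral_diff[symmetric, OF intH[OF int(1)] intH[OF int(2)]])
      (simp add: DD right_diff_distrib)
  ultimately show ?thesis
    using int DD D by (simp add: has_bochner_integral_iff)
qed

section \<open>Disintegration by conditional quantiles\<close>

lemma AE_le_if_set_nn_integral_le:
  assumes [measurable]: "F \<in> borel_measurable M" "G \<in> borel_measurable M"
    and fin: "(\<integral>\<^sup>+x. F x \<partial>M) < \<infinity>"
    and le: "\<And>A. A \<in> sets M \<Longrightarrow> (\<integral>\<^sup>+x. F x * indicator A x \<partial>M) \<le> (\<integral>\<^sup>+x. G x * indicator A x \<partial>M)"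
  shows "AE x in M. F x \<le> (G x :: ennreal)"
proof -
  define B where "B = {x \<in> space M. G x < F x}"
  have [measurable]: "B \<in> sets M" unfolding B_def by measurable
  have "(\<integral>\<^sup>+x. G x * indicator B x \<partial>M) \<le> (\<integral>\<^sup>+x. F x \<partial>M)"
    by (intro nn_integral_mono) (auto simp: B_def indicator_def)
  then have finG: "(\<integral>\<^sup>+x. G x * indicator B x \<partial>M) \<noteq> \<infinity>" using fin by auto
  have "(\<integral>\<^sup>+x. F x * indicator B x - G x * indicator B x \<partial>M)
      = (\<integral>\<^sup>+x. F x * indicator B x \<partial>M) - (\<integral>\<^sup>+x. G x * indicator B x \<partial>M)"
    by (intro nn_integral_diff finG AE_I2) (auto simp: B_def indicator_def)
  also have "\<dots> = 0" using le[of B] finG by (auto simp: diff_eq_0_iff_ennreal top_unique less_top[symmetric])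
  finally have "AE x in M. F x * indicator B x - G x * indicator B x = 0"
    by (subst (asm) nn_integral_0_iff_AE) auto
  then show ?thesis
    using AE_space
  proof eventually_elim
    case (elim x)
    show ?case
    proof (cases "x \<in> B")
      case True
      with elim show ?thesis by (simp add: diff_eq_0_iff_ennreal)
    next
      case False
      with elim show ?thesis by (simp add: B_def not_less)
    qed
  qed
qed

abbreviation unit_uniform :: "real measure" where
  "unit_uniform \<equiv> uniform_measure lborel {0<..<1}"

lemma prob_space_unit_uniform: "prob_space unit_uniform"
  by (intro prob_space_uniform_measure) auto

lemma emeasure_unit_uniform_less:
  assumes "s \<le> 1"
  shows "emeasure unit_uniform {u. ennreal u < s} = s"
proof -
  obtain t where t: "0 \<le> t" "t \<le> 1" "s = ennreal t"
    using assms by (cases s) (auto simp: top_unique)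
  have [measurable]: "{u. ennreal u < s} \<in> sets borel" by measurable
  have "{0<..<1} \<inter> {u. ennreal u < s} = {0<..<t}"
    using t by (auto simp: ennreal_less_iff)
  then show ?thesis using t by (simp add: emeasure_uniform_measure divide_ennreal flip: ennreal_1)
qed

lemma pair_measure_eqI_upper:
  fixes P Q :: "('a \<times> real) measure"
  assumes sets: "sets P = sets (A \<Otimes>\<^sub>M borel)" "sets Q = sets (A \<Otimes>\<^sub>M borel)"
    and fin: "finite_measure P"
    and eq: "\<And>B r. B \<in> sets A \<Longrightarrow> emeasure P (B \<times> {r<..}) = emeasure Q (B \<times> {r<..})"
  shows "P = Q"
proof -
  interpret P: finite_measure P by fact
  note [measurable_cong] = sets
  have rect: "emeasure P (B \<times> C) = emeasure Q (B \<times> C)"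
    if B[measurable]: "B \<in> sets A" and C[measurable]: "C \<in> sets borel" for B C
  proof -
    define \<nu> where "\<nu> R = distr (density R (indicator (B \<times> UNIV))) borel snd" for R :: "('a \<times> real) measure"
    have em: "emeasure (\<nu> R) C = emeasure R (B \<times> C)"
      if S: "sets R = sets (A \<Otimes>\<^sub>M borel)" and [measurable]: "C \<in> sets borel" for R C
    proof -
      note [measurable_cong] = S
      have sp: "space R = space A \<times> UNIV"
        using sets_eq_imp_space_eq[OF S] by (simp add: space_pair_measure)
      have "emeasure (\<nu> R) C = (\<integral>\<^sup>+x. indicator (B \<times> UNIV) x * indicator (snd -` C \<inter> space R) x \<partial>R)"
        unfolding \<nu>_def by (subst emeasure_distr) (auto simp: emeasure_density)
      also have "\<dots> = (\<integral>\<^sup>+x. indicator (B \<times> C) x \<partial>R)"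
        using sets.sets_into_space[OF B] by (intro nn_integral_cong) (auto simp: indicator_def sp)
      finally show ?thesis by simp
    qed
    have "\<nu> P = \<nu> Q"
    proof (rule measure_eqI_lessThan)
      show "emeasure (\<nu> P) {x<..} < \<infinity>" for x
        using em[OF sets(1)] by (simp add: P.emeasure_finite less_top[symmetric])
      show "emeasure (\<nu> P) {x<..} = emeasure (\<nu> Q) {x<..}" for x
        using em[OF sets(1)] em[OF sets(2)] eq[OF B] by simp
    qed (auto simp: \<nu>_def)
    then show ?thesis using em[OF sets(1) C] em[OF sets(2) C] by simp
  qed
  show ?thesis
  proof (rule measure_eqI_generator_eq[OF Int_stable_pair_measure_generator[of A borel]])
    show "{a \<times> b |a b. a \<in> sets A \<and> b \<in> sets borel} \<subseteq> Pow (space A \<times> space borel)"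
      using sets.sets_into_space by fastforce
    show "emeasure P X = emeasure Q X" if "X \<in> {a \<times> b |a b. a \<in> sets A \<and> b \<in> sets borel}" for X
      using that rect by auto
    show "sets P = sigma_sets (space A \<times> space borel) {a \<times> b |a b. a \<in> sets A \<and> b \<in> sets borel}"
      "sets Q = sigma_sets (space A \<times> space borel) {a \<times> b |a b. a \<in> sets A \<and> b \<in> sets borel}"
      using sets by (simp_all add: sets_pair_measure)
    show "range (\<lambda>_::nat. space A \<times> space borel) \<subseteq> {a \<times> b |a b. a \<in> sets A \<and> b \<in> sets borel}"
      by (auto intro!: exI[of _ "space A"] exI[of _ "UNIV :: real set"])
  qed (auto simp: P.emeasure_finite)
qed

text \<open>
  \<open>f\<close> is a version of \<open>P(E | X = \<cdot>)\<close>: the Radon-Nikodym derivative of \<open>P(E \<inter> {X \<in> \<cdot>})\<close> with respect to the law of \<open>X\<close>.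
\<close>

lemma (in prob_space) conditional_law_density:
  assumes X[measurable]: "X \<in> measurable M A" and E[measurable]: "E \<in> sets M"
  obtains f where "f \<in> borel_measurable A"
    "\<And>B. B \<in> sets A \<Longrightarrow> (\<integral>\<^sup>+x. f x * indicator B x \<partial>distr M A X) = emeasure M ((X -` B \<inter> space M) \<inter> E)"
proof -
  interpret \<mu>: prob_space "distr M A X" by (rule prob_space_distr) fact
  define \<nu> where "\<nu> = distr (density M (indicator E)) A X"
  have [measurable]: "X \<in> measurable (density M (indicator E)) A" by simp
  have em: "emeasure \<nu> B = emeasure M ((X -` B \<inter> space M) \<inter> E)" if [measurable]: "B \<in> sets A" for B
  proof -
    have "emeasure \<nu> B = (\<integral>\<^sup>+\<omega>. indicator E \<omega> * indicator (X -` B \<inter> space M) \<omega> \<partial>M)"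
      unfolding \<nu>_def by (subst emeasure_distr) (auto simp: emeasure_density)
    also have "\<dots> = (\<integral>\<^sup>+\<omega>. indicator ((X -` B \<inter> space M) \<inter> E) \<omega> \<partial>M)"
      by (intro nn_integral_cong) (auto simp: indicator_def)
    finally show ?thesis by simp
  qed
  have "absolutely_continuous (distr M A X) \<nu>"
    unfolding absolutely_continuous_def
  proof
    fix B assume "B \<in> null_sets (distr M A X)"
    then have B: "B \<in> sets A" "emeasure M (X -` B \<inter> space M) = 0"
      by (auto simp: null_sets_def emeasure_distr)
    have "emeasure M ((X -` B \<inter> space M) \<inter> E) \<le> emeasure M (X -` B \<inter> space M)"
      using B(1) by (intro emeasure_mono) auto
    with B show "B \<in> null_sets \<nu>" by (auto simp: null_sets_def em \<nu>_def[THEN arg_cong[where f = sets]])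
  qed
  then obtain f where f: "f \<in> borel_measurable (distr M A X)" "density (distr M A X) f = \<nu>"
    using \<mu>.Radon_Nikodym[of \<nu>] by (auto simp: \<nu>_def)
  show ?thesis
  proof (rule that[of f])
    show "f \<in> borel_measurable A" using f(1) by simp
    fix B assume "B \<in> sets A"
    then show "(\<integral>\<^sup>+x. f x * indicator B x \<partial>distr M A X) = emeasure M ((X -` B \<inter> space M) \<inter> E)"
      using f by (subst em[symmetric]) (auto simp: f(2)[symmetric] emeasure_density)
  qed
qed

text \<open>
  The conditional law of \<open>Y\<close> given \<open>X = x\<close> is represented as the law of \<open>Z(x, U)\<close> for an independent uniform \<open>U\<close>, where
  \<open>Z(x, \<cdot>)\<close> is a generalised inverse of the conditional tail function \<open>q \<mapsto> P(Y > q | X = x)\<close>. Only rational \<open>q\<close> occur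
  in the construction, so the exceptional null sets of the densities \<open>F q\<close> cause no harm, and a kernel is
  obtained as an ordinary measurable function on a product space. That \<open>Y\<close> is bounded makes the supremum in \<open>Z\<close> well-defined for
  every \<open>x\<close>.
\<close>

lemma (in prob_space) quantile_transform_bounded:
  assumes X[measurable]: "X \<in> measurable M A" and Y[measurable]: "Y \<in> borel_measurable M"
    and Y01: "\<And>\<omega>. 0 \<le> Y \<omega>" "\<And>\<omega>. Y \<omega> < (1 :: real)"
  obtains Z where "Z \<in> borel_measurable (A \<Otimes>\<^sub>M borel)"
    "distr (distr M A X \<Otimes>\<^sub>M unit_uniform) (A \<Otimes>\<^sub>M borel) (\<lambda>(x, u). (x, Z (x, u)))
      = distr M (A \<Otimes>\<^sub>M borel) (\<lambda>\<omega>. (X \<omega>, Y \<omega>))"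
proof -
  define \<mu> where "\<mu> = distr M A X"
  interpret \<mu>: prob_space \<mu> unfolding \<mu>_def by (rule prob_space_distr) fact
  interpret U: prob_space unit_uniform by (rule prob_space_unit_uniform)
  have [measurable_cong]: "sets \<mu> = sets A" by (simp add: \<mu>_def)
  define ev where "ev B r = (X -` B \<inter> space M) \<inter> {\<omega> \<in> space M. r < Y \<omega>}" for B r
  have ev[measurable]: "ev B r \<in> sets M" if [measurable]: "B \<in> sets A" for B r
    unfolding ev_def by measurable
  have "\<forall>r. \<exists>f. f \<in> borel_measurable A \<and> (\<forall>B\<in>sets A. (\<integral>\<^sup>+x. f x * indicator B x \<partial>\<mu>) = emeasure M (ev B r))"
  proof
    fix r
    have "{\<omega> \<in> space M. r < Y \<omega>} \<in> sets M" by measurable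
    from conditional_law_density[OF X this]
    show "\<exists>f. f \<in> borel_measurable A \<and> (\<forall>B\<in>sets A. (\<integral>\<^sup>+x. f x * indicator B x \<partial>\<mu>) = emeasure M (ev B r))"
      unfolding \<mu>_def ev_def by metis
  qed
  from choice[OF this] obtain F where F[measurable]: "\<And>r. F r \<in> borel_measurable A"
    and F_int: "\<And>r B. B \<in> sets A \<Longrightarrow> (\<integral>\<^sup>+x. F r x * indicator B x \<partial>\<mu>) = emeasure M (ev B r)"
    by blast
  have fin: "(\<integral>\<^sup>+x. F r x \<partial>\<mu>) < \<infinity>" for r
  proof -
    have "(\<integral>\<^sup>+x. F r x \<partial>\<mu>) = (\<integral>\<^sup>+x. F r x * indicator (space A) x \<partial>\<mu>)"
      by (intro nn_integral_cong) (simp add: \<mu>_def)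
    also have "\<dots> < \<infinity>" by (subst F_int) (auto simp: emeasure_finite less_top[symmetric])
    finally show ?thesis .
  qed
  have F1: "AE x in \<mu>. F r x \<le> 1" for r
  proof (rule AE_le_if_set_nn_integral_le[OF _ _ fin])
    fix B assume "B \<in> sets \<mu>"
    then have [measurable]: "B \<in> sets A" by (simp add: \<mu>_def)
    have "emeasure M (ev B r) \<le> emeasure M (X -` B \<inter> space M)"
      by (intro emeasure_mono) (auto simp: ev_def)
    then show "(\<integral>\<^sup>+x. F r x * indicator B x \<partial>\<mu>) \<le> (\<integral>\<^sup>+x. 1 * indicator B x \<partial>\<mu>)"
      by (simp add: F_int) (simp add: \<mu>_def emeasure_distr)
  qed auto
  have F_mono: "AE x in \<mu>. F q x \<le> F r x" if "r \<le> q" for q r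
  proof (rule AE_le_if_set_nn_integral_le[OF _ _ fin])
    fix B assume "B \<in> sets \<mu>"
    then have [measurable]: "B \<in> sets A" by (simp add: \<mu>_def)
    show "(\<integral>\<^sup>+x. F q x * indicator B x \<partial>\<mu>) \<le> (\<integral>\<^sup>+x. F r x * indicator B x \<partial>\<mu>)"
      using that by (simp add: F_int) (intro emeasure_mono, auto simp: ev_def)
  qed auto
  define Q where "Q = \<rat> \<inter> {0 <..< 1 :: real}"
  have Q: "countable Q" unfolding Q_def by (intro countable_Int1 countable_rat)
  have "1 / 2 \<in> Q" by (auto simp: Q_def)
  then have Q_ne: "Q \<noteq> {}" by auto
  define Z where "Z = (\<lambda>(x, u :: real). SUP q\<in>Q. if ennreal u < F q x then q else 0)"
  have bdd: "bdd_above ((\<lambda>q. if ennreal u < F q x then q else 0) ` Q)" for x u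
    by (intro bdd_aboveI[of _ 1]) (auto simp: Q_def)
  have Z[measurable]: "Z \<in> borel_measurable (A \<Otimes>\<^sub>M borel)"
    unfolding Z_def split_beta' by (intro borel_measurable_cSUP Q bdd) measurable
  define S where "S r x = (SUP q\<in>Q \<inter> {r<..}. F q x)" for r x
  have S[measurable]: "S r \<in> borel_measurable A" for r
    unfolding S_def[abs_def] using Q by (intro borel_measurable_SUP) auto
  have S1: "AE x in \<mu>. S r x \<le> 1" for r
  proof -
    have "AE x in \<mu>. \<forall>q\<in>Q \<inter> {r<..}. F q x \<le> 1" using Q F1 by (subst AE_ball_countable) auto
    then show ?thesis by eventually_elim (auto simp: S_def intro!: SUP_least)
  qed
  have Z_gt: "r < Z (x, u) \<longleftrightarrow> ennreal u < S r x" if "0 \<le> r" for r x u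
  proof -
    have "r < Z (x, u) \<longleftrightarrow> (\<exists>q\<in>Q. r < (if ennreal u < F q x then q else 0))"
      unfolding Z_def prod.case by (rule less_cSUP_iff[OF Q_ne bdd])
    also have "\<dots> \<longleftrightarrow> (\<exists>q\<in>Q \<inter> {r<..}. ennreal u < F q x)" using that by auto
    finally show ?thesis by (simp add: S_def less_SUP_iff)
  qed
  have Z0: "0 \<le> Z (x, u)" for x u
  proof -
    obtain q where q: "q \<in> Q" using Q_ne by auto
    have "0 \<le> (if ennreal u < F q x then q else 0)" using q by (auto simp: Q_def)
    also have "\<dots> \<le> Z (x, u)" unfolding Z_def prod.case by (rule cSUP_upper[OF q bdd])
    finally show ?thesis .
  qed
  \<comment> \<open>Right-continuity of the tail function, in integrated form.\<close>
  have S_int: "(\<integral>\<^sup>+x. S r x * indicator B x \<partial>\<mu>) = emeasure M (ev B r)"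
    if r: "0 \<le> r" and B[measurable]: "B \<in> sets A" for r B
  proof (rule antisym)
    have "AE x in \<mu>. \<forall>q\<in>Q \<inter> {r<..}. F q x \<le> F r x"
      using Q F_mono by (subst AE_ball_countable) auto
    then have "AE x in \<mu>. S r x * indicator B x \<le> F r x * indicator B x"
      by eventually_elim (auto simp: S_def intro!: SUP_least mult_right_mono)
    then have "(\<integral>\<^sup>+x. S r x * indicator B x \<partial>\<mu>) \<le> (\<integral>\<^sup>+x. F r x * indicator B x \<partial>\<mu>)"
      by (rule nn_integral_mono_AE)
    then show "(\<integral>\<^sup>+x. S r x * indicator B x \<partial>\<mu>) \<le> emeasure M (ev B r)" by (simp add: F_int)
    show "emeasure M (ev B r) \<le> (\<integral>\<^sup>+x. S r x * indicator B x \<partial>\<mu>)"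
    proof (cases "r < 1")
      case False
      then have "\<omega> \<notin> ev B r" for \<omega> using Y01(2)[of \<omega>] by (auto simp: ev_def)
      then have "ev B r = {}" by auto
      then show ?thesis by simp
    next
      case True
      have "(\<Union>m. ev B (r + 1 / real (Suc m))) = ev B r"
      proof (intro equalityI subsetI)
        fix \<omega> assume \<omega>: "\<omega> \<in> ev B r"
        then have "0 < Y \<omega> - r" by (auto simp: ev_def)
        then obtain m where "1 / real (Suc m) < Y \<omega> - r" using nat_approx_posE by blast
        with \<omega> show "\<omega> \<in> (\<Union>m. ev B (r + 1 / real (Suc m)))"
          by (auto simp: ev_def intro!: exI[of _ m])
      next
        fix \<omega> assume "\<omega> \<in> (\<Union>m. ev B (r + 1 / real (Suc m)))"
        then obtain m where "\<omega> \<in> ev B (r + 1 / real (Suc m))" by auto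
        moreover have "0 < 1 / real (Suc m)" by simp
        ultimately have "r < Y \<omega>" unfolding ev_def Int_iff mem_Collect_eq by linarith
        with \<open>\<omega> \<in> ev B _\<close> show "\<omega> \<in> ev B r" by (simp add: ev_def)
      qed
      moreover have "incseq (\<lambda>m. ev B (r + 1 / real (Suc m)))"
      proof (intro incseq_SucI subsetI)
        fix m \<omega> assume "\<omega> \<in> ev B (r + 1 / real (Suc m))"
        moreover have "1 / real (Suc (Suc m)) \<le> 1 / real (Suc m)" by (intro divide_left_mono) auto
        ultimately have "r + 1 / real (Suc (Suc m)) < Y \<omega>" unfolding ev_def Int_iff mem_Collect_eq by linarith
        with \<open>\<omega> \<in> ev B _\<close> show "\<omega> \<in> ev B (r + 1 / real (Suc (Suc m)))" by (simp add: ev_def)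
      qed
      ultimately have "emeasure M (ev B r) = (SUP m. emeasure M (ev B (r + 1 / real (Suc m))))"
        by (subst SUP_emeasure_incseq) auto
      also have "\<dots> \<le> (\<integral>\<^sup>+x. S r x * indicator B x \<partial>\<mu>)"
      proof (rule SUP_least)
        fix m
        have "r < min 1 (r + 1 / real (Suc m))" using True by simp
        then obtain q where q: "q \<in> \<rat>" "r < q" "q < min 1 (r + 1 / real (Suc m))"
          using Rats_dense_in_real by blast
        then have qQ: "q \<in> Q \<inter> {r<..}" using r by (auto simp: Q_def)
        have "emeasure M (ev B (r + 1 / real (Suc m))) \<le> emeasure M (ev B q)"
          using q(3) by (intro emeasure_mono ev B) (auto simp: ev_def)
        also have "\<dots> = (\<integral>\<^sup>+x. F q x * indicator B x \<partial>\<mu>)" by (simp add: F_int)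
        also have "\<dots> \<le> (\<integral>\<^sup>+x. S r x * indicator B x \<partial>\<mu>)"
          using qQ by (intro nn_integral_mono mult_right_mono) (auto simp: S_def intro: SUP_upper)
        finally show "emeasure M (ev B (r + 1 / real (Suc m))) \<le> (\<integral>\<^sup>+x. S r x * indicator B x \<partial>\<mu>)" .
      qed
      finally show ?thesis .
    qed
  qed
  define T where "T = (\<lambda>(x, u). (x, Z (x, u)))"
  have [measurable]: "T \<in> measurable (A \<Otimes>\<^sub>M borel) (A \<Otimes>\<^sub>M borel)" unfolding T_def by measurable
  have [measurable]: "T \<in> measurable (\<mu> \<Otimes>\<^sub>M unit_uniform) (A \<Otimes>\<^sub>M borel)"
    by (subst measurable_cong_sets[OF sets_pair_measure_cong refl]) (auto simp: \<mu>_def)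
  interpret P: pair_prob_space \<mu> unit_uniform ..
  have "distr (\<mu> \<Otimes>\<^sub>M unit_uniform) (A \<Otimes>\<^sub>M borel) T = distr M (A \<Otimes>\<^sub>M borel) (\<lambda>\<omega>. (X \<omega>, Y \<omega>))"
  proof (rule pair_measure_eqI_upper[where A = A])
    show "finite_measure (distr (\<mu> \<Otimes>\<^sub>M unit_uniform) (A \<Otimes>\<^sub>M borel) T)"
      by (intro P.finite_measure_distr) measurable
    fix B r assume B[measurable]: "B \<in> sets A"
    define E where "E = T -` (B \<times> {r<..}) \<inter> space (\<mu> \<Otimes>\<^sub>M unit_uniform)"
    have [measurable]: "E \<in> sets (\<mu> \<Otimes>\<^sub>M unit_uniform)" unfolding E_def by measurable
    have sp: "space (\<mu> \<Otimes>\<^sub>M unit_uniform) = space A \<times> UNIV"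
      by (simp add: space_pair_measure \<mu>_def)
    have BA: "B \<subseteq> space A" using sets.sets_into_space[OF B] .
    have rhs: "emeasure (distr M (A \<Otimes>\<^sub>M borel) (\<lambda>\<omega>. (X \<omega>, Y \<omega>))) (B \<times> {r<..}) = emeasure M (ev B r)"
      by (subst emeasure_distr) (auto simp: ev_def intro!: arg_cong[where f = "emeasure M"])
    have "emeasure (distr (\<mu> \<Otimes>\<^sub>M unit_uniform) (A \<Otimes>\<^sub>M borel) T) (B \<times> {r<..}) = emeasure (\<mu> \<Otimes>\<^sub>M unit_uniform) E"
      unfolding E_def by (rule emeasure_distr) auto
    also have "\<dots> = (\<integral>\<^sup>+x. emeasure unit_uniform (Pair x -` E) \<partial>\<mu>)"
      by (rule U.emeasure_pair_measure_alt) fact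
    also have "\<dots> = emeasure M (ev B r)"
    proof (cases "0 \<le> r")
      case True
      have "AE x in \<mu>. emeasure unit_uniform (Pair x -` E) = S r x * indicator B x"
        using S1[of r]
      proof eventually_elim
        case (elim x)
        have "Pair x -` E = (if x \<in> B then {u. ennreal u < S r x} else {})"
          using Z_gt[OF True] BA by (auto simp: E_def T_def sp)
        then show ?case using emeasure_unit_uniform_less[OF elim] by simp
      qed
      then show ?thesis by (subst nn_integral_cong_AE) (auto simp: S_int[OF True B])
    next
      case False
      have "r < Z (x, u)" for x u using Z0[of x u] False by linarith
      then have "Pair x -` E = (if x \<in> B then UNIV else {})" for x
        using BA by (auto simp: E_def T_def sp)
      then have "emeasure unit_uniform (Pair x -` E) = indicator B x" for x
        using U.emeasure_space_1 by simp
      moreover have "r < Y \<omega>" for \<omega> using Y01(1)[of \<omega>] False by linarith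
      then have "ev B r = X -` B \<inter> space M" by (auto simp: ev_def)
      ultimately show ?thesis by (simp add: \<mu>_def emeasure_distr)
    qed
    finally show "emeasure (distr (\<mu> \<Otimes>\<^sub>M unit_uniform) (A \<Otimes>\<^sub>M borel) T) (B \<times> {r<..})
        = emeasure (distr M (A \<Otimes>\<^sub>M borel) (\<lambda>\<omega>. (X \<omega>, Y \<omega>))) (B \<times> {r<..})"
      using rhs by simp
  qed auto
  with Z show ?thesis by (intro that[of Z]) (simp_all add: \<mu>_def T_def)
qed

lemma (in prob_space) quantile_transform:
  assumes X[measurable]: "X \<in> measurable M A" and Y[measurable]: "Y \<in> borel_measurable M"
  obtains Z :: "'b \<times> real \<Rightarrow> real" where "Z \<in> borel_measurable (A \<Otimes>\<^sub>M borel)"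
    "distr (distr M A X \<Otimes>\<^sub>M unit_uniform) (A \<Otimes>\<^sub>M borel) (\<lambda>(x, u). (x, Z (x, u)))
      = distr M (A \<Otimes>\<^sub>M borel) (\<lambda>\<omega>. (X \<omega>, Y \<omega>))"
proof -
  have [measurable]: "squash \<in> borel_measurable borel" unfolding squash_def by measurable
  have "(\<lambda>\<omega>. squash (Y \<omega>)) \<in> borel_measurable M" by measurable
  from quantile_transform_bounded[OF X this squash_bounds]
  obtain Z where Z[measurable]: "Z \<in> borel_measurable (A \<Otimes>\<^sub>M borel)"
    and law: "distr (distr M A X \<Otimes>\<^sub>M unit_uniform) (A \<Otimes>\<^sub>M borel) (\<lambda>(x, u). (x, Z (x, u)))
      = distr M (A \<Otimes>\<^sub>M borel) (\<lambda>\<omega>. (X \<omega>, squash (Y \<omega>)))" by blast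
  define S where "S = (\<lambda>(x :: 'b, y). (x, unsquash y))"
  have S[measurable]: "S \<in> measurable (A \<Otimes>\<^sub>M borel) (A \<Otimes>\<^sub>M borel)" unfolding S_def by measurable
  have T: "(\<lambda>(x, u). (x, Z (x, u))) \<in> measurable (distr M A X \<Otimes>\<^sub>M unit_uniform) (A \<Otimes>\<^sub>M borel)"
    by (subst measurable_cong_sets[OF sets_pair_measure_cong refl, of _ A _ borel]) auto
  have "distr (distr M A X \<Otimes>\<^sub>M unit_uniform) (A \<Otimes>\<^sub>M borel) (S \<circ> (\<lambda>(x, u). (x, Z (x, u))))
      = distr M (A \<Otimes>\<^sub>M borel) (S \<circ> (\<lambda>\<omega>. (X \<omega>, squash (Y \<omega>))))"
    using arg_cong[OF law, of "\<lambda>N. distr N (A \<Otimes>\<^sub>M borel) S"]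
    by (subst (asm) (1 2) distr_distr) (use S T in auto)
  then show ?thesis
    by (intro that[of "\<lambda>p. unsquash (Z p)"]) (auto simp: S_def comp_def split_beta' unsquash_squash)
qed

section \<open>Expectations and martingale measures\<close>

text \<open>
  The integrals of the positive and negative parts are lower integrals if \<open>f\<close> or \<open>g\<close> is not measurable; they are monotone all
  the same. This is how expectations of biconjugates are estimated.
\<close>

lemma ereal_expectation_mono:
  assumes "AE x in M. f x \<le> g x"
  shows "ereal_expectation M f \<le> ereal_expectation M g"
  unfolding ereal_expectation_def
proof (intro ereal_minus_mono)
  show "enn2ereal (\<integral>\<^sup>+x. e2ennreal (f x) \<partial>M) \<le> enn2ereal (\<integral>\<^sup>+x. e2ennreal (g x) \<partial>M)"
    unfolding less_eq_ennreal.rep_eq[symmetric]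
  proof (rule nn_integral_mono_AE)
    show "AE x in M. e2ennreal (f x) \<le> e2ennreal (g x)"
      using assms by eventually_elim (rule e2ennreal_mono)
  qed
  show "enn2ereal (\<integral>\<^sup>+x. e2ennreal (- g x) \<partial>M) \<le> enn2ereal (\<integral>\<^sup>+x. e2ennreal (- f x) \<partial>M)"
    unfolding less_eq_ennreal.rep_eq[symmetric]
  proof (rule nn_integral_mono_AE)
    show "AE x in M. e2ennreal (- g x) \<le> e2ennreal (- f x)"
      using assms by eventually_elim (simp add: e2ennreal_mono)
  qed
qed

lemma ereal_expectation_integrable:
  assumes g: "integrable M g" and eq: "AE x in M. f x = ereal (g x)"
  shows "ereal_expectation M f = ereal (\<integral>x. g x \<partial>M)"
proof -
  have fin: "(\<integral>\<^sup>+x. ennreal (g x) \<partial>M) < \<infinity>" "(\<integral>\<^sup>+x. ennreal (- g x) \<partial>M) < \<infinity>"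
    using integrableD[OF g] by (auto simp: less_top)
  have "(\<integral>\<^sup>+x. e2ennreal (f x) \<partial>M) = (\<integral>\<^sup>+x. ennreal (g x) \<partial>M)"
    "(\<integral>\<^sup>+x. e2ennreal (- f x) \<partial>M) = (\<integral>\<^sup>+x. ennreal (- g x) \<partial>M)"
    using eq by (auto intro!: nn_integral_cong_AE elim!: eventually_mono simp: e2ennreal_ereal)
  then show ?thesis
    unfolding ereal_expectation_def real_lebesgue_integral_def[OF g] using fin
    by (cases "\<integral>\<^sup>+x. ennreal (g x) \<partial>M"; cases "\<integral>\<^sup>+x. ennreal (- g x) \<partial>M") (auto simp: enn2ereal_ennreal)
qed

lemma continuous_map_prod_ramps:
  assumes "finite J"
  shows "continuous_map (powertop_real J) euclideanreal (\<lambda>x. \<Prod>j\<in>J. ramp (b j) m (x j))"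
proof (rule continuous_map_prod[OF assms])
  fix j assume "j \<in> J"
  then have "continuous_map (powertop_real J) euclideanreal (\<lambda>x. x j)"
    by (rule continuous_map_product_projection)
  from continuous_map_compose[OF this, of euclideanreal "ramp (b j) m"]
  show "continuous_map (powertop_real J) euclideanreal (\<lambda>x. ramp (b j) m (x j))"
    using continuous_on_ramp[of UNIV] by (simp add: comp_def)
qed

abbreviation path_space :: "nat \<Rightarrow> (nat \<Rightarrow> real) measure" where
  "path_space i \<equiv> PiM {1..i} (\<lambda>_. borel)"

locale martingale_coupling =
  fixes n :: nat and \<mu> :: "nat \<Rightarrow> real measure" and Q :: "(nat \<Rightarrow> real) measure"
  assumes marginal_integrable: "\<And>i. i \<in> {1..n} \<Longrightarrow> integrable (\<mu> i) (\<lambda>x. x)"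
    and Q: "Q \<in> martingale_measures n \<mu>"
begin

sublocale prob_space Q
  using Q by (simp add: martingale_measures_def couplings_def)

lemma sets_Q [measurable_cong]: "sets Q = sets (path_space n)"
  using Q by (simp add: martingale_measures_def couplings_def)

lemma space_Q: "space Q = R_space n"
  using sets_eq_imp_space_eq[OF sets_Q] by (simp add: space_PiM)

lemma marginal: "i \<in> {1..n} \<Longrightarrow> \<mu> i = distr Q borel (\<lambda>x. x i)"
  using Q by (simp add: martingale_measures_def couplings_def)

lemma measurable_coordinate [measurable]: "i \<in> {1..n} \<Longrightarrow> (\<lambda>x. x i) \<in> borel_measurable Q"
  by measurable

lemma measurable_initial [measurable]:
  "i \<le> n \<Longrightarrow> (\<lambda>x. restrict x {1..i}) \<in> measurable Q (path_space i)"
  by (subst measurable_cong_sets[OF sets_Q refl]) (intro measurable_restrict_subset, auto)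

lemma integrable_marginal:
  fixes f :: "real \<Rightarrow> real"
  assumes "i \<in> {1..n}" "integrable (\<mu> i) f"
  shows "integrable Q (\<lambda>x. f (x i))" "(\<integral>x. f (x i) \<partial>Q) = (\<integral>s. f s \<partial>\<mu> i)"
proof -
  have [measurable]: "f \<in> borel_measurable borel"
    using borel_measurable_integrable[OF assms(2)] assms(1) by (simp add: marginal)
  show "integrable Q (\<lambda>x. f (x i))"
    using assms integrable_distr_eq[of "\<lambda>x. x i" Q borel f] by (simp add: marginal)
  show "(\<integral>x. f (x i) \<partial>Q) = (\<integral>s. f s \<partial>\<mu> i)"
    using assms integral_distr[of "\<lambda>x. x i" Q borel f] by (simp add: marginal)
qed

lemma integrable_coordinate: "i \<in> {1..n} \<Longrightarrow> integrable Q (\<lambda>x. x i)"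
  using integrable_marginal(1)[OF _ marginal_integrable] by simp

text \<open>
  The martingale property is stated for continuous weights only. Products of ramps are such weights, and they determine
  the rest.
\<close>

lemma martingale_bounded_measurable:
  fixes H :: "(nat \<Rightarrow> real) \<Rightarrow> real"
  assumes i: "i \<in> {1..n - 1}"
    and H: "H \<in> borel_measurable (path_space i)" "\<And>x. \<bar>H x\<bar> \<le> B"
  shows "has_bochner_integral Q (\<lambda>x. H (restrict x {1..i}) * (x (Suc i) - x i)) 0"
proof (rule orthogonal_if_orthogonal_to_ramps[where J = "{1..i}" and B = B and H = H
      and X = "\<lambda>x. restrict x {1..i}" and D = "\<lambda>x. x (Suc i) - x i"])
  show "(\<lambda>x. restrict x {1..i}) \<in> measurable Q (path_space i)"
    using i by (intro measurable_initial) auto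
  show "integrable Q (\<lambda>x. x (Suc i) - x i)"
    using i by (intro Bochner_Integration.integrable_diff integrable_coordinate) auto
  fix b :: "nat \<Rightarrow> real" and m
  have "bounded ((\<lambda>x. \<Prod>j\<in>{1..i}. ramp (b j) m (x j)) ` R_space i)"
    by (intro boundedI[of _ 1]) (auto simp: abs_prod intro!: prod_le_1 ramp_bounds)
  with continuous_map_prod_ramps[of "{1..i}" b m]
  have "has_bochner_integral Q
      (\<lambda>x. (\<Prod>j\<in>{1..i}. ramp (b j) m (restrict x {1..i} j)) * (x (Suc i) - x i)) 0"
    using Q i unfolding martingale_measures_def by blast
  then show "(\<integral>x. (\<Prod>j\<in>{1..i}. ramp (b j) m (restrict x {1..i} j)) * (x (Suc i) - x i) \<partial>Q) = 0"
    by (rule has_bochner_integral_integral_eq)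
qed (use H in auto)

end

section \<open>Iterated biconjugates are below conditional expectations\<close>

text \<open>
  Jensen's inequality, applied to each convex minorant \<open>h\<close> of \<open>f\<close> through its supporting line at the mean \<open>a\<close>.
\<close>

lemma convex_biconjugate_le_mean:
  assumes U: "prob_space U" and z: "integrable U z" "(\<integral>u. z u \<partial>U) = a" and g: "integrable U g"
    and le: "AE u in U. f (z u) \<le> ereal (g u)"
  shows "convex_biconjugate f a \<le> ereal (\<integral>u. g u \<partial>U)"
  unfolding convex_biconjugate_def
proof (rule Sup_least, safe)
  interpret U: prob_space U by fact
  fix h :: "real \<Rightarrow> real" assume h: "convex_on UNIV h" "\<forall>y. ereal (h y) \<le> f y"
  define s where "s = Inf ((\<lambda>t. (h a - h t) / (a - t)) ` ({a<..} \<inter> UNIV))"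
  have s: "h a + s * (y - a) \<le> h y" for y
    unfolding s_def using convex_le_Inf_differential[OF h(1), of a y] by simp
  have "AE u in U. h a + s * (z u - a) \<le> g u"
    using le
  proof eventually_elim
    case (elim u)
    have "ereal (h (z u)) \<le> ereal (g u)" using h(2) elim order_trans by blast
    then show ?case using s[of "z u"] by simp
  qed
  then have "(\<integral>u. h a + s * (z u - a) \<partial>U) \<le> (\<integral>u. g u \<partial>U)"
    using z g by (intro integral_mono_AE) auto
  moreover have "(\<integral>u. h a + s * (z u - a) \<partial>U) = h a"
    using z by (simp add: U.prob_space)
  ultimately show "ereal (h a) \<le> ereal (\<integral>u. g u \<partial>U)" by simp
qed

context martingale_coupling
begin

definition initial_law :: "nat \<Rightarrow> (nat \<Rightarrow> real) measure" where
  "initial_law i = distr Q (path_space i) (\<lambda>x. restrict x {1..i})"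

lemma sets_initial_law [measurable_cong]: "sets (initial_law i) = sets (path_space i)"
  by (simp add: initial_law_def)

lemma prob_space_initial_law: "i \<le> n \<Longrightarrow> prob_space (initial_law i)"
  unfolding initial_law_def by (rule prob_space_distr) simp

text \<open>
  One step of the path under \<open>Q\<close> is drawn from a conditional law with mean \<open>x i\<close>. To see the latter, the conditional mean \<open>b\<close> is compared
  with \<open>x i\<close> through the bounded weight \<open>sgn (b x - x i)\<close>, for which the martingale property reads
  \<open>E \<bar>b - x i\<bar> = 0\<close>.
\<close>

lemma disintegration:
  assumes i: "i \<in> {1..n - 1}"
  obtains Z :: "(nat \<Rightarrow> real) \<times> real \<Rightarrow> real"
  where "Z \<in> borel_measurable (path_space i \<Otimes>\<^sub>M borel)"
    "initial_law (Suc i) = distr (initial_law i \<Otimes>\<^sub>M unit_uniform) (path_space (Suc i))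
      (\<lambda>(x, u). x(Suc i := Z (x, u)))"
    "AE x in initial_law i. integrable unit_uniform (\<lambda>u. Z (x, u)) \<and> (\<integral>u. Z (x, u) \<partial>unit_uniform) = x i"
proof -
  have i': "i \<in> {1..n}" "Suc i \<in> {1..n}" "i \<le> n" "Suc i \<le> n" using i by auto
  let ?A = "path_space i"
  let ?R = "initial_law i"
  interpret R: prob_space ?R by (rule prob_space_initial_law) fact
  interpret U: prob_space unit_uniform by (rule prob_space_unit_uniform)
  interpret P: pair_prob_space ?R unit_uniform ..
  note [measurable] = measurable_initial[OF i'(3)] measurable_coordinate[OF i'(1)] measurable_coordinate[OF i'(2)]
  from quantile_transform[OF measurable_initial[OF i'(3)] measurable_coordinate[OF i'(2)]]
  obtain Z where Z[measurable]: "Z \<in> borel_measurable (?A \<Otimes>\<^sub>M borel)"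
    and law: "distr (?R \<Otimes>\<^sub>M unit_uniform) (?A \<Otimes>\<^sub>M borel) (\<lambda>(x, u). (x, Z (x, u)))
      = distr Q (?A \<Otimes>\<^sub>M borel) (\<lambda>x. (restrict x {1..i}, x (Suc i)))"
    unfolding initial_law_def by blast
  have [measurable_cong]: "sets (?R \<Otimes>\<^sub>M unit_uniform) = sets (?A \<Otimes>\<^sub>M borel)"
    by (intro sets_pair_measure_cong) (auto simp: sets_initial_law)
  define T where "T = (\<lambda>(x, u). (x, Z (x, u)))"
  have T[measurable]: "T \<in> measurable (?R \<Otimes>\<^sub>M unit_uniform) (?A \<Otimes>\<^sub>M borel)"
    unfolding T_def by measurable
  have I: "insert (Suc i) {1..i} = {1..Suc i}" by auto
  define G where "G = (\<lambda>(x, y). x(Suc i := y :: real))"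
  have G[measurable]: "G \<in> measurable (?A \<Otimes>\<^sub>M borel) (path_space (Suc i))"
    unfolding G_def I[symmetric] by (rule measurable_add_dim)
  have Q_pair[measurable]: "(\<lambda>x. (restrict x {1..i}, x (Suc i))) \<in> measurable Q (?A \<Otimes>\<^sub>M borel)"
    by measurable
  have step: "initial_law (Suc i) = distr (?R \<Otimes>\<^sub>M unit_uniform) (path_space (Suc i)) (G \<circ> T)"
  proof -
    have "distr (?R \<Otimes>\<^sub>M unit_uniform) (path_space (Suc i)) (G \<circ> T)
        = distr Q (path_space (Suc i)) (G \<circ> (\<lambda>x. (restrict x {1..i}, x (Suc i))))"
      using arg_cong[OF law, of "\<lambda>N. distr N (path_space (Suc i)) G"]
      unfolding T_def[symmetric] by (simp only: distr_distr[OF G T] distr_distr[OF G Q_pair])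
    also have "G \<circ> (\<lambda>x. (restrict x {1..i}, x (Suc i))) = (\<lambda>x. restrict x {1..Suc i})"
      by (auto simp: G_def fun_eq_iff restrict_def)
    finally show ?thesis by (simp only: initial_law_def[of "Suc i"])
  qed
  have transfer: "has_bochner_integral (?R \<Otimes>\<^sub>M unit_uniform) (\<lambda>p. f (T p)) v
      \<longleftrightarrow> has_bochner_integral Q (\<lambda>x. f (restrict x {1..i}, x (Suc i))) v"
    if [measurable]: "f \<in> borel_measurable (?A \<Otimes>\<^sub>M borel)" for f and v :: real
  proof -
    have "has_bochner_integral (?R \<Otimes>\<^sub>M unit_uniform) (\<lambda>p. f (T p)) v
        \<longleftrightarrow> has_bochner_integral (distr (?R \<Otimes>\<^sub>M unit_uniform) (?A \<Otimes>\<^sub>M borel) T) f v"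
      by (simp only: has_bochner_integral_iff integrable_distr_eq[OF T that] integral_distr[OF T that])
    also have "\<dots> \<longleftrightarrow> has_bochner_integral Q (\<lambda>x. f (restrict x {1..i}, x (Suc i))) v"
      unfolding T_def law
      by (simp only: has_bochner_integral_iff integrable_distr_eq[OF Q_pair that] integral_distr[OF Q_pair that])
    finally show ?thesis .
  qed
  have xi[measurable]: "(\<lambda>x. x i) \<in> borel_measurable ?A"
    by (rule measurable_component_singleton) (use i in auto)
  have fi[measurable]: "(\<lambda>p. fst p i) \<in> borel_measurable (?A \<Otimes>\<^sub>M (borel :: real measure))"
    by (rule measurable_compose[OF measurable_fst xi])
  have "integrable Q (\<lambda>x. x (Suc i))" "integrable Q (\<lambda>x. restrict x {1..i} i)"
    using integrable_coordinate i' i by auto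
  then have intZ: "integrable (?R \<Otimes>\<^sub>M unit_uniform) (\<lambda>p. Z p)"
    and intx: "integrable (?R \<Otimes>\<^sub>M unit_uniform) (\<lambda>p. fst p i)"
    using transfer[OF measurable_snd] transfer[OF fi]
    unfolding has_bochner_integral_iff T_def by (auto simp: split_beta')
  define b where "b x = (\<integral>u. Z (x, u) \<partial>unit_uniform)" for x
  have [measurable]: "b \<in> borel_measurable ?A" unfolding b_def by measurable
  define H where "H x = sgn (b x - x i)" for x
  have [measurable]: "H \<in> borel_measurable ?A" unfolding H_def by measurable
  have H1: "\<bar>H x\<bar> \<le> 1" for x by (simp add: H_def abs_sgn_eq)
  have "has_bochner_integral Q (\<lambda>x. H (restrict x {1..i}) * (x (Suc i) - restrict x {1..i} i)) 0"
    using martingale_bounded_measurable[OF i \<open>H \<in> _\<close> H1] i by simp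
  moreover have Hm: "(\<lambda>p. H (fst p) * (snd p - fst p i)) \<in> borel_measurable (?A \<Otimes>\<^sub>M borel)"
    by measurable
  ultimately have hb: "has_bochner_integral (?R \<Otimes>\<^sub>M unit_uniform) (\<lambda>p. H (fst p) * (Z p - fst p i)) 0"
    using transfer[OF Hm, of 0] by (simp add: T_def split_beta')
  have AEZ: "AE x in ?R. integrable unit_uniform (\<lambda>u. Z (x, u))"
    using P.AE_integrable_fst'[OF intZ] .
  have eq: "AE x in ?R. (\<integral>u. H x * (Z (x, u) - x i) \<partial>unit_uniform) = \<bar>b x - x i\<bar>"
    using AEZ
  proof eventually_elim
    case (elim x)
    then have "(\<integral>u. H x * (Z (x, u) - x i) \<partial>unit_uniform) = H x * (b x - x i)"
      by (simp add: b_def U.prob_space)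
    then show ?case by (simp add: H_def abs_sgn[symmetric] mult.commute)
  qed
  have "(\<integral>x. \<bar>b x - x i\<bar> \<partial>?R) = (\<integral>x. (\<integral>u. H x * (Z (x, u) - x i) \<partial>unit_uniform) \<partial>?R)"
  proof (rule integral_cong_AE)
    show "(\<lambda>x. \<bar>b x - x i\<bar>) \<in> borel_measurable ?R" by measurable
    show "(\<lambda>x. \<integral>u. H x * (Z (x, u) - x i) \<partial>unit_uniform) \<in> borel_measurable ?R" by measurable
    show "AE x in ?R. \<bar>b x - x i\<bar> = (\<integral>u. H x * (Z (x, u) - x i) \<partial>unit_uniform)"
      using eq by eventually_elim simp
  qed
  also have "\<dots> = 0"
    using P.integral_fst'[of "\<lambda>p. H (fst p) * (Z p - fst p i)"] hb by (simp add: has_bochner_integral_iff)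
  finally have "(\<integral>x. \<bar>b x - x i\<bar> \<partial>?R) = 0" .
  moreover have "integrable ?R (\<lambda>x. \<bar>b x - x i\<bar>)"
    unfolding b_def using P.integrable_fst'[OF intZ] P.integrable_fst'[OF intx] by (simp add: U.prob_space)
  ultimately have "AE x in ?R. b x = x i"
    by (subst (asm) integral_nonneg_eq_0_iff_AE) auto
  with AEZ have "AE x in ?R. integrable unit_uniform (\<lambda>u. Z (x, u)) \<and> (\<integral>u. Z (x, u) \<partial>unit_uniform) = x i"
    by eventually_elim (simp add: b_def)
  with Z step show ?thesis
    by (intro that[of Z]) (auto simp: comp_def G_def T_def split_beta')
qed

text \<open>
  The function \<open>f\<close> for index \<open>i\<close> is the conditional expectation of \<open>g\<close>, obtained by integrating out one coordinate at a time.
  It is this measurable majorant that is carried through the induction, because \<open>c_iter\<close> need not be measurable.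
\<close>

lemma c_iter_le_conditional_expectation:
  assumes g: "integrable Q g" "g \<in> borel_measurable (path_space n)"
    and le: "AE x in Q. c x - ereal (\<Sum>j = 2..n. u j (x j)) \<le> ereal (g x)"
    and i: "1 \<le> i" "i \<le> n"
  shows "\<exists>f. integrable (initial_law i) f \<and> (\<integral>x. f x \<partial>initial_law i) = (\<integral>x. g x \<partial>Q) \<and>
    (AE x in initial_law i. c_iter c n u i x \<le> ereal (f x))"
  using i(2,1)
proof (induction rule: inc_induct)
  case base
  have "distr Q (path_space n) (\<lambda>x. restrict x {1..n}) = distr Q Q (\<lambda>x. x)"
    by (intro distr_cong) (auto simp: sets_Q space_Q)
  then have eq: "initial_law n = Q" by (simp add: initial_law_def distr_id)
  have "c_iter c n u n x = c x - ereal (\<Sum>j = 2..n. u j (x j))" for x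
    by (subst c_iter.simps) simp
  then show ?case using g le unfolding eq by auto
next
  case (step i)
  have i: "i \<in> {1..n - 1}" using step by auto
  interpret R: prob_space "initial_law i" using step by (intro prob_space_initial_law) auto
  interpret U: prob_space unit_uniform by (rule prob_space_unit_uniform)
  interpret P: pair_prob_space "initial_law i" unit_uniform ..
  from step obtain f where f: "integrable (initial_law (Suc i)) f"
    "(\<integral>x. f x \<partial>initial_law (Suc i)) = (\<integral>x. g x \<partial>Q)"
    "AE x in initial_law (Suc i). c_iter c n u (Suc i) x \<le> ereal (f x)" by auto
  from disintegration[OF i] obtain Z where
    Z[measurable]: "Z \<in> borel_measurable (path_space i \<Otimes>\<^sub>M borel)"
    and law: "initial_law (Suc i) = distr (initial_law i \<Otimes>\<^sub>M unit_uniform) (path_space (Suc i))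
      (\<lambda>(x, u). x(Suc i := Z (x, u)))"
    and mean: "AE x in initial_law i. integrable unit_uniform (\<lambda>u. Z (x, u)) \<and> (\<integral>u. Z (x, u) \<partial>unit_uniform) = x i"
    by blast
  define T where "T = (\<lambda>(x, u). x(Suc i := Z (x, u)))"
  have I: "insert (Suc i) {1..i} = {1..Suc i}" by auto
  have setsP[measurable_cong]: "sets (initial_law i \<Otimes>\<^sub>M unit_uniform) = sets (path_space i \<Otimes>\<^sub>M borel)"
    by (intro sets_pair_measure_cong) (auto simp: sets_initial_law)
  have "(\<lambda>(x, y). x(Suc i := y :: real)) \<circ> (\<lambda>p. (fst p, Z p))
      \<in> measurable (path_space i \<Otimes>\<^sub>M borel) (PiM (insert (Suc i) {1..i}) (\<lambda>_. borel))"
    by (rule measurable_comp[OF _ measurable_add_dim]) measurable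
  then have "T \<in> measurable (path_space i \<Otimes>\<^sub>M borel) (path_space (Suc i))"
    unfolding I by (simp add: T_def comp_def split_beta')
  then have T[measurable]: "T \<in> measurable (initial_law i \<Otimes>\<^sub>M unit_uniform) (path_space (Suc i))"
    by (subst measurable_cong_sets[OF setsP refl])
  have fm[measurable]: "f \<in> borel_measurable (path_space (Suc i))"
    using borel_measurable_integrable[OF f(1)] by (simp add: initial_law_def)
  have fT: "integrable (initial_law i \<Otimes>\<^sub>M unit_uniform) (\<lambda>p. f (T p))"
    using f(1) unfolding law T_def[symmetric] integrable_distr_eq[OF T fm] .
  define f' where "f' x = (\<integral>u. f (T (x, u)) \<partial>unit_uniform)" for x
  have "integrable (initial_law i) f'"
    unfolding f'_def using P.integrable_fst'[OF fT] by simp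
  moreover have "(\<integral>x. f' x \<partial>initial_law i) = (\<integral>x. g x \<partial>Q)"
    unfolding f'_def using P.integral_fst'[OF fT] f(2)
    unfolding law T_def[symmetric] integral_distr[OF T fm] by simp
  moreover have "AE x in initial_law i. c_iter c n u i x \<le> ereal (f' x)"
  proof -
    have "AE p in initial_law i \<Otimes>\<^sub>M unit_uniform. c_iter c n u (Suc i) (T p) \<le> ereal (f (T p))"
      using f(3) unfolding law T_def[symmetric] by (rule AE_distrD[OF T])
    then have "AE x in initial_law i. AE v in unit_uniform. c_iter c n u (Suc i) (T (x, v)) \<le> ereal (f (T (x, v)))"
      by (rule P.AE_pair)
    with mean P.AE_integrable_fst'[OF fT] show ?thesis
    proof eventually_elim
      case (elim x)
      have "c_iter c n u i x = convex_biconjugate (\<lambda>y. c_iter c n u (Suc i) (x(Suc i := y))) (x i)"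
        using step by (subst c_iter.simps) auto
      also have "\<dots> \<le> ereal (f' x)"
        unfolding f'_def using elim
        by (intro convex_biconjugate_le_mean[where z = "\<lambda>v. Z (x, v)"] prob_space_unit_uniform) (auto simp: T_def)
      finally show ?case .
    qed
  qed
  ultimately show ?case by blast
qed

lemma c_iter_1_expectation_le:
  assumes n: "1 \<le> n" and g: "integrable Q g" "g \<in> borel_measurable (path_space n)"
    and le: "AE x in Q. c x - ereal (\<Sum>j = 2..n. u j (x j)) \<le> ereal (g x)"
  shows "ereal_expectation (\<mu> 1) (\<lambda>s. c_iter c n u 1 (\<lambda>k\<in>{1}. s)) \<le> ereal (\<integral>x. g x \<partial>Q)"
proof -
  obtain f where f: "integrable (initial_law 1) f" "(\<integral>x. f x \<partial>initial_law 1) = (\<integral>x. g x \<partial>Q)"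
    "AE x in initial_law 1. c_iter c n u 1 x \<le> ereal (f x)"
    using c_iter_le_conditional_expectation[OF g le, of 1] n by auto
  define e where "e = (\<lambda>s :: real. \<lambda>k\<in>{1..1 :: nat}. s)"
  have e1: "e s = (\<lambda>k\<in>{1}. s)" for s by (simp only: e_def atLeastAtMost_singleton)
  have m1: "\<mu> 1 = distr Q borel (\<lambda>x. x 1)" using n by (intro marginal) auto
  have c1[measurable]: "(\<lambda>x. x 1) \<in> borel_measurable Q" using n by (intro measurable_coordinate) auto
  have e[measurable]: "e \<in> measurable borel (path_space 1)" unfolding e_def by measurable
  then have e'[measurable]: "e \<in> measurable (\<mu> 1) (path_space 1)" unfolding m1 by simp
  have law: "initial_law 1 = distr (\<mu> 1) (path_space 1) e"
    unfolding m1 initial_law_def distr_distr[OF e c1] by (intro distr_cong) (auto simp: e_def)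
  have fm[measurable]: "f \<in> borel_measurable (path_space 1)"
    using borel_measurable_integrable[OF f(1)] unfolding initial_law_def by simp
  have "AE s in \<mu> 1. c_iter c n u 1 (e s) \<le> ereal (f (e s))"
    using f(3) unfolding law by (rule AE_distrD[OF e'])
  then have "ereal_expectation (\<mu> 1) (\<lambda>s. c_iter c n u 1 (e s)) \<le> ereal_expectation (\<mu> 1) (\<lambda>s. ereal (f (e s)))"
    by (rule ereal_expectation_mono)
  also have "\<dots> = ereal (\<integral>s. f (e s) \<partial>\<mu> 1)"
    using f(1) unfolding law integrable_distr_eq[OF e' fm] by (intro ereal_expectation_integrable) auto
  also have "(\<integral>s. f (e s) \<partial>\<mu> 1) = (\<integral>x. g x \<partial>Q)"
    using f(2) unfolding law integral_distr[OF e' fm] .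
  finally show ?thesis by (simp only: e1)
qed

end

section \<open>Limits of approximate martingale measures\<close>

text \<open>
  Index sets such as \<open>{1..n}\<close> should keep the form in which they occur in the definitions.
\<close>

declare One_nat_def [simp del]

text \<open>
  Restriction to \<open>J\<close> pulls \<open>U\<close> back to an open subset of the space of all real sequences, where the product topology
  generates the product \<open>\<sigma>\<close>-algebra; extension by zero brings it back.
\<close>

lemma openin_powertop_real_imp_sets:
  fixes J :: "nat set"
  assumes U: "openin (powertop_real J) U"
  shows "U \<in> sets (PiM J (\<lambda>_. borel))"
proof -
  define V where "V = {x :: nat \<Rightarrow> real. restrict x J \<in> U}"
  define e where "e = (\<lambda>(x :: nat \<Rightarrow> real) k. if k \<in> J then x k else 0)"
  have "continuous_map (euclidean :: (nat \<Rightarrow> real) topology) (powertop_real J) (\<lambda>x. restrict x J)"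
    by (auto simp: continuous_map_componentwise intro!: continuous_on_product_coordinates)
  from openin_continuous_map_preimage[OF this U] have "open V" by (simp add: V_def)
  then have V: "V \<in> sets (PiM UNIV (\<lambda>_. borel))" by (simp add: sets_PiM_equal_borel)
  have e: "e \<in> measurable (PiM J (\<lambda>_. borel)) (PiM UNIV (\<lambda>_. borel))"
  proof (rule measurable_PiM_single')
    fix k :: nat
    show "(\<lambda>x. e x k) \<in> borel_measurable (PiM J (\<lambda>_. borel))"
      by (cases "k \<in> J") (simp_all add: e_def)
  qed (auto simp: space_PiM)
  have "restrict (e x) J = x" if "x \<in> extensional J" for x
    using that by (auto simp: e_def extensional_def fun_eq_iff)
  then have "e -` V \<inter> space (PiM J (\<lambda>_. borel)) = U"
    using openin_subset[OF U] by (auto simp: V_def space_PiM PiE_iff)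
  with measurable_sets[OF e V] show ?thesis by simp
qed

lemma lower_semicontinuous_map_measurable:
  fixes J :: "nat set" and f :: "(nat \<Rightarrow> real) \<Rightarrow> 'b :: {second_countable_topology, linorder_topology}"
  assumes "lower_semicontinuous_map (powertop_real J) f"
  shows "f \<in> borel_measurable (PiM J (\<lambda>_. borel))"
proof (rule borel_measurableI_greater)
  fix y
  have "openin (powertop_real J) {x \<in> topspace (powertop_real J). y < f x}"
    using assms by (auto simp: lower_semicontinuous_map_def)
  from openin_powertop_real_imp_sets[OF this]
  show "{x \<in> space (PiM J (\<lambda>_. borel)). y < f x} \<in> sets (PiM J (\<lambda>_. borel))"
    by (simp add: space_PiM)
qed

lemma continuous_map_measurable:
  fixes J :: "nat set"
  assumes "continuous_map (powertop_real J) euclideanreal f"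
  shows "f \<in> borel_measurable (PiM J (\<lambda>_. borel))"
proof (rule borel_measurableI)
  fix S :: "real set" assume "open S"
  then have "openin (powertop_real J) {x \<in> topspace (powertop_real J). f x \<in> S}"
    by (intro openin_continuous_map_preimage[OF assms]) simp
  from openin_powertop_real_imp_sets[OF this]
  show "f -` S \<inter> space (PiM J (\<lambda>_. borel)) \<in> sets (PiM J (\<lambda>_. borel))"
    by (simp add: space_PiM vimage_def Int_def conj_commute)
qed

lemma lower_semicontinuous_map_le_liminf:
  fixes f :: "(nat \<Rightarrow> real) \<Rightarrow> 'b :: complete_linorder"
  assumes f: "lower_semicontinuous_map (powertop_real J) f"
    and x: "\<And>j. x j \<in> extensional J" and y: "y \<in> extensional J"
    and lim: "\<And>i. i \<in> J \<Longrightarrow> (\<lambda>j. x j i) \<longlonglongrightarrow> y i"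
  shows "f y \<le> liminf (\<lambda>j. f (x j))"
  unfolding le_Liminf_iff
proof (intro allI impI)
  fix a assume "a < f y"
  have "limitin (powertop_real J) x y sequentially"
    using x y lim by (auto simp: limitin_componentwise PiE_iff)
  moreover have "openin (powertop_real J) {x \<in> topspace (powertop_real J). a < f x}"
    using f by (auto simp: lower_semicontinuous_map_def)
  ultimately have "\<forall>\<^sub>F j in sequentially. x j \<in> {x \<in> topspace (powertop_real J). a < f x}"
    using \<open>a < f y\<close> y by (auto simp: limitin_def PiE_iff)
  then show "\<forall>\<^sub>F j in sequentially. a < f (x j)" by eventually_elim auto
qed

text \<open>
  A probability \<open>Q\<close> with integrable coordinates is a martingale measure with marginals \<open>\<mu>\<close> iff every test function below has expectation at most
  \<open>0\<close>: the first two families occur with both signs. The moment tests follow from the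
  marginal tests under \<open>Q\<close>, but not in the limit along a sequence, where they provide tightness and
  uniform integrability.
\<close>

definition marginal_test :: "(nat \<Rightarrow> real measure) \<Rightarrow> nat \<Rightarrow> real \<Rightarrow> nat \<Rightarrow> (nat \<Rightarrow> real) \<Rightarrow> real" where
  "marginal_test \<mu> i b m x = ramp b m (x i) - (\<integral>s. ramp b m s \<partial>\<mu> i)"

definition martingale_test :: "nat \<Rightarrow> (nat \<Rightarrow> real) \<Rightarrow> nat \<Rightarrow> (nat \<Rightarrow> real) \<Rightarrow> real" where
  "martingale_test i b m x = (\<Prod>j\<in>{1..i}. ramp (b j) m (x j)) * (x (Suc i) - x i)"

definition moment_test :: "(nat \<Rightarrow> real measure) \<Rightarrow> nat \<Rightarrow> (nat \<Rightarrow> real) \<Rightarrow> real" where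
  "moment_test \<mu> i x = \<bar>x i\<bar> - (\<integral>s. \<bar>s\<bar> \<partial>\<mu> i)"

definition tests :: "nat \<Rightarrow> (nat \<Rightarrow> real measure) \<Rightarrow> ((nat \<Rightarrow> real) \<Rightarrow> real) set" where
  "tests n \<mu> =
    (\<lambda>(s, i, b, m) x. s * marginal_test \<mu> i b m x) ` ({-1, 1} \<times> {1..n} \<times> \<rat> \<times> UNIV) \<union>
    (\<lambda>(s, i, b, m) x. s * martingale_test i b m x) ` ({-1, 1} \<times> {1..n - 1} \<times> ({1..n} \<rightarrow>\<^sub>E \<rat>) \<times> UNIV) \<union>
    moment_test \<mu> ` {1..n}"

lemma tests_intros:
  "s \<in> {-1, 1} \<Longrightarrow> i \<in> {1..n} \<Longrightarrow> b \<in> \<rat> \<Longrightarrow> (\<lambda>x. s * marginal_test \<mu> i b m x) \<in> tests n \<mu>"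
  "s \<in> {-1, 1} \<Longrightarrow> i \<in> {1..n - 1} \<Longrightarrow> a \<in> {1..n} \<rightarrow>\<^sub>E \<rat> \<Longrightarrow> (\<lambda>x. s * martingale_test i a m x) \<in> tests n \<mu>"
  "i \<in> {1..n} \<Longrightarrow> moment_test \<mu> i \<in> tests n \<mu>"
proof -
  show "(\<lambda>x. s * marginal_test \<mu> i b m x) \<in> tests n \<mu>" if "s \<in> {-1, 1}" "i \<in> {1..n}" "b \<in> \<rat>"
    unfolding tests_def by (intro UnI1 image_eqI[of _ _ "(s, i, b, m)"]) (use that in auto)
  show "(\<lambda>x. s * martingale_test i a m x) \<in> tests n \<mu>"
    if "s \<in> {-1, 1}" "i \<in> {1..n - 1}" "a \<in> {1..n} \<rightarrow>\<^sub>E \<rat>"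
    unfolding tests_def by (rule UnI1, rule UnI2, rule image_eqI[of _ _ "(s, i, a, m)"]) (use that in auto)
qed (simp add: tests_def)

lemma countable_tests: "countable (tests n \<mu>)"
  unfolding tests_def
  by (intro countable_Un countable_image countable_SIGMA countable_PiE)
    (auto simp: countable_rat intro: countable_finite)

text \<open>
  The penalty bound forces the positive part of \<open>E f\<^sub>k\<close> to vanish in the limit for every \<open>k\<close>. The moment tests give bounded first moments, so a
  subsequence is represented by almost surely convergent variables \<open>X j\<close> with limit \<open>X'\<close>. The marginal tests are
  bounded and pass to the limit, so \<open>X'\<close> has the marginals \<open>\<mu>\<close>. By the moment tests the first absolute moments of \<open>X j\<close> are asymptotically
  at most those of \<open>X'\<close>, and Scheffe's lemma upgrades the convergence to \<open>L\<^sup>1\<close>; thus the unbounded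
  martingale tests pass to the limit as well. The cost is handled by Fatou's lemma and lower semicontinuity.
\<close>

lemma martingale_measure_of_penalized_sequence:
  fixes c :: "(nat \<Rightarrow> real) \<Rightarrow> ereal" and q :: "nat \<Rightarrow> (nat \<Rightarrow> real) pmf"
  assumes \<mu>: "\<And>i. i \<in> {1..n} \<Longrightarrow> prob_space (\<mu> i)" "\<And>i. i \<in> {1..n} \<Longrightarrow> sets (\<mu> i) = sets borel"
      "\<And>i. i \<in> {1..n} \<Longrightarrow> integrable (\<mu> i) (\<lambda>x. x)"
    and c: "lower_semicontinuous_map (powertop_real {1..n}) c" "\<And>x. x \<in> R_space n \<Longrightarrow> 0 \<le> c x"
    and f: "tests n \<mu> \<subseteq> range f"
    and q: "\<And>N. finite (set_pmf (q N))" "\<And>N. set_pmf (q N) \<subseteq> {x \<in> R_space n. c x < \<infinity>}"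
    and penalized: "\<And>N. measure_pmf.expectation (q N) (\<lambda>x. real_of_ereal (c x)) +
      real (Suc N) * (\<Sum>k<N. (max 0 (measure_pmf.expectation (q N) (f k)))\<^sup>2) \<le> p"
  shows "\<exists>Q\<in>martingale_measures n \<mu>. (\<integral>\<^sup>+x. e2ennreal (c x) \<partial>Q) \<le> ennreal p"
proof -
  have int_q: "integrable (measure_pmf (q N)) g" for N and g :: "(nat \<Rightarrow> real) \<Rightarrow> real"
    using q(1) by (rule integrable_measure_pmf_finite)
  have q_ext: "x \<in> R_space n" "restrict x {1..n} = x" "c x < \<infinity>" if "x \<in> set_pmf (q N)" for x N
    using that q(2)[of N] by (auto simp: PiE_iff extensional_restrict)
  have cost0: "0 \<le> measure_pmf.expectation (q N) (\<lambda>x. real_of_ereal (c x))" for N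
    using q_ext(1) c(2) by (intro integral_nonneg_AE) (auto simp: AE_measure_pmf_iff real_of_ereal_pos)
  have pen0: "0 \<le> real (Suc N) * (\<Sum>k<N. (max 0 (measure_pmf.expectation (q N) (f k)))\<^sup>2)" for N
    by (intro mult_nonneg_nonneg sum_nonneg) auto
  have cost_le: "measure_pmf.expectation (q N) (\<lambda>x. real_of_ereal (c x)) \<le> p" for N
    using penalized[of N] pen0[of N] by linarith
  have small: "\<forall>\<^sub>F N in sequentially. measure_pmf.expectation (q N) g < \<epsilon>"
    if g: "g \<in> tests n \<mu>" and \<epsilon>: "0 < \<epsilon>" for g \<epsilon>
  proof -
    obtain k where k: "g = f k" using g f by auto
    obtain N0 :: nat where N0: "p / \<epsilon>\<^sup>2 < real N0" using reals_Archimedean2 by auto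
    have "measure_pmf.expectation (q N) g < \<epsilon>" if N: "max (Suc k) N0 \<le> N" for N
    proof (rule ccontr)
      assume "\<not> measure_pmf.expectation (q N) g < \<epsilon>"
      then have "\<epsilon>\<^sup>2 \<le> (max 0 (measure_pmf.expectation (q N) (f k)))\<^sup>2"
        using \<epsilon> by (intro power_mono) (auto simp: k)
      also have "\<dots> \<le> (\<Sum>k<N. (max 0 (measure_pmf.expectation (q N) (f k)))\<^sup>2)"
        using N by (intro member_le_sum) auto
      finally have "real (Suc N) * \<epsilon>\<^sup>2 \<le> real (Suc N) * (\<Sum>k<N. (max 0 (measure_pmf.expectation (q N) (f k)))\<^sup>2)"
        by (intro mult_left_mono) auto
      then have "real (Suc N) * \<epsilon>\<^sup>2 \<le> p" using penalized[of N] cost0[of N] by linarith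
      moreover have "p < real N0 * \<epsilon>\<^sup>2" using N0 \<epsilon> by (simp add: field_simps)
      moreover have "real N0 * \<epsilon>\<^sup>2 \<le> real (Suc N) * \<epsilon>\<^sup>2" using N by (intro mult_right_mono) auto
      ultimately show False by linarith
    qed
    then show ?thesis unfolding eventually_sequentially by blast
  qed
  define t where "t i = (\<integral>s. \<bar>s\<bar> \<partial>\<mu> i)" for i
  have moment: "\<forall>\<^sub>F N in sequentially. measure_pmf.expectation (q N) (\<lambda>x. \<bar>x i\<bar>) < t i + \<epsilon>"
    if "i \<in> {1..n}" "0 < \<epsilon>" for i \<epsilon>
  proof -
    have "moment_test \<mu> i \<in> tests n \<mu>" using that by (auto simp: tests_def)
    from small[OF this \<open>0 < \<epsilon>\<close>] show ?thesis
      by eventually_elim (simp add: moment_test_def[abs_def] int_q t_def)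
  qed
  have "\<forall>\<^sub>F N in sequentially. \<forall>i\<in>{1..n}. measure_pmf.expectation (q N) (\<lambda>x. \<bar>x i\<bar>) < t i + 1"
    using moment[of _ 1] by (intro eventually_ball_finite) auto
  then obtain N0 where N0: "\<And>N i. N0 \<le> N \<Longrightarrow> i \<in> {1..n} \<Longrightarrow> measure_pmf.expectation (q N) (\<lambda>x. \<bar>x i\<bar>) < t i + 1"
    unfolding eventually_sequentially by blast
  have "(\<integral>\<^sup>+x. ennreal \<bar>x i\<bar> \<partial>measure_pmf (q (N0 + j))) \<le> ennreal (t i + 1)" if "i \<in> {1..n}" for i j
    using N0[of "N0 + j", OF _ that] by (subst nn_integral_eq_integral[OF int_q]) (auto intro: ennreal_leI)
  from almost_sure_representation[of "{1..n}" "\<lambda>j. q (N0 + j)" "\<lambda>i. t i + 1", OF this]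
  obtain \<Omega> :: "real measure" and r :: "nat \<Rightarrow> nat" and X X' where \<Omega>: "prob_space \<Omega>" and r: "strict_mono r"
    and X[measurable]: "\<And>j. X j \<in> measurable \<Omega> (path_space n)"
    and X'[measurable]: "X' \<in> measurable \<Omega> (path_space n)"
    and law: "\<And>j. distr \<Omega> (path_space n) (X j)
      = distr (measure_pmf (q (N0 + r j))) (path_space n) (\<lambda>x. restrict x {1..n})"
    and conv: "AE \<omega> in \<Omega>. \<forall>i\<in>{1..n}. (\<lambda>j. X j \<omega> i) \<longlonglongrightarrow> X' \<omega> i"
    by blast
  interpret \<Omega>: prob_space \<Omega> by fact
  define s where "s j = N0 + r j" for j
  have s: "filterlim s at_top sequentially"
    unfolding s_def by (rule filterlim_at_top_mono[OF filterlim_subseq[OF r]]) auto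
  have rm: "(\<lambda>x. restrict x {1..n}) \<in> measurable (measure_pmf (q N)) (path_space n)" for N
    by simp (auto simp: space_PiM)
  have law_int: "integrable \<Omega> (\<lambda>\<omega>. g (X j \<omega>))"
    "(\<integral>\<omega>. g (X j \<omega>) \<partial>\<Omega>) = measure_pmf.expectation (q (s j)) g"
    if g[measurable]: "g \<in> borel_measurable (path_space n)" for g :: "(nat \<Rightarrow> real) \<Rightarrow> real" and j
  proof -
    have "integrable (distr \<Omega> (path_space n) (X j)) g"
      unfolding law integrable_distr_eq[OF rm g] by (rule int_q)
    then show "integrable \<Omega> (\<lambda>\<omega>. g (X j \<omega>))" unfolding integrable_distr_eq[OF X g] .
    have "(\<integral>\<omega>. g (X j \<omega>) \<partial>\<Omega>) = (\<integral>x. g x \<partial>distr \<Omega> (path_space n) (X j))"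
      by (rule integral_distr[OF X g, symmetric])
    also have "\<dots> = measure_pmf.expectation (q (s j)) (\<lambda>x. g (restrict x {1..n}))"
      unfolding law s_def by (rule integral_distr[OF rm g])
    also have "\<dots> = measure_pmf.expectation (q (s j)) g"
      by (intro integral_cong_AE) (auto simp: AE_measure_pmf_iff q_ext)
    finally show "(\<integral>\<omega>. g (X j \<omega>) \<partial>\<Omega>) = measure_pmf.expectation (q (s j)) g" .
  qed
  have test_small: "\<forall>\<^sub>F j in sequentially. (\<integral>\<omega>. g (X j \<omega>) \<partial>\<Omega>) < \<epsilon>"
    if "g \<in> tests n \<mu>" "0 < \<epsilon>" "g \<in> borel_measurable (path_space n)" for g \<epsilon>
    using eventually_compose_filterlim[OF small[OF that(1,2)] s]
    unfolding law_int(2)[OF that(3)] .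
  have Xi[measurable]: "(\<lambda>\<omega>. X j \<omega> i) \<in> borel_measurable \<Omega>" "(\<lambda>\<omega>. X' \<omega> i) \<in> borel_measurable \<Omega>"
    and coord: "(\<lambda>x. x i) \<in> borel_measurable (path_space n)"
    if i: "i \<in> {1..n}" for i j
  proof -
    show coord: "(\<lambda>x. x i) \<in> borel_measurable (path_space n)"
      by (rule measurable_component_singleton[OF i])
    show "(\<lambda>\<omega>. X j \<omega> i) \<in> borel_measurable \<Omega>" "(\<lambda>\<omega>. X' \<omega> i) \<in> borel_measurable \<Omega>"
      using measurable_compose[OF X coord] measurable_compose[OF X' coord] by auto
  qed
  have conv_i: "AE \<omega> in \<Omega>. (\<lambda>j. X j \<omega> i) \<longlonglongrightarrow> X' \<omega> i" if "i \<in> {1..n}" for i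
    using conv by eventually_elim (use that in blast)
  \<comment> \<open>Tests that occur with both signs converge to \<open>0\<close>.\<close>
  have zero_limit: "l = 0"
    if lim: "(\<lambda>j. \<integral>\<omega>. g (X j \<omega>) \<partial>\<Omega>) \<longlonglongrightarrow> l"
      and g: "g \<in> borel_measurable (path_space n)"
      and tests: "(\<lambda>x. -1 * g x) \<in> tests n \<mu>" "(\<lambda>x. 1 * g x) \<in> tests n \<mu>" for g l
  proof (rule antisym)
    show "l \<le> 0"
    proof (rule field_le_epsilon)
      fix \<epsilon> :: real assume "0 < \<epsilon>"
      from test_small[OF tests(2) this] g
      have "\<forall>\<^sub>F j in sequentially. (\<integral>\<omega>. g (X j \<omega>) \<partial>\<Omega>) \<le> \<epsilon>"
        by (auto elim: eventually_mono)
      from tendsto_upperbound[OF lim this] show "l \<le> 0 + \<epsilon>" by simp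
    qed
    show "0 \<le> l"
    proof (rule field_le_epsilon)
      fix \<epsilon> :: real assume "0 < \<epsilon>"
      from test_small[OF tests(1) this] g
      have "\<forall>\<^sub>F j in sequentially. - \<epsilon> \<le> (\<integral>\<omega>. g (X j \<omega>) \<partial>\<Omega>)"
        by (auto elim: eventually_mono)
      from tendsto_lowerbound[OF lim this] show "0 \<le> l + \<epsilon>" by simp
    qed
  qed
  have marginal: "distr \<Omega> borel (\<lambda>\<omega>. X' \<omega> i) = \<mu> i" if i: "i \<in> {1..n}" for i
  proof -
    interpret \<mu>i: prob_space "\<mu> i" by (rule \<mu>(1)[OF i])
    note sets_\<mu>i[measurable_cong] = \<mu>(2)[OF i]
    have ramp_eq: "(\<integral>\<omega>. ramp b m (X' \<omega> i) \<partial>\<Omega>) = (\<integral>s. ramp b m s \<partial>\<mu> i)" if b: "b \<in> \<rat>" for b m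
    proof -
      have "(\<integral>\<omega>. ramp b m (X' \<omega> i) - (\<integral>s. ramp b m s \<partial>\<mu> i) \<partial>\<Omega>) = 0"
      proof (rule zero_limit)
        show "marginal_test \<mu> i b m \<in> borel_measurable (path_space n)"
          unfolding marginal_test_def[abs_def] using coord[OF i] by measurable
        show "(\<lambda>x. -1 * marginal_test \<mu> i b m x) \<in> tests n \<mu>" "(\<lambda>x. 1 * marginal_test \<mu> i b m x) \<in> tests n \<mu>"
          by (rule tests_intros; use i b in simp)+
        show "(\<lambda>j. \<integral>\<omega>. marginal_test \<mu> i b m (X j \<omega>) \<partial>\<Omega>)
            \<longlonglongrightarrow> (\<integral>\<omega>. ramp b m (X' \<omega> i) - (\<integral>s. ramp b m s \<partial>\<mu> i) \<partial>\<Omega>)"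
        proof (rule integral_dominated_convergence[where w = "\<lambda>_. 1 + \<bar>\<integral>s. ramp b m s \<partial>\<mu> i\<bar>"])
          show "AE \<omega> in \<Omega>. (\<lambda>j. marginal_test \<mu> i b m (X j \<omega>)) \<longlonglongrightarrow> ramp b m (X' \<omega> i) - (\<integral>s. ramp b m s \<partial>\<mu> i)"
            using conv_i[OF i]
          proof eventually_elim
            case (elim \<omega>)
            have "isCont (ramp b m) (X' \<omega> i)" using continuous_on_ramp[of UNIV b m] by (simp add: continuous_on_eq_continuous_at)
            from isCont_tendsto_compose[OF this elim] show ?case
              unfolding marginal_test_def by (intro tendsto_intros)
          qed
          show "AE \<omega> in \<Omega>. norm (marginal_test \<mu> i b m (X j \<omega>)) \<le> 1 + \<bar>\<integral>s. ramp b m s \<partial>\<mu> i\<bar>" for j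
            unfolding marginal_test_def real_norm_def
            using ramp_bounds(3)[of b m] by (intro AE_I2 order_trans[OF abs_triangle_ineq4] add_mono) auto
          show "(\<lambda>\<omega>. marginal_test \<mu> i b m (X j \<omega>)) \<in> borel_measurable \<Omega>" for j
            unfolding marginal_test_def using Xi[OF i] by measurable
          show "(\<lambda>\<omega>. ramp b m (X' \<omega> i) - (\<integral>s. ramp b m s \<partial>\<mu> i)) \<in> borel_measurable \<Omega>"
            using Xi(2)[OF i] by measurable
        qed simp
      qed
      moreover have "integrable \<Omega> (\<lambda>\<omega>. ramp b m (X' \<omega> i))"
      proof (rule \<Omega>.integrable_const_bound[where B = 1])
        show "(\<lambda>\<omega>. ramp b m (X' \<omega> i)) \<in> borel_measurable \<Omega>" using Xi(2)[OF i] by measurable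
      qed (use ramp_bounds(3) in simp)
      ultimately show ?thesis by (simp add: \<Omega>.prob_space)
    qed
    have ramp_lim: "(\<lambda>m. \<integral>s. ramp (b m) (Suc m) s \<partial>M) \<longlonglongrightarrow> measure M {a<..}"
      if M: "prob_space M" "sets M = sets borel"
        and lim: "\<And>s. (\<lambda>m. ramp (b m) (Suc m) s) \<longlonglongrightarrow> indicator {a<..} s" for M :: "real measure" and a b
    proof -
      interpret M: prob_space M by fact
      note [measurable_cong] = M(2)
      have "(\<lambda>m. \<integral>s. ramp (b m) (Suc m) s \<partial>M) \<longlonglongrightarrow> (\<integral>s. indicator {a<..} s \<partial>M)"
        by (rule integral_dominated_convergence[where w = "\<lambda>_. 1"])
          (use lim ramp_bounds(3) M(2) in \<open>auto simp: measurable_cong_sets[OF M(2) refl]\<close>)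
      then show ?thesis using M(2) by simp
    qed
    have \<nu>: "prob_space (distr \<Omega> borel (\<lambda>\<omega>. X' \<omega> i))"
      by (rule \<Omega>.prob_space_distr[OF Xi(2)[OF i]])
    interpret \<nu>: prob_space "distr \<Omega> borel (\<lambda>\<omega>. X' \<omega> i)" by fact
    show ?thesis
    proof (rule measure_eqI_lessThan)
      fix a
      obtain b where b: "\<And>m. b m \<in> \<rat>" "\<And>s. (\<lambda>m. ramp (b m) (Suc m) s) \<longlonglongrightarrow> indicator {a<..} s"
        using ramp_tendsto_indicator[of a] by blast
      have "(\<integral>s. ramp (b m) (Suc m) s \<partial>distr \<Omega> borel (\<lambda>\<omega>. X' \<omega> i)) = (\<integral>s. ramp (b m) (Suc m) s \<partial>\<mu> i)" for m
        using ramp_eq[OF b(1)] integral_distr[OF Xi(2)[OF i] measurable_ramp] by simp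
      with ramp_lim[OF \<nu> _ b(2)] ramp_lim[OF \<mu>(1,2)[OF i] b(2)]
      have "measure (distr \<Omega> borel (\<lambda>\<omega>. X' \<omega> i)) {a<..} = measure (\<mu> i) {a<..}"
        by (auto intro: LIMSEQ_unique)
      then show "emeasure (distr \<Omega> borel (\<lambda>\<omega>. X' \<omega> i)) {a<..} = emeasure (\<mu> i) {a<..}"
        by (simp add: \<nu>.emeasure_eq_measure \<mu>i.emeasure_eq_measure)
    qed (auto simp: \<mu>(2)[OF i] \<nu>.emeasure_finite less_top[symmetric])
  qed
  have X'_eq: "(\<integral>\<^sup>+\<omega>. ennreal \<bar>X' \<omega> i\<bar> \<partial>\<Omega>) = ennreal (t i)" and X'_int: "integrable \<Omega> (\<lambda>\<omega>. X' \<omega> i)"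
    if i: "i \<in> {1..n}" for i
  proof -
    have "integrable (distr \<Omega> borel (\<lambda>\<omega>. X' \<omega> i)) (\<lambda>x. x)" unfolding marginal[OF i] by (rule \<mu>(3)[OF i])
    then show int: "integrable \<Omega> (\<lambda>\<omega>. X' \<omega> i)" by (subst (asm) integrable_distr_eq[OF Xi(2)[OF i]]) auto
    have "(\<integral>\<omega>. \<bar>X' \<omega> i\<bar> \<partial>\<Omega>) = t i"
      unfolding t_def marginal[OF i, symmetric] by (rule integral_distr[OF Xi(2)[OF i], symmetric]) simp
    then show "(\<integral>\<^sup>+\<omega>. ennreal \<bar>X' \<omega> i\<bar> \<partial>\<Omega>) = ennreal (t i)"
      using int by (subst nn_integral_eq_integral) auto
  qed
  have Xj_int: "integrable \<Omega> (\<lambda>\<omega>. X j \<omega> i)" if i: "i \<in> {1..n}" for i j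
    using law_int(1)[OF coord[OF i]] .
  \<comment> \<open>Scheffe's lemma: almost sure convergence together with \<open>limsup E \<bar>X j\<bar> \<le> E \<bar>X'\<bar>\<close>.\<close>
  have L1: "(\<lambda>j. \<integral>\<omega>. \<bar>X j \<omega> i - X' \<omega> i\<bar> \<partial>\<Omega>) \<longlonglongrightarrow> 0" if i: "i \<in> {1..n}" for i
  proof -
    have "limsup (\<lambda>j. \<integral>\<^sup>+\<omega>. norm (X j \<omega> i) \<partial>\<Omega>) \<le> (\<integral>\<^sup>+\<omega>. norm (X' \<omega> i) \<partial>\<Omega>)"
      unfolding real_norm_def X'_eq[OF i]
    proof (rule ennreal_le_epsilon)
      fix \<epsilon> :: real assume \<epsilon>: "0 < \<epsilon>"
      have t0: "0 \<le> t i" unfolding t_def by simp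
      have "\<forall>\<^sub>F j in sequentially. measure_pmf.expectation (q (s j)) (\<lambda>x. \<bar>x i\<bar>) < t i + \<epsilon>"
        by (rule eventually_compose_filterlim[OF moment[OF i \<epsilon>] s])
      then have "\<forall>\<^sub>F j in sequentially. (\<integral>\<^sup>+\<omega>. ennreal \<bar>X j \<omega> i\<bar> \<partial>\<Omega>) \<le> ennreal (t i) + ennreal \<epsilon>"
      proof eventually_elim
        case (elim j)
        have m: "(\<lambda>x. \<bar>x i\<bar>) \<in> borel_measurable (path_space n)"
          using coord[OF i] by measurable
        have "(\<integral>\<^sup>+\<omega>. ennreal \<bar>X j \<omega> i\<bar> \<partial>\<Omega>) = ennreal (measure_pmf.expectation (q (s j)) (\<lambda>x. \<bar>x i\<bar>))"
          using law_int[OF m] by (subst nn_integral_eq_integral) auto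
        also have "\<dots> \<le> ennreal (t i + \<epsilon>)" using elim by (intro ennreal_leI) simp
        finally show ?case using t0 \<epsilon> by simp
      qed
      then show "limsup (\<lambda>j. \<integral>\<^sup>+\<omega>. ennreal \<bar>X j \<omega> i\<bar> \<partial>\<Omega>) \<le> ennreal (t i) + ennreal \<epsilon>"
        by (rule Limsup_bounded)
    qed
    from Scheffe_lemma1[OF Xj_int[OF i] X'_int[OF i] conv_i[OF i] this]
    have "(\<lambda>j. ennreal (\<integral>\<omega>. \<bar>X j \<omega> i - X' \<omega> i\<bar> \<partial>\<Omega>)) \<longlonglongrightarrow> ennreal 0"
      using Xj_int[OF i] X'_int[OF i] by (subst (asm) nn_integral_eq_integral) auto
    then show ?thesis by (rule tendsto_ennrealD) auto
  qed
  have martingale: "(\<integral>\<omega>. (\<Prod>k\<in>{1..i}. ramp (b k) m (X' \<omega> k)) * (X' \<omega> (Suc i) - X' \<omega> i) \<partial>\<Omega>) = 0"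
    if i: "i \<in> {1..n - 1}" and b: "\<And>k. k \<in> {1..i} \<Longrightarrow> b k \<in> \<rat>" for i b m
  proof -
    have i': "i \<in> {1..n}" "Suc i \<in> {1..n}" "{1..i} \<subseteq> {1..n}" using i by auto
    define b' where "b' = (\<lambda>k\<in>{1..n}. if k \<in> {1..i} then b k else 0)"
    have b': "b' \<in> {1..n} \<rightarrow>\<^sub>E \<rat>" using b by (auto simp: b'_def)
    define \<phi> where "\<phi> x = (\<Prod>k\<in>{1..i}. ramp (b k) m (x k))" for x
    have test: "martingale_test i b' m x = \<phi> x * (x (Suc i) - x i)" for x
      unfolding martingale_test_def \<phi>_def using i'
      by (intro arg_cong2[where f = "(*)"] prod.cong) (auto simp: b'_def)
    have \<phi>m: "\<phi> \<in> borel_measurable (path_space n)"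
      unfolding \<phi>_def[abs_def] using coord i'(3) by (intro borel_measurable_prod) (auto intro!: measurable_compose[OF _ measurable_ramp])
    have \<phi>1: "\<bar>\<phi> x\<bar> \<le> 1" for x
      unfolding \<phi>_def by (auto simp: abs_prod intro!: prod_le_1 ramp_bounds)
    note [measurable] = measurable_compose[OF X \<phi>m] measurable_compose[OF X' \<phi>m]
      Xi[OF i'(1)] Xi[OF i'(2)]
    define D where "D j \<omega> = X j \<omega> (Suc i) - X j \<omega> i" for j \<omega>
    define D' where "D' \<omega> = X' \<omega> (Suc i) - X' \<omega> i" for \<omega>
    have D_int: "integrable \<Omega> (D j)" "integrable \<Omega> D'" for j
      unfolding D_def[abs_def] D'_def[abs_def] using Xj_int X'_int i' by auto
    note [measurable] = borel_measurable_integrable[OF D_int(1)] borel_measurable_integrable[OF D_int(2)]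
    have \<phi>_int: "integrable \<Omega> (\<lambda>\<omega>. \<phi> (Y \<omega>) * g \<omega>)"
      if "integrable \<Omega> g" "(\<lambda>\<omega>. \<phi> (Y \<omega>)) \<in> borel_measurable \<Omega>" for Y g
      using that \<phi>1 by (intro Bochner_Integration.integrable_bound[OF that(1)])
        (auto simp: abs_mult intro!: mult_left_le_one_le)
    \<comment> \<open>\<open>\<phi>(X j) D j = \<phi>(X j) (D j - D') + \<phi>(X j) D'\<close>: the first summand vanishes in \<open>L\<^sup>1\<close>, the second one is dominated by \<open>\<bar>D'\<bar>\<close>.\<close>
    have "(\<lambda>j. \<integral>\<omega>. \<phi> (X j \<omega>) * (D j \<omega> - D' \<omega>) \<partial>\<Omega>) \<longlonglongrightarrow> 0"
    proof (rule Lim_null_comparison)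
      have "norm (\<integral>\<omega>. \<phi> (X j \<omega>) * (D j \<omega> - D' \<omega>) \<partial>\<Omega>)
          \<le> (\<integral>\<omega>. \<bar>X j \<omega> (Suc i) - X' \<omega> (Suc i)\<bar> + \<bar>X j \<omega> i - X' \<omega> i\<bar> \<partial>\<Omega>)" for j
      proof (rule Bochner_Integration.integral_norm_bound_integral)
        show "norm (\<phi> (X j \<omega>) * (D j \<omega> - D' \<omega>)) \<le> \<bar>X j \<omega> (Suc i) - X' \<omega> (Suc i)\<bar> + \<bar>X j \<omega> i - X' \<omega> i\<bar>" for \<omega>
        proof -
          have "norm (\<phi> (X j \<omega>) * (D j \<omega> - D' \<omega>)) \<le> 1 * \<bar>D j \<omega> - D' \<omega>\<bar>"
            using \<phi>1 unfolding real_norm_def abs_mult by (intro mult_right_mono) auto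
          also have "1 * \<bar>D j \<omega> - D' \<omega>\<bar> \<le> \<bar>X j \<omega> (Suc i) - X' \<omega> (Suc i)\<bar> + \<bar>X j \<omega> i - X' \<omega> i\<bar>"
            using abs_triangle_ineq4[of "X j \<omega> (Suc i) - X' \<omega> (Suc i)" "X j \<omega> i - X' \<omega> i"]
            by (simp add: D_def D'_def algebra_simps)
          finally show ?thesis .
        qed
      qed (use \<phi>_int D_int Xj_int X'_int i' in auto)
      then show "\<forall>\<^sub>F j in sequentially. norm (\<integral>\<omega>. \<phi> (X j \<omega>) * (D j \<omega> - D' \<omega>) \<partial>\<Omega>)
          \<le> (\<integral>\<omega>. \<bar>X j \<omega> (Suc i) - X' \<omega> (Suc i)\<bar> \<partial>\<Omega>) + (\<integral>\<omega>. \<bar>X j \<omega> i - X' \<omega> i\<bar> \<partial>\<Omega>)"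
        using Xj_int X'_int i' by (intro always_eventually allI) auto
      show "(\<lambda>j. (\<integral>\<omega>. \<bar>X j \<omega> (Suc i) - X' \<omega> (Suc i)\<bar> \<partial>\<Omega>) + (\<integral>\<omega>. \<bar>X j \<omega> i - X' \<omega> i\<bar> \<partial>\<Omega>)) \<longlonglongrightarrow> 0"
        using tendsto_add[OF L1[OF i'(2)] L1[OF i'(1)]] by simp
    qed
    moreover have "(\<lambda>j. \<integral>\<omega>. \<phi> (X j \<omega>) * D' \<omega> \<partial>\<Omega>) \<longlonglongrightarrow> (\<integral>\<omega>. \<phi> (X' \<omega>) * D' \<omega> \<partial>\<Omega>)"
    proof (rule integral_dominated_convergence[where w = "\<lambda>\<omega>. \<bar>D' \<omega>\<bar>"])
      show "AE \<omega> in \<Omega>. (\<lambda>j. \<phi> (X j \<omega>) * D' \<omega>) \<longlonglongrightarrow> \<phi> (X' \<omega>) * D' \<omega>"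
        using conv
      proof eventually_elim
        case (elim \<omega>)
        have "isCont (ramp (b k) m) (X' \<omega> k)" for k
          using continuous_on_ramp[of UNIV "b k" m] by (simp add: continuous_on_eq_continuous_at)
        from isCont_tendsto_compose[OF this] elim i'(3) show ?case
          unfolding \<phi>_def by (intro tendsto_intros) blast
      qed
      show "AE \<omega> in \<Omega>. norm (\<phi> (X j \<omega>) * D' \<omega>) \<le> \<bar>D' \<omega>\<bar>" for j
        using \<phi>1 by (intro AE_I2) (auto simp: abs_mult intro!: mult_left_le_one_le)
      show "integrable \<Omega> (\<lambda>\<omega>. \<bar>D' \<omega>\<bar>)" using D_int(2) by simp
    qed measurable
    ultimately have "(\<lambda>j. (\<integral>\<omega>. \<phi> (X j \<omega>) * (D j \<omega> - D' \<omega>) \<partial>\<Omega>) + (\<integral>\<omega>. \<phi> (X j \<omega>) * D' \<omega> \<partial>\<Omega>))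
        \<longlonglongrightarrow> 0 + (\<integral>\<omega>. \<phi> (X' \<omega>) * D' \<omega> \<partial>\<Omega>)" by (rule tendsto_add)
    moreover have "(\<integral>\<omega>. \<phi> (X j \<omega>) * (D j \<omega> - D' \<omega>) \<partial>\<Omega>) + (\<integral>\<omega>. \<phi> (X j \<omega>) * D' \<omega> \<partial>\<Omega>)
        = (\<integral>\<omega>. martingale_test i b' m (X j \<omega>) \<partial>\<Omega>)" for j
      using D_int \<phi>_int
      by (subst Bochner_Integration.integral_add[symmetric])
        (auto simp: test D_def[symmetric] right_diff_distrib intro!: Bochner_Integration.integral_cong)
    ultimately have "(\<lambda>j. \<integral>\<omega>. martingale_test i b' m (X j \<omega>) \<partial>\<Omega>) \<longlonglongrightarrow> (\<integral>\<omega>. \<phi> (X' \<omega>) * D' \<omega> \<partial>\<Omega>)"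
      by simp
    then have "(\<integral>\<omega>. \<phi> (X' \<omega>) * D' \<omega> \<partial>\<Omega>) = 0"
    proof (rule zero_limit)
      show "martingale_test i b' m \<in> borel_measurable (path_space n)"
        unfolding test[abs_def] using \<phi>m coord[OF i'(1)] coord[OF i'(2)] by measurable
      show "(\<lambda>x. -1 * martingale_test i b' m x) \<in> tests n \<mu>" "(\<lambda>x. 1 * martingale_test i b' m x) \<in> tests n \<mu>"
        by (rule tests_intros(2); use i b' in simp)+
    qed
    then show ?thesis by (simp add: \<phi>_def D'_def)
  qed
  define Q where "Q = distr \<Omega> (path_space n) X'"
  have "Q \<in> couplings n \<mu>"
    unfolding couplings_def Q_def
    by (auto simp: \<Omega>.prob_space_distr distr_distr[OF coord X'] comp_def marginal)
  moreover have "has_bochner_integral Q (\<lambda>x. H (restrict x {1..i}) * (x (Suc i) - x i)) 0"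
    if i: "i \<in> {1..n - 1}" and H: "continuous_map (powertop_real {1..i}) euclideanreal H" "bounded (H ` R_space i)"
    for i H
  proof -
    have i': "i \<in> {1..n}" "Suc i \<in> {1..n}" "{1..i} \<subseteq> {1..n}" using i by auto
    have Hm: "H \<in> borel_measurable (path_space i)" by (rule continuous_map_measurable[OF H(1)])
    have rm: "(\<lambda>x. restrict x {1..i}) \<in> measurable (path_space n) (path_space i)"
      by (rule measurable_restrict_subset[OF i'(3)])
    obtain B where B: "\<And>x. x \<in> R_space i \<Longrightarrow> \<bar>H x\<bar> \<le> B"
      using H(2) unfolding bounded_iff real_norm_def by blast
    have "has_bochner_integral \<Omega> (\<lambda>\<omega>. H (restrict (X' \<omega>) {1..i}) * (X' \<omega> (Suc i) - X' \<omega> i)) 0"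
    proof (rule orthogonal_if_orthogonal_to_ramps[where J = "{1..i}" and B = B and H = H
          and X = "\<lambda>\<omega>. restrict (X' \<omega>) {1..i}" and D = "\<lambda>\<omega>. X' \<omega> (Suc i) - X' \<omega> i"])
      show "(\<lambda>\<omega>. restrict (X' \<omega>) {1..i}) \<in> measurable \<Omega> (path_space i)"
        by (rule measurable_compose[OF X' rm])
      show "integrable \<Omega> (\<lambda>\<omega>. X' \<omega> (Suc i) - X' \<omega> i)" using X'_int i' by auto
      show "(\<integral>\<omega>. (\<Prod>j\<in>{1..i}. ramp (b j) m (restrict (X' \<omega>) {1..i} j)) * (X' \<omega> (Suc i) - X' \<omega> i) \<partial>\<Omega>) = 0"
        if "\<And>j. j \<in> {1..i} \<Longrightarrow> b j \<in> \<rat>" for b m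
        using martingale[OF i that] by simp
      show "\<bar>H x\<bar> \<le> B" if "x \<in> space (path_space i)" for x
        using that B by (simp add: space_PiM)
    qed (use Hm in auto)
    moreover have "(\<lambda>x. H (restrict x {1..i}) * (x (Suc i) - x i)) \<in> borel_measurable (path_space n)"
      using measurable_compose[OF rm Hm] coord[OF i'(1)] coord[OF i'(2)] by measurable
    ultimately show ?thesis
      unfolding Q_def has_bochner_integral_iff
      by (simp add: integrable_distr_eq[OF X'] integral_distr[OF X'])
  qed
  ultimately have "Q \<in> martingale_measures n \<mu>" by (simp add: martingale_measures_def)
  moreover have "(\<integral>\<^sup>+x. e2ennreal (c x) \<partial>Q) \<le> ennreal p"
  proof -
    have cm: "(\<lambda>x. e2ennreal (c x)) \<in> borel_measurable (path_space n)"
      using lower_semicontinuous_map_measurable[OF c(1)] by measurable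
    have ext: "X j \<omega> \<in> R_space n" "X' \<omega> \<in> R_space n" if "\<omega> \<in> space \<Omega>" for j \<omega>
      using measurable_space[OF X that] measurable_space[OF X' that] by (simp_all add: space_PiM)
    have lsc: "lower_semicontinuous_map (powertop_real {1..n}) (\<lambda>x. e2ennreal (c x))"
      unfolding lower_semicontinuous_map_def
    proof
      fix a :: ennreal
      have "{x \<in> topspace (powertop_real {1..n}). a < e2ennreal (c x)}
          = {x \<in> topspace (powertop_real {1..n}). enn2ereal a < c x}"
        using c(2) by (auto simp: less_ennreal.rep_eq enn2ereal_e2ennreal)
      then show "openin (powertop_real {1..n}) {x \<in> topspace (powertop_real {1..n}). a < e2ennreal (c x)}"
        using c(1) by (simp add: lower_semicontinuous_map_def)
    qed
    have cost_law: "(\<integral>\<^sup>+\<omega>. e2ennreal (c (X j \<omega>)) \<partial>\<Omega>) \<le> ennreal p" for j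
    proof -
      have "(\<integral>\<^sup>+\<omega>. e2ennreal (c (X j \<omega>)) \<partial>\<Omega>) = (\<integral>\<^sup>+x. e2ennreal (c x) \<partial>distr \<Omega> (path_space n) (X j))"
        using cm by (intro nn_integral_distr[OF X, symmetric]) simp
      also have "\<dots> = (\<integral>\<^sup>+x. e2ennreal (c (restrict x {1..n})) \<partial>measure_pmf (q (s j)))"
        unfolding law s_def using cm by (intro nn_integral_distr[OF rm]) simp
      also have "\<dots> = (\<integral>\<^sup>+x. ennreal (real_of_ereal (c x)) \<partial>measure_pmf (q (s j)))"
      proof (intro nn_integral_cong_AE)
        have "e2ennreal (c (restrict x {1..n})) = ennreal (real_of_ereal (c x))" if "x \<in> set_pmf (q (s j))" for x
          using q_ext[OF that] c(2)[OF q_ext(1)[OF that]]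
          by (cases "c x") (auto simp: e2ennreal_ereal)
        then show "AE x in measure_pmf (q (s j)). e2ennreal (c (restrict x {1..n})) = ennreal (real_of_ereal (c x))"
          by (simp add: AE_measure_pmf_iff)
      qed
      also have "\<dots> = ennreal (measure_pmf.expectation (q (s j)) (\<lambda>x. real_of_ereal (c x)))"
        using q_ext(1) c(2)
        by (intro nn_integral_eq_integral int_q) (auto simp: AE_measure_pmf_iff real_of_ereal_pos)
      also have "\<dots> \<le> ennreal p" by (intro ennreal_leI cost_le)
      finally show ?thesis .
    qed
    have "(\<integral>\<^sup>+x. e2ennreal (c x) \<partial>Q) = (\<integral>\<^sup>+\<omega>. e2ennreal (c (X' \<omega>)) \<partial>\<Omega>)"
      unfolding Q_def using cm by (intro nn_integral_distr[OF X']) simp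
    also have "\<dots> \<le> (\<integral>\<^sup>+\<omega>. liminf (\<lambda>j. e2ennreal (c (X j \<omega>))) \<partial>\<Omega>)"
    proof (intro nn_integral_mono_AE)
      show "AE \<omega> in \<Omega>. e2ennreal (c (X' \<omega>)) \<le> liminf (\<lambda>j. e2ennreal (c (X j \<omega>)))"
        using conv AE_space
      proof eventually_elim
        case (elim \<omega>)
        then show ?case using ext[OF elim(2)]
          by (intro lower_semicontinuous_map_le_liminf[OF lsc]) (auto simp: PiE_iff)
      qed
    qed
    also have "\<dots> \<le> liminf (\<lambda>j. \<integral>\<^sup>+\<omega>. e2ennreal (c (X j \<omega>)) \<partial>\<Omega>)"
      by (rule nn_integral_liminf[OF measurable_compose[OF X cm]])
    also have "\<dots> \<le> liminf (\<lambda>j. ennreal p)" by (intro Liminf_mono always_eventually allI cost_law)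
    also have "\<dots> = ennreal p" by (simp add: Liminf_const)
    finally show ?thesis .
  qed
  ultimately show ?thesis by blast
qed

lemma tests_cases [consumes 1]:
  assumes "f \<in> tests n \<mu>"
  obtains (marginal) s i b m where "s \<in> {-1, 1}" "i \<in> {1..n}" "f = (\<lambda>x. s * marginal_test \<mu> i b m x)"
    | (martingale) s i b m where "s \<in> {-1, 1}" "i \<in> {1..n - 1}" "f = (\<lambda>x. s * martingale_test i b m x)"
    | (moment) i where "i \<in> {1..n}" "f = moment_test \<mu> i"
  using assms unfolding tests_def
proof (elim UnE imageE)
  fix z assume f: "f = (case z of (s, i, b, m) \<Rightarrow> \<lambda>x. s * marginal_test \<mu> i b m x)"
    and z: "z \<in> {-1, 1} \<times> {1..n} \<times> \<rat> \<times> UNIV"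
  obtain s i b m where "z = (s, i, b, m)" by (cases z) auto
  with f z show thesis by (intro marginal[of s i b m]) auto
next
  fix z :: "real \<times> nat \<times> (nat \<Rightarrow> real) \<times> nat"
  assume f: "f = (case z of (s, i, b, m) \<Rightarrow> \<lambda>x. s * martingale_test i b m x)"
    and z: "z \<in> {-1, 1} \<times> {1..n - 1} \<times> ({1..n} \<rightarrow>\<^sub>E \<rat>) \<times> UNIV"
  obtain s i b m where "z = (s, i, b, m)" by (cases z) auto
  with f z show thesis by (intro martingale[of s i b m]) auto
qed (rule moment)

section \<open>Semistatic portfolios\<close>

text \<open>
  \<open>\<phi>\<close> is the payoff of a static position \<open>u\<close> in the marginals and a self-financing trading strategy \<open>\<Delta>\<close>, and \<open>r\<close> is its price. That \<open>\<Delta> i\<close>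
  depends on the first \<open>i\<close> coordinates only is expressed pointwise.
\<close>

definition semistatic :: "nat \<Rightarrow> (nat \<Rightarrow> real measure) \<Rightarrow> ((nat \<Rightarrow> real) \<Rightarrow> real) \<Rightarrow> real \<Rightarrow> bool" where
  "semistatic n \<mu> \<phi> r \<longleftrightarrow> (\<exists>u \<Delta>.
     (\<forall>i\<in>{1..n}. integrable (\<mu> i) (u i)) \<and>
     (\<forall>i\<in>{1..n - 1}. \<forall>x y. (\<forall>j\<in>{1..i}. x j = y j) \<longrightarrow> \<Delta> i x = \<Delta> i y) \<and>
     (\<forall>x. \<phi> x = (\<Sum>i=1..n. u i (x i)) + (\<Sum>i=1..n - 1. \<Delta> i x * (x (Suc i) - x i))) \<and>
     r = (\<Sum>i=1..n. \<integral>s. u i s \<partial>\<mu> i))"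

lemma semistatic_add:
  assumes "semistatic n \<mu> \<phi> r" "semistatic n \<mu> \<psi> s"
  shows "semistatic n \<mu> (\<lambda>x. \<phi> x + \<psi> x) (r + s)"
proof -
  from assms obtain u \<Delta> v \<Gamma> where
    u: "\<And>i. i \<in> {1..n} \<Longrightarrow> integrable (\<mu> i) (u i)" "r = (\<Sum>i=1..n. \<integral>s. u i s \<partial>\<mu> i)"
      "\<And>i x y. i \<in> {1..n - 1} \<Longrightarrow> (\<forall>j\<in>{1..i}. x j = y j) \<Longrightarrow> \<Delta> i x = \<Delta> i y"
      "\<And>x. \<phi> x = (\<Sum>i=1..n. u i (x i)) + (\<Sum>i=1..n - 1. \<Delta> i x * (x (Suc i) - x i))"
    and v: "\<And>i. i \<in> {1..n} \<Longrightarrow> integrable (\<mu> i) (v i)" "s = (\<Sum>i=1..n. \<integral>s. v i s \<partial>\<mu> i)"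
      "\<And>i x y. i \<in> {1..n - 1} \<Longrightarrow> (\<forall>j\<in>{1..i}. x j = y j) \<Longrightarrow> \<Gamma> i x = \<Gamma> i y"
      "\<And>x. \<psi> x = (\<Sum>i=1..n. v i (x i)) + (\<Sum>i=1..n - 1. \<Gamma> i x * (x (Suc i) - x i))"
    unfolding semistatic_def by blast
  show ?thesis
    unfolding semistatic_def
  proof (intro exI conjI ballI allI impI)
    show "integrable (\<mu> i) (\<lambda>s. u i s + v i s)" if "i \<in> {1..n}" for i
      using u(1) v(1) that by auto
    show "\<Delta> i x + \<Gamma> i x = \<Delta> i y + \<Gamma> i y" if "i \<in> {1..n - 1}" "\<forall>j\<in>{1..i}. x j = y j" for i x y
      using u(3)[OF that] v(3)[OF that] by simp
    show "\<phi> x + \<psi> x = (\<Sum>i=1..n. u i (x i) + v i (x i)) + (\<Sum>i=1..n - 1. (\<Delta> i x + \<Gamma> i x) * (x (Suc i) - x i))" for x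
      by (simp add: u(4) v(4) sum.distrib distrib_right)
    show "r + s = (\<Sum>i=1..n. \<integral>s. u i s + v i s \<partial>\<mu> i)"
      unfolding u(2) v(2) sum.distrib[symmetric] using u(1) v(1) by (intro sum.cong) auto
  qed
qed

lemma semistatic_scale:
  assumes "semistatic n \<mu> \<phi> r"
  shows "semistatic n \<mu> (\<lambda>x. a * \<phi> x) (a * r)"
proof -
  from assms obtain u \<Delta> where
    u: "\<And>i. i \<in> {1..n} \<Longrightarrow> integrable (\<mu> i) (u i)" "r = (\<Sum>i=1..n. \<integral>s. u i s \<partial>\<mu> i)"
      "\<And>i x y. i \<in> {1..n - 1} \<Longrightarrow> (\<forall>j\<in>{1..i}. x j = y j) \<Longrightarrow> \<Delta> i x = \<Delta> i y"
      "\<And>x. \<phi> x = (\<Sum>i=1..n. u i (x i)) + (\<Sum>i=1..n - 1. \<Delta> i x * (x (Suc i) - x i))"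
    unfolding semistatic_def by blast
  show ?thesis
    unfolding semistatic_def
  proof (intro exI conjI ballI allI impI)
    show "integrable (\<mu> i) (\<lambda>s. a * u i s)" if "i \<in> {1..n}" for i using u(1) that by auto
    show "a * \<Delta> i x = a * \<Delta> i y" if "i \<in> {1..n - 1}" "\<forall>j\<in>{1..i}. x j = y j" for i x y
      using u(3)[OF that] by simp
    show "a * \<phi> x = (\<Sum>i=1..n. a * u i (x i)) + (\<Sum>i=1..n - 1. (a * \<Delta> i x) * (x (Suc i) - x i))" for x
      by (simp add: u(4) sum_distrib_left distrib_left mult.assoc)
    show "a * r = (\<Sum>i=1..n. \<integral>s. a * u i s \<partial>\<mu> i)"
      by (simp add: u(2) sum_distrib_left)
  qed
qed

lemma semistatic_coordinate:
  assumes i: "i \<in> {1..n}" and g: "integrable (\<mu> i) g"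
  shows "semistatic n \<mu> (\<lambda>x. g (x i)) (\<integral>s. g s \<partial>\<mu> i)"
  unfolding semistatic_def
proof (intro exI conjI ballI allI impI)
  show "integrable (\<mu> j) (if j = i then g else (\<lambda>_. 0))" for j using g by simp
  have "(\<Sum>j=1..n. (if j = i then g else (\<lambda>_. 0)) (x j)) = (\<Sum>j=1..n. if j = i then g (x i) else 0)" for x
    by (intro sum.cong) auto
  then show "g (x i) = (\<Sum>j=1..n. (if j = i then g else (\<lambda>_. 0)) (x j)) + (\<Sum>j=1..n - 1. 0 * (x (Suc j) - x j))" for x
    using i by simp
  have "(\<Sum>j=1..n. \<integral>s. (if j = i then g else (\<lambda>_. 0)) s \<partial>\<mu> j) = (\<Sum>j=1..n. if j = i then \<integral>s. g s \<partial>\<mu> i else 0)"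
    by (intro sum.cong) auto
  then show "(\<integral>s. g s \<partial>\<mu> i) = (\<Sum>j=1..n. \<integral>s. (if j = i then g else (\<lambda>_. 0)) s \<partial>\<mu> j)"
    using i by simp
qed auto

lemma semistatic_sum:
  assumes "finite I" "semistatic n \<mu> (\<lambda>_. 0) 0" "\<And>k. k \<in> I \<Longrightarrow> semistatic n \<mu> (f k) (r k)"
  shows "semistatic n \<mu> (\<lambda>x. \<Sum>k\<in>I. f k x) (\<Sum>k\<in>I. r k)"
  using assms by (induction I rule: finite_induct) (auto intro: semistatic_add)

lemma semistatic_const:
  assumes "1 \<le> n" "prob_space (\<mu> 1)"
  shows "semistatic n \<mu> (\<lambda>_. a) a"
proof -
  interpret prob_space "\<mu> 1" by fact
  show ?thesis using semistatic_coordinate[of 1 n \<mu> "\<lambda>_. a"] assms by (simp add: prob_space)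
qed

lemma semistatic_martingale_test:
  assumes i: "i \<in> {1..n - 1}"
  shows "semistatic n \<mu> (martingale_test i b m) 0"
  unfolding semistatic_def
proof (intro exI conjI ballI allI impI)
  let ?\<Delta> = "\<lambda>k x. if k = i then \<Prod>j\<in>{1..i}. ramp (b j) m (x j) else 0"
  show "?\<Delta> k x = ?\<Delta> k y" if "\<forall>j\<in>{1..k}. x j = y j" for k x y
    using that by auto
  have "(\<Sum>k=1..n - 1. ?\<Delta> k x * (x (Suc k) - x k)) = (\<Sum>k=1..n - 1. if k = i then martingale_test i b m x else 0)" for x
    by (intro sum.cong) (auto simp: martingale_test_def)
  then show "martingale_test i b m x = (\<Sum>k=1..n. 0) + (\<Sum>k=1..n - 1. ?\<Delta> k x * (x (Suc k) - x k))" for x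
    using i by simp
qed auto

lemma semistatic_tests:
  assumes n: "1 \<le> n" and \<mu>: "\<And>i. i \<in> {1..n} \<Longrightarrow> prob_space (\<mu> i)" "\<And>i. i \<in> {1..n} \<Longrightarrow> sets (\<mu> i) = sets borel"
      "\<And>i. i \<in> {1..n} \<Longrightarrow> integrable (\<mu> i) (\<lambda>x. x)"
    and f: "f \<in> tests n \<mu>"
  shows "semistatic n \<mu> f 0"
proof -
  have centred: "semistatic n \<mu> (\<lambda>x. g (x i) - (\<integral>s. g s \<partial>\<mu> i)) 0"
    if i: "i \<in> {1..n}" and g: "integrable (\<mu> i) g" for i g
  proof -
    have "semistatic n \<mu> (\<lambda>x. g (x i) + (- 1) * (\<integral>s. g s \<partial>\<mu> i)) ((\<integral>s. g s \<partial>\<mu> i) + (- 1) * (\<integral>s. g s \<partial>\<mu> i))"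
      using n \<mu>(1) by (intro semistatic_add semistatic_scale semistatic_const semistatic_coordinate i g) auto
    then show ?thesis by simp
  qed
  have semistatic_marginal: "semistatic n \<mu> (marginal_test \<mu> i b m) 0" if i: "i \<in> {1..n}" for i b m
  proof -
    interpret prob_space "\<mu> i" by (rule \<mu>(1)[OF i])
    have "integrable (\<mu> i) (ramp b m)"
      using ramp_bounds(3) by (intro integrable_const_bound[where B = 1])
        (auto simp: measurable_cong_sets[OF \<mu>(2)[OF i] refl])
    from centred[OF i this] show ?thesis by (simp add: marginal_test_def[abs_def])
  qed
  from f show ?thesis
  proof (cases rule: tests_cases)
    case (marginal s i b m)
    then show ?thesis using semistatic_scale[OF semistatic_marginal[OF marginal(2)], where a = s] by simp
  next
    case (martingale s i b m)
    then show ?thesis using semistatic_scale[OF semistatic_martingale_test[OF martingale(2)], where a = s] by simp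
  next
    case (moment i)
    then show ?thesis using centred[OF moment(1), of abs] \<mu>(3) by (simp add: moment_test_def[abs_def])
  qed
qed

lemma tests_linear_growth:
  assumes f: "f \<in> tests n \<mu>"
  shows "\<exists>B\<ge>0. \<forall>x. \<bar>f x\<bar> \<le> B * (1 + (\<Sum>i=1..n. \<bar>x i\<bar>))"
proof -
  define W where "W x = 1 + (\<Sum>i=1..n. \<bar>x i\<bar>)" for x :: "nat \<Rightarrow> real"
  have W1: "1 \<le> W x" for x by (simp add: W_def sum_nonneg)
  have Wi: "\<bar>x i\<bar> \<le> W x" if "i \<in> {1..n}" for x i
    using member_le_sum[OF that, of "\<lambda>i. \<bar>x i\<bar>"] by (simp add: W_def)
  have le_scale: "a \<le> a * W x" if "0 \<le> a" for a x using mult_left_mono[OF W1 that] by simp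
  from f have "\<exists>B\<ge>0. \<forall>x. \<bar>f x\<bar> \<le> B * W x"
  proof (cases rule: tests_cases)
    case (marginal s i b m)
    have "\<bar>f x\<bar> \<le> (1 + \<bar>\<integral>s. ramp b m s \<partial>\<mu> i\<bar>) * W x" for x
    proof -
      have "\<bar>f x\<bar> = \<bar>ramp b m (x i) - (\<integral>s. ramp b m s \<partial>\<mu> i)\<bar>"
        using marginal by (auto simp: marginal_test_def)
      also have "\<dots> \<le> 1 + \<bar>\<integral>s. ramp b m s \<partial>\<mu> i\<bar>"
        using ramp_bounds(3)[of b m "x i"] by linarith
      also have "\<dots> \<le> (1 + \<bar>\<integral>s. ramp b m s \<partial>\<mu> i\<bar>) * W x" by (rule le_scale) simp
      finally show ?thesis .
    qed
    then show ?thesis by (intro exI[of _ "1 + \<bar>\<integral>s. ramp b m s \<partial>\<mu> i\<bar>"]) auto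
  next
    case (martingale s i b m)
    have "\<bar>f x\<bar> \<le> 2 * W x" for x
    proof -
      have "\<bar>\<Prod>j\<in>{1..i}. ramp (b j) m (x j)\<bar> \<le> 1"
        by (auto simp: abs_prod intro!: prod_le_1 ramp_bounds)
      then have "\<bar>\<Prod>j\<in>{1..i}. ramp (b j) m (x j)\<bar> * \<bar>x (Suc i) - x i\<bar> \<le> 1 * \<bar>x (Suc i) - x i\<bar>"
        by (intro mult_right_mono) auto
      then have "\<bar>f x\<bar> \<le> \<bar>x (Suc i) - x i\<bar>" using martingale by (auto simp: martingale_test_def abs_mult)
      also have "\<dots> \<le> \<bar>x (Suc i)\<bar> + \<bar>x i\<bar>" by (rule abs_triangle_ineq4)
      also have "\<dots> \<le> W x + W x" using martingale(2) by (intro add_mono Wi) auto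
      finally show ?thesis by simp
    qed
    then show ?thesis by (intro exI[of _ 2]) auto
  next
    case (moment i)
    have "\<bar>f x\<bar> \<le> (1 + (\<integral>s. \<bar>s\<bar> \<partial>\<mu> i)) * W x" for x
    proof -
      have t: "0 \<le> (\<integral>s. \<bar>s\<bar> \<partial>\<mu> i)" by simp
      have "\<bar>f x\<bar> \<le> \<bar>x i\<bar> + (\<integral>s. \<bar>s\<bar> \<partial>\<mu> i)" using moment t by (simp add: moment_test_def abs_le_iff)
      also have "\<dots> \<le> W x + (\<integral>s. \<bar>s\<bar> \<partial>\<mu> i) * W x" using Wi[OF moment(1)] le_scale[OF t] by (intro add_mono)
      finally show ?thesis by (simp add: distrib_right)
    qed
    then show ?thesis by (intro exI[of _ "1 + (\<integral>s. \<bar>s\<bar> \<partial>\<mu> i)"]) auto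
  qed
  then show ?thesis by (simp add: W_def)
qed

lemma affine_le_convex_biconjugate:
  assumes "\<And>y. ereal (a + d * (y - x)) \<le> f y"
  shows "ereal a \<le> convex_biconjugate f x"
  unfolding convex_biconjugate_def
proof (rule Sup_upper, rule CollectI, rule exI[of _ "\<lambda>y. a + d * (y - x)"], intro conjI)
  let ?h = "\<lambda>y. a + d * (y - x)"
  show "ereal a = ereal (?h x)" by simp
  show "lower_semicontinuous_map euclideanreal ?h"
    unfolding lower_semicontinuous_map_def by (auto intro!: open_Collect_less continuous_intros)
  show "convex_on UNIV ?h"
  proof (rule convex_onI)
    fix t y z :: real
    show "?h ((1 - t) *\<^sub>R y + t *\<^sub>R z) \<le> (1 - t) * ?h y + t * ?h z"
      by (simp add: algebra_simps)
  qed simp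
  show "\<forall>y. ereal (?h y) \<le> f y" using assms by simp
qed

text \<open>
  The value at time \<open>i\<close> of the portfolio without its positions in \<open>u\<^sub>2, \<dots>, u\<^sub>n\<close> is a lower bound of \<open>c\<^sub>i\<close>: as a function of the next
  coordinate, its value at time \<open>i + 1\<close> is affine, and at \<open>y = x i\<close> the last trading gain vanishes.
\<close>

lemma subhedge_le_c_iter:
  assumes adapted: "\<And>i x y. i \<in> {1..n - 1} \<Longrightarrow> (\<forall>j\<in>{1..i}. x j = y j) \<Longrightarrow> \<Delta> i x = \<Delta> i y"
    and le: "\<And>x. x \<in> R_space n \<Longrightarrow>
      ereal ((\<Sum>i=1..n. u i (x i)) + (\<Sum>i=1..n - 1. \<Delta> i x * (x (Suc i) - x i))) \<le> c x"
    and i: "1 \<le> i" "i \<le> n" and x: "x \<in> R_space i"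
  shows "ereal (u 1 (x 1) + (\<Sum>j=1..i - 1. \<Delta> j x * (x (Suc j) - x j))) \<le> c_iter c n u i x"
  using i(2,1) x
proof (induction arbitrary: x rule: inc_induct)
  case base
  have "(\<Sum>j=1..n. u j (x j)) = u 1 (x 1) + (\<Sum>j=2..n. u j (x j))"
    using base(1) by (subst sum.atLeast_Suc_atMost) (auto simp: numeral_2_eq_2 One_nat_def)
  with le[OF base(2)] show ?case
    by (subst c_iter.simps) (cases "c x"; simp)
next
  case (step i)
  have "c_iter c n u i x = convex_biconjugate (\<lambda>y. c_iter c n u (Suc i) (x(Suc i := y))) (x i)"
    using step by (subst c_iter.simps) auto
  moreover have "ereal (u 1 (x 1) + (\<Sum>j=1..i - 1. \<Delta> j x * (x (Suc j) - x j)))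
      \<le> convex_biconjugate (\<lambda>y. c_iter c n u (Suc i) (x(Suc i := y))) (x i)"
  proof (rule affine_le_convex_biconjugate)
    fix y
    define x' where "x' = x(Suc i := y)"
    have "x' \<in> R_space (Suc i)" using step(5) by (auto simp: x'_def PiE_iff extensional_def)
    from step.IH[OF _ this]
    have IH: "ereal (u 1 (x' 1) + (\<Sum>j=1..i. \<Delta> j x' * (x' (Suc j) - x' j))) \<le> c_iter c n u (Suc i) x'" by simp
    have \<Delta>: "\<Delta> j x' = \<Delta> j x" if "j \<in> {1..i}" for j
      using that step by (intro adapted) (auto simp: x'_def)
    obtain i0 where i0: "i = Suc i0" using step by (cases i) auto
    have "(\<Sum>j=1..i. \<Delta> j x' * (x' (Suc j) - x' j))
        = (\<Sum>j=1..i0. \<Delta> j x' * (x' (Suc j) - x' j)) + \<Delta> i x' * (x' (Suc i) - x' i)"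
      unfolding i0 by simp
    also have "(\<Sum>j=1..i0. \<Delta> j x' * (x' (Suc j) - x' j)) = (\<Sum>j=1..i0. \<Delta> j x * (x (Suc j) - x j))"
    proof (rule sum.cong)
      fix j assume j: "j \<in> {1..i0}"
      then show "\<Delta> j x' * (x' (Suc j) - x' j) = \<Delta> j x * (x (Suc j) - x j)"
        using \<Delta>[of j] by (simp add: i0) (simp add: x'_def i0)
    qed simp
    also have "\<Delta> i x' * (x' (Suc i) - x' i) = \<Delta> i x * (y - x i)"
      using \<Delta>[of i] step by (simp add: x'_def)
    finally have eq: "(\<Sum>j=1..i. \<Delta> j x' * (x' (Suc j) - x' j))
        = (\<Sum>j=1..i - 1. \<Delta> j x * (x (Suc j) - x j)) + \<Delta> i x * (y - x i)"
      by (simp add: i0)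
    have "x' 1 = x 1" using step by (auto simp: x'_def)
    with IH show "ereal (u 1 (x 1) + (\<Sum>j=1..i - 1. \<Delta> j x * (x (Suc j) - x j)) + \<Delta> i x * (y - x i))
        \<le> c_iter c n u (Suc i) (x(Suc i := y))"
      unfolding eq x'_def[symmetric] by (simp only: add.assoc)
  qed
  ultimately show ?case by simp
qed

lemma semistatic_subhedge_value:
  assumes n: "1 \<le> n" and hedge: "semistatic n \<mu> \<phi> r"
    and le: "\<And>x. x \<in> R_space n \<Longrightarrow> ereal (\<phi> x) \<le> c x"
  shows "\<exists>u. (\<forall>i\<in>{2..n}. integrable (\<mu> i) (u i)) \<and>
    ereal r \<le> ereal_expectation (\<mu> 1) (\<lambda>s. c_iter c n u 1 (\<lambda>k\<in>{1}. s)) + ereal (\<Sum>i = 2..n. \<integral>s. u i s \<partial>\<mu> i)"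
proof -
  from hedge obtain u \<Delta> where
    u: "\<And>i. i \<in> {1..n} \<Longrightarrow> integrable (\<mu> i) (u i)" "r = (\<Sum>i=1..n. \<integral>s. u i s \<partial>\<mu> i)"
      "\<And>i x y. i \<in> {1..n - 1} \<Longrightarrow> (\<forall>j\<in>{1..i}. x j = y j) \<Longrightarrow> \<Delta> i x = \<Delta> i y"
      "\<And>x. \<phi> x = (\<Sum>i=1..n. u i (x i)) + (\<Sum>i=1..n - 1. \<Delta> i x * (x (Suc i) - x i))"
    unfolding semistatic_def by blast
  have "ereal (u 1 s) \<le> c_iter c n u 1 (\<lambda>k\<in>{1}. s)" for s
  proof -
    define e where "e = (\<lambda>k\<in>{1 :: nat}. s)"
    have "ereal (u 1 (e 1) + (\<Sum>j=1..1 - 1. \<Delta> j e * (e (Suc j) - e j))) \<le> c_iter c n u 1 e"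
    proof (rule subhedge_le_c_iter[where n = n and i = 1 and x = e])
      show "\<Delta> i x = \<Delta> i y" if "i \<in> {1..n - 1}" "\<forall>j\<in>{1..i}. x j = y j" for i x y
        using that by (rule u(3))
      show "ereal ((\<Sum>i=1..n. u i (x i)) + (\<Sum>i=1..n - 1. \<Delta> i x * (x (Suc i) - x i))) \<le> c x"
        if "x \<in> R_space n" for x
        using le[OF that] by (simp add: u(4))
    qed (use n in \<open>auto simp: e_def\<close>)
    then show ?thesis by (simp add: e_def)
  qed
  then have "ereal_expectation (\<mu> 1) (\<lambda>s. ereal (u 1 s)) \<le> ereal_expectation (\<mu> 1) (\<lambda>s. c_iter c n u 1 (\<lambda>k\<in>{1}. s))"
    by (intro ereal_expectation_mono) simp
  moreover have "ereal_expectation (\<mu> 1) (\<lambda>s. ereal (u 1 s)) = ereal (\<integral>s. u 1 s \<partial>\<mu> 1)"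
    using u(1) n by (intro ereal_expectation_integrable) auto
  moreover have "r = (\<integral>s. u 1 s \<partial>\<mu> 1) + (\<Sum>i = 2..n. \<integral>s. u i s \<partial>\<mu> i)"
    using n unfolding u(2) by (subst sum.atLeast_Suc_atMost) (auto simp: numeral_2_eq_2 One_nat_def)
  ultimately have "ereal r \<le> ereal_expectation (\<mu> 1) (\<lambda>s. c_iter c n u 1 (\<lambda>k\<in>{1}. s)) + ereal (\<Sum>i = 2..n. \<integral>s. u i s \<partial>\<mu> i)"
    by (metis add_right_mono plus_ereal.simps(1))
  then show ?thesis using u(1) by (intro exI[of _ u]) auto
qed

section \<open>Duality\<close>

lemma lower_semicontinuous_map_add_real:
  fixes c :: "(nat \<Rightarrow> real) \<Rightarrow> ereal"
  assumes c: "lower_semicontinuous_map X c" and fin: "\<And>x. x \<in> topspace X \<Longrightarrow> -\<infinity> < c x"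
    and w: "continuous_map X euclideanreal w"
  shows "lower_semicontinuous_map X (\<lambda>x. c x + ereal (w x))"
  unfolding lower_semicontinuous_map_def
proof
  fix a :: ereal
  show "openin X {x \<in> topspace X. a < c x + ereal (w x)}"
  proof (cases a)
    case (real b)
    have "{x \<in> topspace X. a < c x + ereal (w x)}
        = (\<Union>r. {x \<in> topspace X. w x \<in> {b - r<..}} \<inter> {x \<in> topspace X. ereal r < c x})"
    proof (intro equalityI subsetI)
      fix x assume x: "x \<in> {x \<in> topspace X. a < c x + ereal (w x)}"
      then have "ereal (b - w x) < c x" using real by (cases "c x") auto
      then obtain r where "ereal (b - w x) < ereal r" "ereal r < c x" using ereal_dense2 by blast
      with x show "x \<in> (\<Union>r. {x \<in> topspace X. w x \<in> {b - r<..}} \<inter> {x \<in> topspace X. ereal r < c x})"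
        by (auto intro!: exI[of _ r])
    next
      fix x assume "x \<in> (\<Union>r. {x \<in> topspace X. w x \<in> {b - r<..}} \<inter> {x \<in> topspace X. ereal r < c x})"
      then obtain r where "x \<in> topspace X" "b - r < w x" "ereal r < c x" by auto
      then show "x \<in> {x \<in> topspace X. a < c x + ereal (w x)}" using real by (cases "c x") auto
    qed
    moreover have "openin X {x \<in> topspace X. w x \<in> {b - r<..}}" for r
      by (intro openin_continuous_map_preimage[OF w]) simp
    moreover have "openin X {x \<in> topspace X. ereal r < c x}" for r
      using c by (simp add: lower_semicontinuous_map_def)
    ultimately show ?thesis by (simp only:) (intro openin_Union, auto intro: openin_Int)
  next
    case PInf
    then show ?thesis by simp
  next
    case MInf
    have "{x \<in> topspace X. a < c x + ereal (w x)} = topspace X"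
    proof -
      have "a < c x + ereal (w x)" if "x \<in> topspace X" for x
        using MInf fin[OF that] by (cases "c x") auto
      then show ?thesis by auto
    qed
    then show ?thesis by simp
  qed
qed

context martingale_coupling
begin

lemma integrable_linear_growth:
  "integrable Q (\<lambda>x. 1 + (\<Sum>i=1..n. \<bar>x i\<bar>))"
  "(\<integral>x. 1 + (\<Sum>i=1..n. \<bar>x i\<bar>) \<partial>Q) = 1 + (\<Sum>i=1..n. \<integral>s. \<bar>s\<bar> \<partial>\<mu> i)"
proof -
  have int: "integrable Q (\<lambda>x. \<bar>x i\<bar>)" "(\<integral>x. \<bar>x i\<bar> \<partial>Q) = (\<integral>s. \<bar>s\<bar> \<partial>\<mu> i)" if "i \<in> {1..n}" for i
    using integrable_marginal[OF that, of abs] marginal_integrable[OF that] by auto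
  show "integrable Q (\<lambda>x. 1 + (\<Sum>i=1..n. \<bar>x i\<bar>))" 
    by (intro Bochner_Integration.integrable_add Bochner_Integration.integrable_sum int(1)) auto
  show "(\<integral>x. 1 + (\<Sum>i=1..n. \<bar>x i\<bar>) \<partial>Q) = 1 + (\<Sum>i=1..n. \<integral>s. \<bar>s\<bar> \<partial>\<mu> i)"
  proof -
    have "(\<integral>x. 1 + (\<Sum>i=1..n. \<bar>x i\<bar>) \<partial>Q) = 1 + (\<integral>x. (\<Sum>i=1..n. \<bar>x i\<bar>) \<partial>Q)"
    proof (subst Bochner_Integration.integral_add)
      show "integrable Q (\<lambda>x. \<Sum>i=1..n. \<bar>x i\<bar>)" by (intro Bochner_Integration.integrable_sum int(1))
    qed (auto simp: prob_space)
    also have "(\<integral>x. (\<Sum>i=1..n. \<bar>x i\<bar>) \<partial>Q) = (\<Sum>i=1..n. \<integral>x. \<bar>x i\<bar> \<partial>Q)"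
      by (rule Bochner_Integration.integral_sum) (rule int(1))
    also have "\<dots> = (\<Sum>i=1..n. \<integral>s. \<bar>s\<bar> \<partial>\<mu> i)" by (intro sum.cong int(2)) auto
    finally show ?thesis .
  qed
qed

lemma expectation_of_finite_nonnegative:
  assumes c: "c \<in> borel_measurable (path_space n)"
    and c0: "\<forall>x\<in>R_space n. 0 \<le> c x" and fin: "(\<integral>\<^sup>+x. e2ennreal (c x) \<partial>Q) < \<infinity>"
  shows "integrable Q (\<lambda>x. real_of_ereal (c x))"
    "AE x in Q. c x = ereal (real_of_ereal (c x))"
    "ennreal (\<integral>x. real_of_ereal (c x) \<partial>Q) = (\<integral>\<^sup>+x. e2ennreal (c x) \<partial>Q)"
proof -
  have [measurable]: "c \<in> borel_measurable Q"
    using c by (simp add: measurable_cong_sets[OF sets_Q refl])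
  have "AE x in Q. e2ennreal (c x) \<noteq> \<infinity>"
    using fin by (intro nn_integral_PInf_AE) auto
  then have AE: "AE x in Q. c x = ereal (real_of_ereal (c x)) \<and> 0 \<le> real_of_ereal (c x)"
    using AE_space
  proof eventually_elim
    case (elim x)
    then show ?case using bspec[OF c0, of x] by (cases "c x") (auto simp: space_Q)
  qed
  then show "AE x in Q. c x = ereal (real_of_ereal (c x))" by eventually_elim simp
  have eq: "(\<integral>\<^sup>+x. e2ennreal (c x) \<partial>Q) = (\<integral>\<^sup>+x. ennreal (real_of_ereal (c x)) \<partial>Q)"
  proof (rule nn_integral_cong_AE)
    show "AE x in Q. e2ennreal (c x) = ennreal (real_of_ereal (c x))"
      using AE
    proof eventually_elim
      case (elim x)
      then show ?case by (cases "c x") (auto simp: e2ennreal_ereal)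
    qed
  qed
  show int: "integrable Q (\<lambda>x. real_of_ereal (c x))"
    using AE fin eq by (intro integrableI_nonneg) auto
  show "ennreal (\<integral>x. real_of_ereal (c x) \<partial>Q) = (\<integral>\<^sup>+x. e2ennreal (c x) \<partial>Q)"
    unfolding eq using AE by (intro nn_integral_eq_integral[OF int, symmetric]) auto
qed

text \<open>
  The cost \<open>c + w\<close> is nonnegative, and its expectation differs from that of \<open>c\<close> by a constant that is the same for all
  martingale measures with the given marginals.
\<close>

lemma expectation_of_cost:
  fixes c :: "(nat \<Rightarrow> real) \<Rightarrow> ereal" and K :: real
  defines "w x \<equiv> \<bar>K\<bar> * (1 + (\<Sum>i=1..n. \<bar>x i\<bar>))"
  assumes c: "c \<in> borel_measurable (path_space n)"
    and lower: "\<forall>x\<in>R_space n. ereal (- w x) \<le> c x"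
    and fin: "(\<integral>\<^sup>+x. e2ennreal (c x + ereal (w x)) \<partial>Q) < \<infinity>"
  shows "integrable Q (\<lambda>x. real_of_ereal (c x))"
    "AE x in Q. c x = ereal (real_of_ereal (c x))"
    "ereal_expectation Q c = ereal (\<integral>x. real_of_ereal (c x) \<partial>Q)"
    "(\<integral>\<^sup>+x. e2ennreal (c x + ereal (w x)) \<partial>Q)
      = ennreal ((\<integral>x. real_of_ereal (c x) \<partial>Q) + \<bar>K\<bar> * (1 + (\<Sum>i=1..n. \<integral>s. \<bar>s\<bar> \<partial>\<mu> i)))"
proof -
  define d where "d x = c x + ereal (w x)" for x
  have wm: "w \<in> borel_measurable (path_space n)"
    unfolding w_def[abs_def] by measurable
  have dm: "d \<in> borel_measurable (path_space n)"
    unfolding d_def[abs_def] using c wm by measurable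
  have w: "integrable Q w" "(\<integral>x. w x \<partial>Q) = \<bar>K\<bar> * (1 + (\<Sum>i=1..n. \<integral>s. \<bar>s\<bar> \<partial>\<mu> i))"
    unfolding w_def[abs_def] using integrable_linear_growth by simp_all
  have d0: "\<forall>x\<in>R_space n. 0 \<le> d x"
  proof
    fix x assume "x \<in> R_space n"
    from bspec[OF lower this] show "0 \<le> d x" unfolding d_def by (cases "c x") auto
  qed
  have "(\<integral>\<^sup>+x. e2ennreal (d x) \<partial>Q) < \<infinity>" using fin by (simp add: d_def)
  note d = expectation_of_finite_nonnegative[OF dm d0 this]
  have eq: "AE x in Q. c x = ereal (real_of_ereal (d x) - w x)"
    using d(2)
  proof eventually_elim
    case (elim x)
    then show ?case unfolding d_def by (cases "c x") auto
  qed
  have eq': "AE x in Q. real_of_ereal (c x) = real_of_ereal (d x) - w x"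
    using eq by eventually_elim simp
  have int: "integrable Q (\<lambda>x. real_of_ereal (d x) - w x)" using d(1) w(1) by simp
  have "c \<in> borel_measurable Q" using c by (simp add: measurable_cong_sets[OF sets_Q refl])
  then have rcm: "(\<lambda>x. real_of_ereal (c x)) \<in> borel_measurable Q" by measurable
  have "integrable Q (\<lambda>x. real_of_ereal (c x)) \<longleftrightarrow> integrable Q (\<lambda>x. real_of_ereal (d x) - w x)"
    by (rule integrable_cong_AE[OF rcm borel_measurable_integrable[OF int] eq'])
  with int show rc: "integrable Q (\<lambda>x. real_of_ereal (c x))" by simp
  show AE: "AE x in Q. c x = ereal (real_of_ereal (c x))"
    using eq by eventually_elim simp
  show "ereal_expectation Q c = ereal (\<integral>x. real_of_ereal (c x) \<partial>Q)"
    by (rule ereal_expectation_integrable[OF rc AE])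
  have "(\<integral>x. real_of_ereal (c x) \<partial>Q) = (\<integral>x. real_of_ereal (d x) - w x \<partial>Q)"
    by (rule integral_cong_AE[OF rcm borel_measurable_integrable[OF int] eq'])
  then have "(\<integral>x. real_of_ereal (d x) \<partial>Q) = (\<integral>x. real_of_ereal (c x) \<partial>Q) + \<bar>K\<bar> * (1 + (\<Sum>i=1..n. \<integral>s. \<bar>s\<bar> \<partial>\<mu> i))"
    using d(1) w by simp
  then show "(\<integral>\<^sup>+x. e2ennreal (c x + ereal (w x)) \<partial>Q)
      = ennreal ((\<integral>x. real_of_ereal (c x) \<partial>Q) + \<bar>K\<bar> * (1 + (\<Sum>i=1..n. \<integral>s. \<bar>s\<bar> \<partial>\<mu> i)))"
    using d(3) by (simp add: d_def)
qed

lemma weak_duality: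
  fixes c :: "(nat \<Rightarrow> real) \<Rightarrow> ereal" and K :: real
  assumes n: "1 \<le> n" and c: "c \<in> borel_measurable (path_space n)"
    and lower: "\<forall>x\<in>R_space n. ereal (- (\<bar>K\<bar> * (1 + (\<Sum>i=1..n. \<bar>x i\<bar>)))) \<le> c x"
    and u: "\<And>i. i \<in> {2..n} \<Longrightarrow> integrable (\<mu> i) (u i)"
  shows "ereal_expectation (\<mu> 1) (\<lambda>s. c_iter c n u 1 (\<lambda>k\<in>{1}. s)) + ereal (\<Sum>i = 2..n. \<integral>s. u i s \<partial>\<mu> i)
    \<le> ereal_expectation Q c"
proof (cases "ereal_expectation Q c = \<infinity>")
  case False
  define w where "w x = \<bar>K\<bar> * (1 + (\<Sum>i=1..n. \<bar>x i\<bar>))" for x :: "nat \<Rightarrow> real"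
  have w0: "0 \<le> w x" for x by (simp add: w_def sum_nonneg)
  have w: "integrable Q w" unfolding w_def[abs_def] using integrable_linear_growth(1) by simp
  have [measurable]: "c \<in> borel_measurable Q" using c by (simp add: measurable_cong_sets[OF sets_Q refl])
  note [measurable] = borel_measurable_integrable[OF w]
  have w_fin: "(\<integral>\<^sup>+x. ennreal (w x) \<partial>Q) < \<infinity>"
    using integrableD(2)[OF w] by (simp add: less_top)
  have "(\<integral>\<^sup>+x. e2ennreal (- c x) \<partial>Q) \<le> (\<integral>\<^sup>+x. ennreal (w x) \<partial>Q)"
  proof (rule nn_integral_mono)
    fix x assume "x \<in> space Q"
    then have "- c x \<le> ereal (w x)"
      using bspec[OF lower, of x] unfolding space_Q w_def by (cases "c x") auto
    then show "e2ennreal (- c x) \<le> ennreal (w x)" using e2ennreal_mono by (fastforce simp: e2ennreal_ereal)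
  qed
  with w_fin have "(\<integral>\<^sup>+x. e2ennreal (- c x) \<partial>Q) < \<infinity>" by simp
  with False have c_fin: "(\<integral>\<^sup>+x. e2ennreal (c x) \<partial>Q) < \<infinity>"
    unfolding ereal_expectation_def
    by (cases "\<integral>\<^sup>+x. e2ennreal (c x) \<partial>Q"; cases "\<integral>\<^sup>+x. e2ennreal (- c x) \<partial>Q") (auto simp: enn2ereal_ennreal)
  have "(\<integral>\<^sup>+x. e2ennreal (c x + ereal (w x)) \<partial>Q) \<le> (\<integral>\<^sup>+x. e2ennreal (c x) + ennreal (w x) \<partial>Q)"
  proof (rule nn_integral_mono)
    show "e2ennreal (c x + ereal (w x)) \<le> e2ennreal (c x) + ennreal (w x)" for x
      using w0[of x] by (cases "c x") (auto simp: e2ennreal_ereal ennreal_plus_if intro: ennreal_leI)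
  qed
  also have "\<dots> = (\<integral>\<^sup>+x. e2ennreal (c x) \<partial>Q) + (\<integral>\<^sup>+x. ennreal (w x) \<partial>Q)" by (rule nn_integral_add) auto
  also have "\<dots> < \<infinity>" using c_fin w_fin by simp
  finally have "(\<integral>\<^sup>+x. e2ennreal (c x + ereal (w x)) \<partial>Q) < \<infinity>" .
  note cost = expectation_of_cost[OF c lower this[unfolded w_def]]
  have u': "integrable Q (\<lambda>x. u j (x j))" "(\<integral>x. u j (x j) \<partial>Q) = (\<integral>s. u j s \<partial>\<mu> j)"
    "(\<lambda>x. u j (x j)) \<in> borel_measurable (path_space n)" if j: "j \<in> {2..n}" for j
  proof -
    have j': "j \<in> {1..n}" using j by auto
    show "integrable Q (\<lambda>x. u j (x j))" "(\<integral>x. u j (x j) \<partial>Q) = (\<integral>s. u j s \<partial>\<mu> j)"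
      using integrable_marginal[OF j' u[OF j]] by auto
    have "u j \<in> borel_measurable borel" using borel_measurable_integrable[OF u[OF j]] marginal[OF j'] by simp
    from measurable_compose[OF measurable_component_singleton[OF j'] this]
    show "(\<lambda>x. u j (x j)) \<in> borel_measurable (path_space n)" .
  qed
  define g where "g x = real_of_ereal (c x) - (\<Sum>j=2..n. u j (x j))" for x
  have sum_int: "integrable Q (\<lambda>x. \<Sum>j=2..n. u j (x j))" by (intro Bochner_Integration.integrable_sum u'(1))
  have g: "integrable Q g" unfolding g_def[abs_def] using cost(1) sum_int by simp
  have g_int: "(\<integral>x. g x \<partial>Q) = (\<integral>x. real_of_ereal (c x) \<partial>Q) - (\<Sum>i = 2..n. \<integral>s. u i s \<partial>\<mu> i)"
  proof -
    have "(\<integral>x. (\<Sum>j=2..n. u j (x j)) \<partial>Q) = (\<Sum>j=2..n. \<integral>x. u j (x j) \<partial>Q)"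
      by (rule Bochner_Integration.integral_sum) (rule u'(1))
    also have "\<dots> = (\<Sum>i = 2..n. \<integral>s. u i s \<partial>\<mu> i)" by (intro sum.cong u'(2)) auto
    finally show ?thesis
      unfolding g_def using Bochner_Integration.integral_diff[OF cost(1) sum_int] by simp
  qed
  have gm: "g \<in> borel_measurable (path_space n)"
    unfolding g_def[abs_def] using c by (intro borel_measurable_diff borel_measurable_sum u'(3)) measurable
  have "AE x in Q. c x - ereal (\<Sum>j = 2..n. u j (x j)) \<le> ereal (g x)"
    using cost(2)
  proof eventually_elim
    case (elim x)
    then show ?case unfolding g_def by (cases "c x") auto
  qed
  from c_iter_1_expectation_le[OF n g gm this]
  have "ereal_expectation (\<mu> 1) (\<lambda>s. c_iter c n u 1 (\<lambda>k\<in>{1}. s)) + ereal (\<Sum>i = 2..n. \<integral>s. u i s \<partial>\<mu> i)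
      \<le> ereal (\<integral>x. g x \<partial>Q) + ereal (\<Sum>i = 2..n. \<integral>s. u i s \<partial>\<mu> i)"
    by (rule add_right_mono)
  also have "\<dots> = ereal_expectation Q c" by (simp add: g_int cost(3))
  finally show ?thesis .
qed simp

end

text \<open>
  The penalisation argument, applied to the nonnegative cost \<open>c + \<bar>K\<bar> W\<close> and to the first \<open>N\<close> of the countably many tests. All errors have the form
  \<open>\<epsilon> W\<close> with \<open>W\<close> of linear growth, hence are semistatic and have a small price.
\<close>

lemma strong_duality:
  fixes c :: "(nat \<Rightarrow> real) \<Rightarrow> ereal" and K p p' :: real
  assumes n: "1 \<le> n"
    and \<mu>: "\<And>i. i \<in> {1..n} \<Longrightarrow> prob_space (\<mu> i)" "\<And>i. i \<in> {1..n} \<Longrightarrow> sets (\<mu> i) = sets borel"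
      "\<And>i. i \<in> {1..n} \<Longrightarrow> integrable (\<mu> i) (\<lambda>x. x)"
    and c: "lower_semicontinuous_map (powertop_real {1..n}) c"
    and lower: "\<forall>x\<in>R_space n. ereal (- (\<bar>K\<bar> * (1 + (\<Sum>i=1..n. \<bar>x i\<bar>)))) \<le> c x"
    and p: "p < p'" "\<And>Q. Q \<in> martingale_measures n \<mu> \<Longrightarrow> ereal p' < ereal_expectation Q c"
  shows "\<exists>\<phi> r. semistatic n \<mu> \<phi> r \<and> p \<le> r \<and> (\<forall>x\<in>R_space n. ereal (\<phi> x) \<le> c x)"
proof -
  define W where "W x = 1 + (\<Sum>i=1..n. \<bar>x i\<bar>)" for x :: "nat \<Rightarrow> real"
  define T where "T = 1 + (\<Sum>i=1..n. \<integral>s. \<bar>s\<bar> \<partial>\<mu> i)"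
  have W1: "1 \<le> W x" for x by (simp add: W_def sum_nonneg)
  have T1: "1 \<le> T" by (simp add: T_def sum_nonneg)
  define d where "d x = c x + ereal (\<bar>K\<bar> * W x)" for x
  have W_cont: "continuous_map (powertop_real {1..n}) euclideanreal (\<lambda>x. \<bar>K\<bar> * W x)"
    unfolding W_def
    by (intro continuous_map_real_mult continuous_map_add continuous_map_sum continuous_map_real_abs
        continuous_map_product_projection) auto
  have c_fin: "-\<infinity> < c x" if "x \<in> R_space n" for x
    using bspec[OF lower that] by (cases "c x") auto
  have d_lsc: "lower_semicontinuous_map (powertop_real {1..n}) d"
    unfolding d_def[abs_def] using c_fin by (intro lower_semicontinuous_map_add_real c W_cont) auto
  have d0: "0 \<le> d x" if "x \<in> R_space n" for x
    using bspec[OF lower that] unfolding d_def W_def by (cases "c x") auto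
  define D where "D = {x \<in> R_space n. d x < \<infinity>}"
  define f where "f = from_nat_into (tests n \<mu>)"
  have "moment_test \<mu> 1 \<in> tests n \<mu>" using n by (intro tests_intros) auto
  then have f: "range f = tests n \<mu>"
    unfolding f_def by (intro range_from_nat_into countable_tests) auto
  have "\<exists>N. \<forall>q. finite (set_pmf q) \<and> set_pmf q \<subseteq> D \<longrightarrow>
      p' + \<bar>K\<bar> * T \<le> measure_pmf.expectation q (\<lambda>x. real_of_ereal (d x)) +
        real (Suc N) * (\<Sum>k<N. (max 0 (measure_pmf.expectation q (f k)))\<^sup>2)"
  proof (rule ccontr)
    assume "\<not> ?thesis"
    then have "\<forall>N. \<exists>q. finite (set_pmf q) \<and> set_pmf q \<subseteq> D \<and>
      measure_pmf.expectation q (\<lambda>x. real_of_ereal (d x)) +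
        real (Suc N) * (\<Sum>k<N. (max 0 (measure_pmf.expectation q (f k)))\<^sup>2) \<le> p' + \<bar>K\<bar> * T"
      by (meson linear)
    from choice[OF this] obtain q where q: "\<And>N. finite (set_pmf (q N))" "\<And>N. set_pmf (q N) \<subseteq> D"
      "\<And>N. measure_pmf.expectation (q N) (\<lambda>x. real_of_ereal (d x)) +
        real (Suc N) * (\<Sum>k<N. (max 0 (measure_pmf.expectation (q N) (f k)))\<^sup>2) \<le> p' + \<bar>K\<bar> * T"
      by blast
    have "\<exists>Q\<in>martingale_measures n \<mu>. (\<integral>\<^sup>+x. e2ennreal (d x) \<partial>Q) \<le> ennreal (p' + \<bar>K\<bar> * T)"
      by (rule martingale_measure_of_penalized_sequence[where f = f and q = q])
        (fact \<mu> d_lsc d0 eq_refl[OF f[symmetric]] q(1) q(2)[unfolded D_def] q(3))+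
    then obtain Q where QM: "Q \<in> martingale_measures n \<mu>"
      and Q_le: "(\<integral>\<^sup>+x. e2ennreal (d x) \<partial>Q) \<le> ennreal (p' + \<bar>K\<bar> * T)" by blast
    interpret martingale_coupling n \<mu> Q by standard (fact \<mu>(3) QM)+
    have "(\<integral>\<^sup>+x. e2ennreal (d x) \<partial>Q) < \<infinity>" using Q_le by (rule le_less_trans) simp
    note cost = expectation_of_cost[OF lower_semicontinuous_map_measurable[OF c] lower this[unfolded d_def W_def]]
    have "ereal p' < ereal (\<integral>x. real_of_ereal (c x) \<partial>Q)" using p(2)[OF QM] by (simp add: cost(3))
    moreover have "ennreal ((\<integral>x. real_of_ereal (c x) \<partial>Q) + \<bar>K\<bar> * T) \<le> ennreal (p' + \<bar>K\<bar> * T)"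
      using Q_le cost(4) by (simp add: d_def W_def T_def)
    moreover have "0 \<le> p' + \<bar>K\<bar> * T"
    proof -
      have "0 \<le> measure_pmf.expectation (q 0) (\<lambda>x. real_of_ereal (d x))"
        using q(2)[of 0] d0 by (intro integral_nonneg_AE) (auto simp: AE_measure_pmf_iff D_def real_of_ereal_pos)
      with q(3)[of 0] show ?thesis by simp
    qed
    ultimately show False by (simp add: ennreal_le_iff)
  qed
  then obtain N where N: "\<And>q. finite (set_pmf q) \<Longrightarrow> set_pmf q \<subseteq> D \<Longrightarrow>
      p' + \<bar>K\<bar> * T \<le> measure_pmf.expectation q (\<lambda>x. real_of_ereal (d x)) +
        real (Suc N) * (\<Sum>k\<in>{..<N}. (max 0 (measure_pmf.expectation q (f k)))\<^sup>2)" by blast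
  have "\<forall>k. \<exists>B\<ge>0. \<forall>x. \<bar>f k x\<bar> \<le> B * W x"
    unfolding W_def using f by (intro allI tests_linear_growth) auto
  from choice[OF this] obtain B where B: "\<And>k. 0 \<le> B k" "\<And>k x. \<bar>f k x\<bar> \<le> B k * W x" by blast
  have fB: "\<bar>f k x\<bar> \<le> (\<Sum>k<N. B k) * W x" if "k \<in> {..<N}" for k x
  proof -
    have "B k \<le> (\<Sum>k<N. B k)" using that B(1) by (intro member_le_sum) auto
    then have "B k * W x \<le> (\<Sum>k<N. B k) * W x" using W1[of x] by (intro mult_right_mono) auto
    with B(2)[of k x] show ?thesis by linarith
  qed
  \<comment> \<open>\<open>T\<close> is the price of \<open>W\<close>, so the error term \<open>\<epsilon> W\<close> uses up exactly the gap between \<open>p'\<close> and \<open>p\<close>.\<close>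
  define \<epsilon> where "\<epsilon> = (p' - p) / T"
  have eps: "0 < \<epsilon>" "\<epsilon> * T = p' - p" using p(1) T1 by (auto simp: \<epsilon>_def)
  obtain l where l: "\<And>x. x \<in> D \<Longrightarrow>
      p' + \<bar>K\<bar> * T \<le> real_of_ereal (d x) + (\<Sum>k\<in>{..<N}. l k * f k x) + \<epsilon> * W x"
  proof (rule approximate_multipliers[of "{..<N}" D W "\<lambda>x. real_of_ereal (d x)" f "\<Sum>k<N. B k" "real (Suc N)" \<epsilon> "p' + \<bar>K\<bar> * T"])
    show "0 \<le> real_of_ereal (d x)" if "x \<in> D" for x
      using that d0 by (auto simp: D_def real_of_ereal_pos)
  qed (use W1 fB eps N in auto)
  define \<phi> where "\<phi> x = (p' + \<bar>K\<bar> * T) + (- (\<bar>K\<bar> + \<epsilon>)) * W x + (- 1) * (\<Sum>k\<in>{..<N}. l k * f k x)" for x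
  have \<mu>1: "prob_space (\<mu> 1)" using n by (intro \<mu>(1)) auto
  note const = semistatic_const[where \<mu> = \<mu>, OF n \<mu>1]
  have "semistatic n \<mu> (\<lambda>x. \<Sum>i=1..n. \<bar>x i\<bar>) (\<Sum>i=1..n. \<integral>s. \<bar>s\<bar> \<partial>\<mu> i)"
    using semistatic_coordinate[of _ n \<mu> abs] \<mu>(3) by (intro semistatic_sum const) auto
  then have W_semi: "semistatic n \<mu> W T"
    unfolding W_def[abs_def] T_def by (intro semistatic_add const)
  have "semistatic n \<mu> (\<lambda>x. \<Sum>k\<in>{..<N}. l k * f k x) (\<Sum>k\<in>{..<N}. l k * 0)"
    using f by (intro semistatic_sum semistatic_scale semistatic_tests n \<mu> const) auto
  then have "semistatic n \<mu> \<phi> ((p' + \<bar>K\<bar> * T) + (- (\<bar>K\<bar> + \<epsilon>)) * T + (- 1) * (\<Sum>k\<in>{..<N}. l k * 0))"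
    unfolding \<phi>_def[abs_def] by (intro semistatic_add semistatic_scale const W_semi)
  moreover have "p \<le> (p' + \<bar>K\<bar> * T) + (- (\<bar>K\<bar> + \<epsilon>)) * T + (- 1) * (\<Sum>k\<in>{..<N}. l k * 0)"
    using eps(2) by (simp add: algebra_simps)
  moreover have "ereal (\<phi> x) \<le> c x" if x: "x \<in> R_space n" for x
  proof (cases "c x")
    case (real a)
    then have "x \<in> D" using x by (simp add: D_def d_def)
    from l[OF this] show ?thesis by (simp add: \<phi>_def d_def real algebra_simps)
  qed (use c_fin[OF x] in auto)
  ultimately show ?thesis by blast
qed

theorem proposition2p1:
  fixes n :: nat
    and \<mu> :: "nat \<Rightarrow> real measure"
    and c :: "(nat \<Rightarrow> real) \<Rightarrow> ereal"
    and K :: real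
    and Q' :: "(nat \<Rightarrow> real) measure"
  assumes "n > 2"
    and "\<And>i. i \<in> {1..n} \<Longrightarrow> prob_space (\<mu> i)"
    and "\<And>i. i \<in> {1..n} \<Longrightarrow> sets (\<mu> i) = sets borel"
    and "increasing_convex_order n \<mu>"
    and "\<And>x. x \<in> R_space n \<Longrightarrow> c x > -\<infinity>"
    and "lower_semicontinuous_map (powertop_real {1..n}) c"
    and "\<And>x. x \<in> R_space n \<Longrightarrow> c x \<ge> ereal (- K * (1 + (\<Sum>i = 1..n. \<bar>x i\<bar>)))"
    and "Q' \<in> martingale_measures n \<mu>"
    and "ereal_expectation Q' c < \<infinity>"
  shows "(INF Q\<in>martingale_measures n \<mu>. ereal_expectation Q c) =
    (SUP u\<in>{u :: nat \<Rightarrow> real \<Rightarrow> real. \<forall>i\<in>{2..n}. integrable (\<mu> i) (u i)}.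
       ereal_expectation (\<mu> 1) (\<lambda>s. c_iter c n u 1 (\<lambda>k\<in>{1}. s)) +
       ereal (\<Sum>i = 2..n. \<integral>s. u i s \<partial>\<mu> i))"
proof (rule antisym)
  have n: "1 \<le> n" using assms(1) by simp
  have \<mu>_int: "integrable (\<mu> i) (\<lambda>x. x)" if "i \<in> {1..n}" for i
    using assms(4) that by (simp add: increasing_convex_order_def)
  have lower: "\<forall>x\<in>R_space n. ereal (- (\<bar>K\<bar> * (1 + (\<Sum>i=1..n. \<bar>x i\<bar>)))) \<le> c x"
  proof
    fix x assume x: "x \<in> R_space n"
    have "K * (1 + (\<Sum>i=1..n. \<bar>x i\<bar>)) \<le> \<bar>K\<bar> * (1 + (\<Sum>i=1..n. \<bar>x i\<bar>))"
      by (intro mult_right_mono) (auto intro: add_nonneg_nonneg sum_nonneg)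
    then have "ereal (- (\<bar>K\<bar> * (1 + (\<Sum>i=1..n. \<bar>x i\<bar>)))) \<le> ereal (- K * (1 + (\<Sum>i = 1..n. \<bar>x i\<bar>)))" by simp
    with assms(7)[OF x] show "ereal (- (\<bar>K\<bar> * (1 + (\<Sum>i=1..n. \<bar>x i\<bar>)))) \<le> c x"
      by (rule order_trans[rotated])
  qed
  let ?dual = "\<lambda>u. ereal_expectation (\<mu> 1) (\<lambda>s. c_iter c n u 1 (\<lambda>k\<in>{1}. s)) +
    ereal (\<Sum>i = 2..n. \<integral>s. u i s \<partial>\<mu> i)"
  let ?U = "{u :: nat \<Rightarrow> real \<Rightarrow> real. \<forall>i\<in>{2..n}. integrable (\<mu> i) (u i)}"
  show "(SUP u\<in>?U. ?dual u) \<le> (INF Q\<in>martingale_measures n \<mu>. ereal_expectation Q c)"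
  proof (intro SUP_least INF_greatest)
    fix u Q assume u: "u \<in> ?U" and Q: "Q \<in> martingale_measures n \<mu>"
    interpret martingale_coupling n \<mu> Q by standard (fact \<mu>_int Q)+
    show "?dual u \<le> ereal_expectation Q c"
      using u by (intro weak_duality[OF n lower_semicontinuous_map_measurable[OF assms(6)] lower]) auto
  qed
  show "(INF Q\<in>martingale_measures n \<mu>. ereal_expectation Q c) \<le> (SUP u\<in>?U. ?dual u)"
  proof (rule dense_le)
    fix a assume a: "a < (INF Q\<in>martingale_measures n \<mu>. ereal_expectation Q c)"
    then obtain p' where p': "a < ereal p'" "ereal p' < (INF Q\<in>martingale_measures n \<mu>. ereal_expectation Q c)"
      using ereal_dense2 by blast
    from ereal_dense2[OF p'(1)] obtain p where p: "a < ereal p" "p < p'" by auto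
    have gap: "ereal p' < ereal_expectation Q c" if "Q \<in> martingale_measures n \<mu>" for Q
      using p'(2) INF_lower[OF that] by (rule less_le_trans)
    have "\<exists>\<phi> r. semistatic n \<mu> \<phi> r \<and> p \<le> r \<and> (\<forall>x\<in>R_space n. ereal (\<phi> x) \<le> c x)"
      by (rule strong_duality[where K = K and p' = p']) (fact n assms(2,3,6) \<mu>_int lower p(2) gap)+
    then obtain \<phi> r where hedge: "semistatic n \<mu> \<phi> r" "p \<le> r" "\<And>x. x \<in> R_space n \<Longrightarrow> ereal (\<phi> x) \<le> c x" by blast
    from semistatic_subhedge_value[OF n hedge(1,3)] obtain u where u: "u \<in> ?U" "ereal r \<le> ?dual u" by blast
    have "a \<le> ereal r" using p(1) hedge(2) by (meson ereal_less_eq(3) less_le_not_le order_trans)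
    also have "\<dots> \<le> (SUP u\<in>?U. ?dual u)" using u by (intro SUP_upper2[of u]) auto
    finally show "a \<le> (SUP u\<in>?U. ?dual u)" .
  qed
qed

end
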